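(* If $L(x,u)=L_1(x)+L_2(u)$ with $L_1:\mathbb R^n\to\mathbb R$ continuous and $L_2:\mathbb R^k\to\mathbb R$ convex, then the problem of minimizing $\int_0^1L(x(t),u(t))\,dt$ subject to $\dot x=f(x)+G(x)u$, $x(0)=x^0$, $x(1)=x^1$ does not have an $L_1^k[0,1]$-$\mathcal F_{k,1}^0$ Lavrentiev gap.
   Context: The vector fields $f,g_1,\dots,g_k$ on $\mathbb R^n$ are locally Lipschitz, $G=(g_1,\dots,g_k)$, $x^0,x^1\in\mathbb R^n$. $L:\mathbb R^{n+k}\to\mathbb R$ is continuous, and convex in $u$. On $\mathbb R^n\times[0,+\infty[\times\mathbb R^k$: $\lambda(y,v,w)=L(y,\frac wv)v$ for $v>0$, $\lambda(y,0,w)=\lim_{\eta\to0^+}L(y,\frac w\eta)\eta\in\,]-\infty,+\infty]$. Generalized controls: let $\mathcal T$ be the set of increasing locally absolutely continuous bijections of $[0,+\infty[$ with locally absolutely continuous inverse; locally absolutely continuous functions $g_1,g_2$ on $[0,+\infty[$ are equivalent if $\inf_{\alpha\in\mathcal T}\|g_1-g_2\circ\alpha\|_{L_\infty[0,+\infty[}=0$. $\mathcal F_{k,1}^0$ is the set of equivalence classes $[(V,W)]$ of locally absolutely continuous $(V,W):[0,+\infty[\to\mathbb R^{1+k}$ with $V(0)=0$, $W(0)=0$, $\dot V\ge0$ a.e., infinite total length, and $V(\infty)>1$. Put $(v,w)=(\dot V,\dot W)$, $V^{\#}(1)=\sup\{s\ge0:V(s)\le1\}$, let $y_{(v,w)}$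 be the maximal solution of $\dot y=f(y)v+G(y)w$, $y(0)=x^0$, and, when it is defined on $[0,V^{\#}(1)]$, put $I([(V,W)])=\int_0^{V^{\#}(1)}\lambda(y_{(v,w)},v,w)\,d\tau$ (independent of the representative). For $u\in L_1^k[0,1]$, $U(t)=\int_0^tu\,ds$ and $x_u$ is the trajectory of $\dot x=f(x)+G(x)u$, $x(0)=x^0$; then $I([(t,U)])=\int_0^1L(x_u,u)\,dt$. Lavrentiev gap: the problem (the functional $I$) exhibits an $L_1^k[0,1]$-$\mathcal F_{k,1}^0$ Lavrentiev gap if $$\lim_{\varepsilon\to0^+}\ \inf_{u\in L_1^k[0,1],\ |x_u(1)-x^1|\le\varepsilon}I([(t,U)])\ >\ \inf_{[(V,W)]\in\mathcal F_{k,1}^0,\ y_{(v,w)}(V^{\#}(1))=x^1}I([(V,W)]),$$ where only controls whose trajectories are defined up to the final time are considered, and $\inf\emptyset=+\infty$. *)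

theory Defs
  imports "HOL-Analysis.Analysis" "HOL-Probability.Essential_Supremum"
begin

definition abs_cont_on :: "real \<Rightarrow> real \<Rightarrow> (real \<Rightarrow> 'a::real_normed_vector) \<Rightarrow> bool" where
  "abs_cont_on a b h \<longleftrightarrow>
     (\<forall>\<epsilon>>0. \<exists>\<delta>>0. \<forall>(m::nat) (p :: nat \<Rightarrow> real) q.
        (\<forall>i<m. a \<le> p i \<and> p i \<le> q i \<and> q i \<le> b) \<longrightarrow>
        (\<forall>i<m. \<forall>j<m. i \<noteq> j \<longrightarrow> {p i<..<q i} \<inter> {p j<..<q j} = {}) \<longrightarrow>
        (\<Sum>i<m. q i - p i) < \<delta> \<longrightarrow>
        (\<Sum>i<m. norm (h (q i) - h (p i))) < \<epsilon>)"

(* Functions on [0,+oo[ are represented by functions on real whose values at negative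
   arguments are irrelevant. *)
definition loc_abs_cont :: "(real \<Rightarrow> 'a::real_normed_vector) \<Rightarrow> bool" where
  "loc_abs_cont h \<longleftrightarrow> (\<forall>b>0. abs_cont_on 0 b h)"

definition time_changes :: "(real \<Rightarrow> real) set" where
  "time_changes =
     {\<alpha>. bij_betw \<alpha> {0..} {0..} \<and> strict_mono_on {0..} \<alpha> \<and>
          loc_abs_cont \<alpha> \<and> loc_abs_cont (inv_into {0..} \<alpha>)}"

definition param_equiv :: "(real \<Rightarrow> 'a::real_normed_vector) \<Rightarrow> (real \<Rightarrow> 'a) \<Rightarrow> bool" where
  "param_equiv p q \<longleftrightarrow>
     (INF \<alpha>\<in>time_changes. esssup (lebesgue_on {0..}) (\<lambda>s. ereal (norm (p s - q (\<alpha> s))))) = 0"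

(* A space-time control (V,W) is a single curve p with V = fst o p and W = snd o p, and
   (v,w) is the (almost everywhere existing) derivative of p. *)
definition space_time_controls :: "(real \<Rightarrow> real \<times> (real ^ 'k)) set" where
  "space_time_controls =
     {p. loc_abs_cont p \<and> p 0 = (0, 0) \<and>
         (AE s in lebesgue_on {0..}. 0 \<le> fst (vector_derivative p (at s))) \<and>
         (\<integral>\<^sup>+ s. ennreal (norm (vector_derivative p (at s))) \<partial>lebesgue_on {0..}) = \<infinity> \<and>
         1 < Lim at_top (\<lambda>s. ereal (fst (p s)))}"

definition generalized_controls :: "(real \<Rightarrow> real \<times> (real ^ 'k)) set set" where
  "generalized_controls =
     space_time_controls //
       {(p, q). p \<in> space_time_controls \<and> q \<in> space_time_controls \<and> param_equiv p q}"

definition final_param :: "(real \<Rightarrow> real \<times> (real ^ 'k)) \<Rightarrow> real" where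
  "final_param p = Sup {s. 0 \<le> s \<and> fst (p s) \<le> 1}"

definition control_field ::
    "(real ^ 'n \<Rightarrow> real ^ 'n) \<Rightarrow> ('k \<Rightarrow> real ^ 'n \<Rightarrow> real ^ 'n) \<Rightarrow>
     real ^ 'n \<Rightarrow> real \<Rightarrow> real ^ 'k \<Rightarrow> real ^ 'n" where
  "control_field f g y v w = v *\<^sub>R f y + (\<Sum>j\<in>UNIV. (w $ j) *\<^sub>R g j y)"

definition solution_upto ::
    "(real ^ 'n \<Rightarrow> real ^ 'n) \<Rightarrow> ('k \<Rightarrow> real ^ 'n \<Rightarrow> real ^ 'n) \<Rightarrow> real ^ 'n \<Rightarrow>
     (real \<Rightarrow> real) \<Rightarrow> (real \<Rightarrow> real ^ 'k) \<Rightarrow> real \<Rightarrow> (real \<Rightarrow> real ^ 'n) \<Rightarrow> bool" where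
  "solution_upto f g x0 v w S y \<longleftrightarrow>
     abs_cont_on 0 S y \<and> y 0 = x0 \<and>
     (AE s in lebesgue_on {0..S}.
        (y has_vector_derivative control_field f g (y s) (v s) (w s)) (at s))"

(* For locally Lipschitz fields solutions are unique, so the maximal solution is defined at S
   iff there is a solution on [0,S], and its value at t is the common value at t of the
   solutions on [0,t]. *)
definition trajectory_defined ::
    "(real ^ 'n \<Rightarrow> real ^ 'n) \<Rightarrow> ('k \<Rightarrow> real ^ 'n \<Rightarrow> real ^ 'n) \<Rightarrow> real ^ 'n \<Rightarrow>
     (real \<Rightarrow> real) \<Rightarrow> (real \<Rightarrow> real ^ 'k) \<Rightarrow> real \<Rightarrow> bool" where
  "trajectory_defined f g x0 v w S \<longleftrightarrow> (\<exists>y. solution_upto f g x0 v w S y)"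

definition trajectory ::
    "(real ^ 'n \<Rightarrow> real ^ 'n) \<Rightarrow> ('k \<Rightarrow> real ^ 'n \<Rightarrow> real ^ 'n) \<Rightarrow> real ^ 'n \<Rightarrow>
     (real \<Rightarrow> real) \<Rightarrow> (real \<Rightarrow> real ^ 'k) \<Rightarrow> real \<Rightarrow> real ^ 'n" where
  "trajectory f g x0 v w t = (THE z. \<exists>y. solution_upto f g x0 v w t y \<and> y t = z)"

(* Only arguments v \<ge> 0 matter. *)
definition parametric_lagrangian ::
    "(real ^ 'n \<Rightarrow> real ^ 'k \<Rightarrow> real) \<Rightarrow> real ^ 'n \<Rightarrow> real \<Rightarrow> real ^ 'k \<Rightarrow> ereal" where
  "parametric_lagrangian L y v w =
     (if v > 0 then ereal (L y (w /\<^sub>R v) * v)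
      else Lim (at_right 0) (\<lambda>\<eta>. ereal (L y (w /\<^sub>R \<eta>) * \<eta>)))"

(* Lebesgue integral with values in the extended reals. For Lagrangians convex in the control
   the negative part below always has finite integral, so no oo - oo occurs. *)
definition ereal_integral :: "'a measure \<Rightarrow> ('a \<Rightarrow> ereal) \<Rightarrow> ereal" where
  "ereal_integral M h =
     enn2ereal (\<integral>\<^sup>+ x. e2ennreal (h x) \<partial>M) - enn2ereal (\<integral>\<^sup>+ x. e2ennreal (- h x) \<partial>M)"

context
  fixes L :: "real ^ 'n \<Rightarrow> real ^ 'k \<Rightarrow> real"
    and f :: "real ^ 'n \<Rightarrow> real ^ 'n"
    and g :: "'k \<Rightarrow> real ^ 'n \<Rightarrow> real ^ 'n"
    and x0 :: "real ^ 'n"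
begin

definition generalized_trajectory_defined :: "(real \<Rightarrow> real \<times> (real ^ 'k)) \<Rightarrow> bool" where
  "generalized_trajectory_defined p \<longleftrightarrow>
     trajectory_defined f g x0
       (\<lambda>s. fst (vector_derivative p (at s))) (\<lambda>s. snd (vector_derivative p (at s)))
       (final_param p)"

definition generalized_trajectory :: "(real \<Rightarrow> real \<times> (real ^ 'k)) \<Rightarrow> real \<Rightarrow> real ^ 'n" where
  "generalized_trajectory p =
     trajectory f g x0
       (\<lambda>s. fst (vector_derivative p (at s))) (\<lambda>s. snd (vector_derivative p (at s)))"

definition generalized_cost :: "(real \<Rightarrow> real \<times> (real ^ 'k)) \<Rightarrow> ereal" where
  "generalized_cost p =
     ereal_integral (lebesgue_on {0..final_param p})
       (\<lambda>s. parametric_lagrangian L (generalized_trajectory p s)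
          (fst (vector_derivative p (at s))) (snd (vector_derivative p (at s))))"

definition ordinary_trajectory_defined :: "(real \<Rightarrow> real ^ 'k) \<Rightarrow> bool" where
  "ordinary_trajectory_defined u \<longleftrightarrow> trajectory_defined f g x0 (\<lambda>_. 1) u 1"

definition ordinary_trajectory :: "(real \<Rightarrow> real ^ 'k) \<Rightarrow> real \<Rightarrow> real ^ 'n" where
  "ordinary_trajectory u = trajectory f g x0 (\<lambda>_. 1) u"

definition ordinary_cost :: "(real \<Rightarrow> real ^ 'k) \<Rightarrow> ereal" where
  "ordinary_cost u =
     ereal_integral (lebesgue_on {0..1}) (\<lambda>t. ereal (L (ordinary_trajectory u t) (u t)))"

definition ordinary_inf :: "real ^ 'n \<Rightarrow> real \<Rightarrow> ereal" where
  "ordinary_inf x1 \<epsilon> =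
     Inf {ordinary_cost u | u. u absolutely_integrable_on {0..1} \<and>
            ordinary_trajectory_defined u \<and> norm (ordinary_trajectory u 1 - x1) \<le> \<epsilon>}"

(* The cost and the end point of a class do not depend on the representative; the infimum runs
   over all representatives of all classes. *)
definition generalized_inf :: "real ^ 'n \<Rightarrow> ereal" where
  "generalized_inf x1 =
     Inf {generalized_cost p | c p. c \<in> generalized_controls \<and> p \<in> c \<and>
            generalized_trajectory_defined p \<and>
            generalized_trajectory p (final_param p) = x1}"

definition lavrentiev_gap :: "real ^ 'n \<Rightarrow> bool" where
  "lavrentiev_gap x1 \<longleftrightarrow> Lim (at_right 0) (ordinary_inf x1) > generalized_inf x1"

end

end

theory Submission
  imports Defs
begin

text \<open>Only approximating a given space-time control \<open>(v, w)\<close> on \<open>[0, S]\<close> by ordinary controls is at stake.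
  Waiting a time \<open>e\<close> per unit of parameter and rescaling so that the total time is again 1, one gets
  \<open>v' = \<mu> (v + e)\<close> and \<open>w' = \<mu> w\<close> with \<open>\<mu> = 1 / (1 + e S)\<close>. Since \<open>v' > 0\<close>, this is an ordinary control
  \<open>u = w' / v'\<close> in the time \<open>t = \<integral> v'\<close>; its trajectory is uniformly close to that of \<open>(v, w)\<close> because
  \<open>(v', w')\<close> tends to \<open>(v, w)\<close> in \<open>L\<^sub>1\<close> as \<open>e\<close> tends to 0. The \<open>L1\<close> part of the cost converges by uniform
  continuity. The \<open>L2\<close> part does not depend on the trajectory, and its parametric version is convex and
  positively homogeneous, hence subadditive: passing to \<open>(v', w')\<close> increases it by at most a multiple
  of \<open>e\<close>. This is where the separation \<open>L1 x + L2 u\<close> enters.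

  The measure-theoretic input is that absolutely continuous functions are differentiable almost
  everywhere and are the integrals of their derivatives. Subtracting a function from its variation
  reduces this to monotone functions, where it is the Radon-Nikodym theorem for the
  Lebesgue-Stieltjes measure.\<close>

subsection \<open>Absolutely continuous functions\<close>

text \<open>The obstacle is that \<open>v\<close> may vanish on sets of positive measure, where
  \<open>w / v\<close> is meaningless and the cost is a recession term, possibly infinite. Waiting
  bounds the new time derivative below by \<open>\<mu> * e\<close>, so the inverse time change is
  Lipschitz; the factor \<open>\<mu>\<close> cancels in \<open>w' / v'\<close>, so \<open>L2\<close>
  is only evaluated at \<open>w / (v + e)\<close>. Without separation, shifting the trajectory would
  change the cost by an amount depending on the unbounded control, which uniform continuity on
  compact sets does not bound.

  No limit of the \<open>L2\<close> terms is taken. For every \<open>e > 0\<close> the perspective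
  at \<open>v + e\<close>, minus \<open>e * L2 0\<close>, lies below the parametric one pointwise,
  recession terms included. A finite generalized cost thus also yields integrability of the
  perturbed cost, whose negative part is bounded by an integrable expression in \<open>v\<close> and
  \<open>norm w\<close>.

  Since the ordinary infimum decreases as the tolerance grows, its limit at 0 is a supremum, and
  absence of a gap is one inequality per tolerance and space-time control.\<close>

definition nonoverlapping :: "real \<Rightarrow> real \<Rightarrow> 'i set \<Rightarrow> ('i \<Rightarrow> real) \<Rightarrow> ('i \<Rightarrow> real) \<Rightarrow> bool" where
  "nonoverlapping a b I p q \<longleftrightarrow> finite I \<and> (\<forall>i\<in>I. a \<le> p i \<and> p i \<le> q i \<and> q i \<le> b) \<and>
     (\<forall>i\<in>I. \<forall>j\<in>I. i \<noteq> j \<longrightarrow> {p i<..<q i} \<inter> {p j<..<q j} = {})"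

lemma abs_cont_onI:
  assumes "\<And>e. e > 0 \<Longrightarrow> \<exists>d>0. \<forall>(I::nat set) p q. nonoverlapping a b I p q \<longrightarrow>
      (\<Sum>i\<in>I. q i - p i) < d \<longrightarrow> (\<Sum>i\<in>I. norm (h (q i) - h (p i))) < e"
  shows "abs_cont_on a b h"
  unfolding abs_cont_on_def
proof (intro allI impI)
  fix e :: real assume "e > 0"
  then obtain d where "d > 0" and d: "\<And>(I::nat set) p q. nonoverlapping a b I p q \<Longrightarrow>
      (\<Sum>i\<in>I. q i - p i) < d \<Longrightarrow> (\<Sum>i\<in>I. norm (h (q i) - h (p i))) < e"
    using assms by blast
  show "\<exists>\<delta>>0. \<forall>(m::nat) p q.
        (\<forall>i<m. a \<le> p i \<and> p i \<le> q i \<and> q i \<le> b) \<longrightarrow>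
        (\<forall>i<m. \<forall>j<m. i \<noteq> j \<longrightarrow> {p i<..<q i} \<inter> {p j<..<q j} = {}) \<longrightarrow>
        (\<Sum>i<m. q i - p i) < \<delta> \<longrightarrow>
        (\<Sum>i<m. norm (h (q i) - h (p i))) < e"
  proof (intro exI[of _ d] conjI allI impI \<open>d > 0\<close>)
    fix m :: nat and p q :: "nat \<Rightarrow> real"
    assume "\<forall>i<m. a \<le> p i \<and> p i \<le> q i \<and> q i \<le> b"
      "\<forall>i<m. \<forall>j<m. i \<noteq> j \<longrightarrow> {p i<..<q i} \<inter> {p j<..<q j} = {}" "(\<Sum>i<m. q i - p i) < d"
    then show "(\<Sum>i<m. norm (h (q i) - h (p i))) < e"
      by (intro d) (auto simp: nonoverlapping_def)
  qed
qed

text \<open>Lifts the indices \<open>{..<m}\<close> of the definition to arbitrary finite index sets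
  by means of a bijection. Refinements can then be indexed by pairs, and families of intervals by
  the intervals themselves.\<close>

lemma abs_cont_onE:
  assumes "abs_cont_on a b h" "e > 0"
  obtains d where "d > 0" "\<And>(I::'i set) p q. nonoverlapping a b I p q \<Longrightarrow>
      (\<Sum>i\<in>I. q i - p i) < d \<Longrightarrow> (\<Sum>i\<in>I. norm (h (q i) - h (p i))) < e"
proof -
  obtain d where "d > 0" and d: "\<And>(m::nat) (p :: nat \<Rightarrow> real) q.
        (\<forall>i<m. a \<le> p i \<and> p i \<le> q i \<and> q i \<le> b) \<Longrightarrow>
        (\<forall>i<m. \<forall>j<m. i \<noteq> j \<longrightarrow> {p i<..<q i} \<inter> {p j<..<q j} = {}) \<Longrightarrow>
        (\<Sum>i<m. q i - p i) < d \<Longrightarrow> (\<Sum>i<m. norm (h (q i) - h (p i))) < e"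
    using assms(1)[unfolded abs_cont_on_def, THEN spec, THEN mp, OF assms(2)]
    by (elim exE conjE) blast
  show thesis
  proof (rule that[OF \<open>d > 0\<close>])
    fix I :: "'i set" and p q
    assume no: "nonoverlapping a b I p q" and less: "(\<Sum>i\<in>I. q i - p i) < d"
    have "finite I" using no by (simp add: nonoverlapping_def)
    then obtain \<phi> where \<phi>: "bij_betw \<phi> {..<card I} I"
      using ex_bij_betw_nat_finite[OF \<open>finite I\<close>] by (auto simp: atLeast0LessThan)
    have mem: "\<phi> i \<in> I" if "i < card I" for i
      using \<phi> that by (auto simp: bij_betw_def)
    have inj: "\<phi> i \<noteq> \<phi> j" if "i < card I" "j < card I" "i \<noteq> j" for i j
      using \<phi> that by (auto simp: bij_betw_def inj_on_def)
    have "(\<Sum>i<card I. norm (h (q (\<phi> i)) - h (p (\<phi> i)))) < e"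
    proof (rule d)
      show "\<forall>i<card I. a \<le> p (\<phi> i) \<and> p (\<phi> i) \<le> q (\<phi> i) \<and> q (\<phi> i) \<le> b"
        using no mem by (simp add: nonoverlapping_def)
      show "\<forall>i<card I. \<forall>j<card I. i \<noteq> j \<longrightarrow> {p (\<phi> i)<..<q (\<phi> i)} \<inter> {p (\<phi> j)<..<q (\<phi> j)} = {}"
        using no mem inj unfolding nonoverlapping_def by meson
      show "(\<Sum>i<card I. q (\<phi> i) - p (\<phi> i)) < d"
        using less sum.reindex_bij_betw[OF \<phi>, of "\<lambda>i. q i - p i"] by simp
    qed
    then show "(\<Sum>i\<in>I. norm (h (q i) - h (p i))) < e"
      using sum.reindex_bij_betw[OF \<phi>, of "\<lambda>i. norm (h (q i) - h (p i))"] by simp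
  qed
qed

lemma nonoverlapping_single: "nonoverlapping a b {i} p q \<longleftrightarrow> a \<le> p i \<and> p i \<le> q i \<and> q i \<le> b"
  by (auto simp: nonoverlapping_def)

lemma nonoverlapping_mono:
  "nonoverlapping a b I p q \<Longrightarrow> a' \<le> a \<Longrightarrow> b \<le> b' \<Longrightarrow> nonoverlapping a' b' I p q"
  unfolding nonoverlapping_def by fastforce

lemma nonoverlapping_refine:
  assumes "nonoverlapping a b I p q"
    and "\<And>i. i \<in> I \<Longrightarrow> a' \<le> p' i \<and> p' i \<le> q' i \<and> q' i \<le> b'"
    and "\<And>i. i \<in> I \<Longrightarrow> {p' i<..<q' i} \<subseteq> {p i<..<q i}"
  shows "nonoverlapping a' b' I p' q'"
proof -
  have "{p' i<..<q' i} \<inter> {p' j<..<q' j} = {}" if "i \<in> I" "j \<in> I" "i \<noteq> j" for i j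
    using assms(1,3) that unfolding nonoverlapping_def by (meson disjoint_iff subsetD)
  then show ?thesis using assms(1,2) by (simp add: nonoverlapping_def)
qed

lemma nonoverlapping_measure:
  assumes "nonoverlapping a b I p q"
  shows "(\<Sum>i\<in>I. q i - p i) = measure lebesgue (\<Union>i\<in>I. {p i<..<q i})"
proof -
  have fin: "finite I" using assms by (simp add: nonoverlapping_def)
  have "(\<Sum>i\<in>I. q i - p i) = (\<Sum>i\<in>I. measure lebesgue {p i<..<q i})"
    using assms by (intro sum.cong) (auto simp: nonoverlapping_def)
  also have "\<dots> = measure lebesgue (\<Union>i\<in>I. {p i<..<q i})"
    using assms fin by (intro measure_finite_Union[symmetric])
      (auto simp: nonoverlapping_def disjoint_family_on_def)
  finally show ?thesis .
qed

lemma nonoverlapping_length: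
  assumes "nonoverlapping a b I p q" "a \<le> b"
  shows "(\<Sum>i\<in>I. q i - p i) \<le> b - a"
proof -
  have "(\<Sum>i\<in>I. q i - p i) = measure lebesgue (\<Union>i\<in>I. {p i<..<q i})"
    by (rule nonoverlapping_measure[OF assms(1)])
  also have "\<dots> \<le> measure lebesgue {a..b}"
    using assms by (intro measure_mono_fmeasurable) (fastforce simp: nonoverlapping_def)+
  finally show ?thesis using assms by simp
qed

section \<open>Closure properties of absolute continuity\<close>

lemma abs_cont_on_subinterval:
  assumes "abs_cont_on a b h" "a \<le> a'" "b' \<le> b"
  shows "abs_cont_on a' b' h"
proof (rule abs_cont_onI)
  fix e :: real assume "e > 0"
  then obtain d where "d > 0" "\<And>(I::nat set) p q. nonoverlapping a b I p q \<Longrightarrow>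
      (\<Sum>i\<in>I. q i - p i) < d \<Longrightarrow> (\<Sum>i\<in>I. norm (h (q i) - h (p i))) < e"
    using abs_cont_onE[OF assms(1)] by blast
  then show "\<exists>d>0. \<forall>(I::nat set) p q. nonoverlapping a' b' I p q \<longrightarrow>
      (\<Sum>i\<in>I. q i - p i) < d \<longrightarrow> (\<Sum>i\<in>I. norm (h (q i) - h (p i))) < e"
    using assms(2,3) nonoverlapping_mono by blast
qed

lemma abs_cont_on_imp_uniformly_continuous_on:
  assumes "abs_cont_on a b h"
  shows "uniformly_continuous_on {a..b} h"
  unfolding uniformly_continuous_on_def
proof (intro allI impI)
  fix e :: real assume "e > 0"
  then obtain d where "d > 0" and d: "\<And>(I::nat set) p q. nonoverlapping a b I p q \<Longrightarrow>
      (\<Sum>i\<in>I. q i - p i) < d \<Longrightarrow> (\<Sum>i\<in>I. norm (h (q i) - h (p i))) < e"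
    using abs_cont_onE[OF assms] by blast
  have *: "dist (h y) (h x) < e" if "x \<in> {a..b}" "y \<in> {a..b}" "dist y x < d" "x \<le> y" for x y
    using d[of "{0}" "\<lambda>_. x" "\<lambda>_. y"] that by (auto simp: nonoverlapping_single dist_norm)
  have "dist (h y) (h x) < e" if "x \<in> {a..b}" "y \<in> {a..b}" "dist y x < d" for x y
    using *[of x y] *[of y x] that by (cases "x \<le> y") (auto simp: dist_commute)
  then show "\<exists>d>0. \<forall>x\<in>{a..b}. \<forall>x'\<in>{a..b}. dist x' x < d \<longrightarrow> dist (h x') (h x) < e"
    using \<open>d > 0\<close> by blast
qed

lemma abs_cont_on_imp_continuous_on: "abs_cont_on a b h \<Longrightarrow> continuous_on {a..b} h"
  by (intro uniformly_continuous_imp_continuous abs_cont_on_imp_uniformly_continuous_on)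

text \<open>The common source of the later closure properties: negatives, linear images,
  exponentials of a primitive and solutions of integral equations are all dominated in this sense by
  a function already known to be absolutely continuous.\<close>

lemma abs_cont_on_dominated:
  assumes ac: "abs_cont_on a b T"
    and le: "\<And>x y. a \<le> x \<Longrightarrow> x \<le> y \<Longrightarrow> y \<le> b \<Longrightarrow> norm (h y - h x) \<le> C * norm (T y - T x)"
  shows "abs_cont_on a b h"
proof (rule abs_cont_onI)
  fix e :: real assume "e > 0"
  \<comment> \<open>The divisor \<open>\<bar>C\<bar> + 1\<close> is positive whatever the sign of
    \<open>C\<close>.\<close>
  then have "e / (\<bar>C\<bar> + 1) > 0" by simp
  then obtain d where "d > 0" and d: "\<And>(I::nat set) p q. nonoverlapping a b I p q \<Longrightarrow>
      (\<Sum>i\<in>I. q i - p i) < d \<Longrightarrow> (\<Sum>i\<in>I. norm (T (q i) - T (p i))) < e / (\<bar>C\<bar> + 1)"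
    using abs_cont_onE[OF ac] by blast
  show "\<exists>d>0. \<forall>(I::nat set) p q. nonoverlapping a b I p q \<longrightarrow>
      (\<Sum>i\<in>I. q i - p i) < d \<longrightarrow> (\<Sum>i\<in>I. norm (h (q i) - h (p i))) < e"
  proof (intro exI[of _ d] conjI allI impI \<open>d > 0\<close>)
    fix I :: "nat set" and p q
    assume no: "nonoverlapping a b I p q" and "(\<Sum>i\<in>I. q i - p i) < d"
    then have *: "(\<Sum>i\<in>I. norm (T (q i) - T (p i))) < e / (\<bar>C\<bar> + 1)" by (rule d)
    have "(\<Sum>i\<in>I. norm (h (q i) - h (p i))) \<le> (\<Sum>i\<in>I. (\<bar>C\<bar> + 1) * norm (T (q i) - T (p i)))"
    proof (rule sum_mono)
      fix i assume "i \<in> I"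
      then have "norm (h (q i) - h (p i)) \<le> C * norm (T (q i) - T (p i))"
        using no by (intro le) (auto simp: nonoverlapping_def)
      also have "\<dots> \<le> (\<bar>C\<bar> + 1) * norm (T (q i) - T (p i))"
        by (intro mult_right_mono) auto
      finally show "norm (h (q i) - h (p i)) \<le> (\<bar>C\<bar> + 1) * norm (T (q i) - T (p i))" .
    qed
    also have "\<dots> = (\<bar>C\<bar> + 1) * (\<Sum>i\<in>I. norm (T (q i) - T (p i)))"
      by (simp add: sum_distrib_left)
    also have "\<dots> < e"
      using * by (simp add: pos_less_divide_eq mult.commute)
    finally show "(\<Sum>i\<in>I. norm (h (q i) - h (p i))) < e" .
  qed
qed

lemma abs_cont_on_add:
  assumes "abs_cont_on a b h" "abs_cont_on a b k"
  shows "abs_cont_on a b (\<lambda>x. h x + k x)"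
proof (rule abs_cont_onI)
  fix e :: real assume "e > 0"
  then have "e/2 > 0" by simp
  obtain d1 where "d1 > 0" and d1: "\<And>(I::nat set) p q. nonoverlapping a b I p q \<Longrightarrow>
      (\<Sum>i\<in>I. q i - p i) < d1 \<Longrightarrow> (\<Sum>i\<in>I. norm (h (q i) - h (p i))) < e/2"
    using abs_cont_onE[OF assms(1) \<open>e/2 > 0\<close>] by blast
  obtain d2 where "d2 > 0" and d2: "\<And>(I::nat set) p q. nonoverlapping a b I p q \<Longrightarrow>
      (\<Sum>i\<in>I. q i - p i) < d2 \<Longrightarrow> (\<Sum>i\<in>I. norm (k (q i) - k (p i))) < e/2"
    using abs_cont_onE[OF assms(2) \<open>e/2 > 0\<close>] by blast
  show "\<exists>d>0. \<forall>(I::nat set) p q. nonoverlapping a b I p q \<longrightarrow>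
      (\<Sum>i\<in>I. q i - p i) < d \<longrightarrow> (\<Sum>i\<in>I. norm (h (q i) + k (q i) - (h (p i) + k (p i)))) < e"
  proof (intro exI[of _ "min d1 d2"] conjI allI impI)
    fix I :: "nat set" and p q
    assume *: "nonoverlapping a b I p q" "(\<Sum>i\<in>I. q i - p i) < min d1 d2"
    have "(\<Sum>i\<in>I. norm (h (q i) + k (q i) - (h (p i) + k (p i)))) \<le>
        (\<Sum>i\<in>I. norm (h (q i) - h (p i)) + norm (k (q i) - k (p i)))"
      by (intro sum_mono) norm
    also have "\<dots> < e"
      using d1[of I p q] d2[of I p q] * by (simp add: sum.distrib)
    finally show "(\<Sum>i\<in>I. norm (h (q i) + k (q i) - (h (p i) + k (p i)))) < e" .
  qed (use \<open>d1 > 0\<close> \<open>d2 > 0\<close> in auto)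
qed

lemma abs_cont_on_diff:
  assumes "abs_cont_on a b h" "abs_cont_on a b k"
  shows "abs_cont_on a b (\<lambda>x. h x - k x)"
  using abs_cont_on_add[OF assms(1) abs_cont_on_dominated[OF assms(2), of "\<lambda>x. - k x" 1]]
  by (simp add: norm_minus_commute)

lemma abs_cont_on_bounded_linear:
  assumes "bounded_linear L" "abs_cont_on a b h"
  shows "abs_cont_on a b (\<lambda>x. L (h x))"
proof -
  interpret bounded_linear L by fact
  obtain C where "\<And>x. norm (L x) \<le> norm x * C" using bounded by blast
  then show ?thesis
    by (intro abs_cont_on_dominated[OF assms(2), of _ C]) (simp add: diff[symmetric] mult.commute)
qed

section \<open>Total variation\<close>

text \<open>Valued in \<open>ennreal\<close>, so that the supremum makes sense before the variation
  is known to be finite.\<close>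

definition variation :: "(real \<Rightarrow> 'a::real_normed_vector) \<Rightarrow> real \<Rightarrow> real \<Rightarrow> ennreal" where
  "variation h a b =
     (SUP (I, p, q) \<in> {(I::nat set, p, q). nonoverlapping a b I p q}.
        ennreal (\<Sum>i\<in>I. norm (h (q i) - h (p i))))"

lemma variation_upper:
  assumes "nonoverlapping a b (I::nat set) p q"
  shows "ennreal (\<Sum>i\<in>I. norm (h (q i) - h (p i))) \<le> variation h a b"
  unfolding variation_def using assms by (intro SUP_upper2[of "(I, p, q)"]) auto

lemma variation_least:
  assumes "\<And>(I::nat set) p q. nonoverlapping a b I p q \<Longrightarrow>
     ennreal (\<Sum>i\<in>I. norm (h (q i) - h (p i))) \<le> u"
  shows "variation h a b \<le> u"
  unfolding variation_def using assms by (intro SUP_least) auto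

text \<open>Every interval of a family is cut at \<open>b\<close> with \<open>min\<close> and
  \<open>max\<close>. Pieces that degenerate to a point contribute 0, so both halves keep the same
  index set.\<close>

lemma variation_subadditive:
  assumes "a \<le> b" "b \<le> c"
  shows "variation h a c \<le> variation h a b + variation h b c"
proof (rule variation_least)
  fix I :: "nat set" and p q assume no: "nonoverlapping a c I p q"
  let ?p1 = "\<lambda>i. min (p i) b" and ?q1 = "\<lambda>i. min (q i) b"
  let ?p2 = "\<lambda>i. max (p i) b" and ?q2 = "\<lambda>i. max (q i) b"
  have no1: "nonoverlapping a b I ?p1 ?q1"
    by (rule nonoverlapping_refine[OF no]) (use no assms in \<open>fastforce simp: nonoverlapping_def\<close>)+
  have no2: "nonoverlapping b c I ?p2 ?q2"
    by (rule nonoverlapping_refine[OF no]) (use no assms in \<open>fastforce simp: nonoverlapping_def\<close>)+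
  have "norm (h (q i) - h (p i)) \<le> norm (h (?q1 i) - h (?p1 i)) + norm (h (?q2 i) - h (?p2 i))" for i
  proof -
    have "h (q i) - h (p i) = (h (?q1 i) - h (?p1 i)) + (h (?q2 i) - h (?p2 i))"
      by (auto simp: min_def max_def)
    then show ?thesis by (metis norm_triangle_ineq)
  qed
  then have "(\<Sum>i\<in>I. norm (h (q i) - h (p i))) \<le>
      (\<Sum>i\<in>I. norm (h (?q1 i) - h (?p1 i))) + (\<Sum>i\<in>I. norm (h (?q2 i) - h (?p2 i)))"
    by (simp add: sum.distrib[symmetric] sum_mono)
  then have "ennreal (\<Sum>i\<in>I. norm (h (q i) - h (p i))) \<le>
      ennreal (\<Sum>i\<in>I. norm (h (?q1 i) - h (?p1 i))) + ennreal (\<Sum>i\<in>I. norm (h (?q2 i) - h (?p2 i)))"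
    by (simp add: sum_nonneg ennreal_leI ennreal_plus[symmetric] del: ennreal_plus)
  also have "\<dots> \<le> variation h a b + variation h b c"
    by (intro add_mono variation_upper no1 no2)
  finally show "ennreal (\<Sum>i\<in>I. norm (h (q i) - h (p i))) \<le> variation h a b + variation h b c" .
qed

text \<open>The interval from \<open>x\<close> to \<open>y\<close> is adjoined, under a fresh index,
  to an arbitrary family in \<open>{a..x}\<close>. For real-valued \<open>h\<close> of finite
  variation, this makes both the variation and its difference with \<open>h\<close>
  increasing.\<close>

lemma variation_ge_increment:
  assumes "a \<le> x" "x \<le> y"
  shows "variation h a x + ennreal (norm (h y - h x)) \<le> variation h a y"
proof -
  let ?S = "{(I::nat set, p, q). nonoverlapping a x I p q}"
  have ne: "?S \<noteq> {}" 
    by (auto intro!: exI[of _ "{}"] simp: nonoverlapping_def)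
  have "variation h a x + ennreal (norm (h y - h x)) =
     (SUP (I, p, q) \<in> ?S. ennreal (\<Sum>i\<in>I. norm (h (q i) - h (p i))) + ennreal (norm (h y - h x)))"
    unfolding variation_def using ne
    by (subst ennreal_SUP_add_left[symmetric]) (auto simp: case_prod_beta')
  also have "\<dots> \<le> variation h a y"
  proof (rule SUP_least, clarify)
    fix I :: "nat set" and p q assume no: "nonoverlapping a x I p q"
    have "finite I" using no by (simp add: nonoverlapping_def)
    obtain n where n: "n \<notin> I" using \<open>finite I\<close> ex_new_if_finite by blast
    let ?p = "p(n := x)" and ?q = "q(n := y)"
    have "{p i<..<q i} \<inter> {x<..<y} = {}" if "i \<in> I" for i
      using no that by (fastforce simp: nonoverlapping_def)
    then have "nonoverlapping a y (insert n I) ?p ?q"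
      using no assms n by (fastforce simp: nonoverlapping_def)
    then have "ennreal (\<Sum>i\<in>insert n I. norm (h (?q i) - h (?p i))) \<le> variation h a y"
      by (rule variation_upper)
    moreover have "(\<Sum>i\<in>insert n I. norm (h (?q i) - h (?p i))) =
        norm (h y - h x) + (\<Sum>i\<in>I. norm (h (?q i) - h (?p i)))"
      using n \<open>finite I\<close> by simp
    moreover have "(\<Sum>i\<in>I. norm (h (?q i) - h (?p i))) = (\<Sum>i\<in>I. norm (h (q i) - h (p i)))"
      using n by (intro sum.cong) auto
    ultimately show "ennreal (\<Sum>i\<in>I. norm (h (q i) - h (p i))) + ennreal (norm (h y - h x)) \<le> variation h a y"
      by (simp add: sum_nonneg ennreal_plus[symmetric] add.commute del: ennreal_plus)
  qed
  finally show ?thesis .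
qed

text \<open>An interval shorter than the \<open>d\<close> belonging to the tolerance 1 carries
  variation at most 1, and finitely many steps of length \<open>d / 2\<close> reach
  \<open>b\<close>.\<close>

lemma abs_cont_on_variation_finite:
  assumes ac: "abs_cont_on a b h" and "a \<le> b"
  shows "variation h a b < \<infinity>"
proof -
  obtain d where "d > 0" and d: "\<And>(I::nat set) p q. nonoverlapping a b I p q \<Longrightarrow>
      (\<Sum>i\<in>I. q i - p i) < d \<Longrightarrow> (\<Sum>i\<in>I. norm (h (q i) - h (p i))) < 1"
    using abs_cont_onE[OF ac zero_less_one] by blast
  have small: "variation h x y \<le> 1" if "a \<le> x" "x \<le> y" "y \<le> b" "y - x < d" for x y
  proof (rule variation_least)
    fix I :: "nat set" and p q assume no: "nonoverlapping x y I p q"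
    then have "nonoverlapping a b I p q" using that nonoverlapping_mono by blast
    moreover have "(\<Sum>i\<in>I. q i - p i) < d" using nonoverlapping_length[OF no] that by simp
    ultimately have "(\<Sum>i\<in>I. norm (h (q i) - h (p i))) < 1" by (rule d)
    then show "ennreal (\<Sum>i\<in>I. norm (h (q i) - h (p i))) \<le> 1" by simp
  qed
  have step: "variation h a (min b (a + real n * (d/2))) < \<infinity>" for n
  proof (induction n)
    case 0
    show ?case using small[of a a] assms \<open>d > 0\<close> 
      by (auto intro: le_less_trans)
  next
    case (Suc n)
    let ?x = "min b (a + real n * (d/2))" and ?y = "min b (a + real (Suc n) * (d/2))"
    have xy: "a \<le> ?x" "?x \<le> ?y" "?y \<le> b" "?y - ?x < d"
      using assms \<open>d > 0\<close> by (auto simp: min_def field_simps)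
    have "variation h a ?y \<le> variation h a ?x + variation h ?x ?y"
      by (rule variation_subadditive) (use xy in auto)
    also have "\<dots> < \<infinity>" using Suc small[OF xy] 
      by (simp add: le_less_trans ennreal_add_less_top)
    finally show ?case .
  qed
  obtain n :: nat where "(b - a) / (d/2) \<le> real n" using real_arch_simple by blast
  then have "min b (a + real n * (d/2)) = b" using \<open>d > 0\<close> by (auto simp: min_def field_simps)
  then show ?thesis using step[of n] by simp
qed

text \<open>The variation over each \<open>{p i..q i}\<close> is nearly attained by a finite family
  inside it. All these families together form one nonoverlapping family, indexed by
  \<open>Sigma I J\<close> and of no greater total length, to which the absolute continuity of
  \<open>h\<close> applies.\<close>

lemma abs_cont_on_variation:
  assumes ac: "abs_cont_on a b h" and "a \<le> b"
  shows "abs_cont_on a b (\<lambda>x. enn2real (variation h a x))"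
proof (rule abs_cont_onI)
  fix e :: real assume "e > 0"
  then have "e/2 > 0" by simp
  obtain d where "d > 0" and d: "\<And>(I::(nat\<times>nat) set) p q. nonoverlapping a b I p q \<Longrightarrow>
      (\<Sum>i\<in>I. q i - p i) < d \<Longrightarrow> (\<Sum>i\<in>I. norm (h (q i) - h (p i))) < e/2"
    using abs_cont_onE[OF ac \<open>e/2 > 0\<close>] by blast
  define T where "T x = enn2real (variation h a x)" for x
  have fin: "variation h x y < \<infinity>" if "a \<le> x" "x \<le> y" "y \<le> b" for x y
    by (rule abs_cont_on_variation_finite[OF abs_cont_on_subinterval[OF ac]]) (use that in auto)
  have incr: "norm (T y - T x) \<le> enn2real (variation h x y)" if "a \<le> x" "x \<le> y" "y \<le> b" for x y
  proof -
    have "variation h a y \<le> variation h a x + variation h x y"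
      using that by (intro variation_subadditive)
    then have "T y \<le> T x + enn2real (variation h x y)"
      unfolding T_def using fin[of a x] fin[of x y] that
      by (metis enn2real_mono enn2real_plus ennreal_add_less_top infinity_ennreal_def order_refl order_trans)
    moreover have "variation h a x \<le> variation h a y"
      using variation_ge_increment[of a x y h] that by (meson add_increasing2 order_refl order_trans zero_le le_iff_add)
    then have "T x \<le> T y" unfolding T_def using fin[of a y] that by (intro enn2real_mono) auto
    ultimately show ?thesis by simp
  qed
  show "\<exists>d>0. \<forall>(I::nat set) p q. nonoverlapping a b I p q \<longrightarrow>
      (\<Sum>i\<in>I. q i - p i) < d \<longrightarrow>
      (\<Sum>i\<in>I. norm (enn2real (variation h a (q i)) - enn2real (variation h a (p i)))) < e"
    unfolding T_def[symmetric]
  proof (intro exI[of _ d] conjI allI impI \<open>d > 0\<close>)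
    fix I :: "nat set" and p q
    assume no: "nonoverlapping a b I p q" and less: "(\<Sum>i\<in>I. q i - p i) < d"
    have "finite I" using no by (simp add: nonoverlapping_def)
    have pq: "a \<le> p i" "p i \<le> q i" "q i \<le> b" if "i \<in> I" for i
      using no that by (auto simp: nonoverlapping_def)
    \<comment> \<open>The slack \<open>e / 2\<close> is shared among the intervals; the added 1
      covers an empty \<open>I\<close>.\<close>
    define r where "r = e / (2 * (real (card I) + 1))"
    have "r > 0" using \<open>e > 0\<close> by (simp add: r_def)
    let ?v = "\<lambda>i. enn2real (variation h (p i) (q i))"
    have "\<exists>X. nonoverlapping (p i) (q i) (fst X::nat set) (fst (snd X)) (snd (snd X)) \<and>
        ?v i - r < (\<Sum>j\<in>fst X. norm (h (snd (snd X) j) - h (fst (snd X) j)))" if "i \<in> I" for i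
    \<comment> \<open>A negative bound would be truncated to 0 by \<open>ennreal\<close>; the empty
      family settles that case.\<close>
    proof (cases "?v i - r < 0")
      case True
      then show ?thesis by (intro exI[of _ "({}, \<lambda>_. 0, \<lambda>_. 0)"]) (auto simp: nonoverlapping_def)
    next
      case False
      have "ennreal (?v i - r) < ennreal (?v i)"
        using \<open>r > 0\<close> False by (intro ennreal_lessI) auto
      also have "\<dots> = variation h (p i) (q i)"
        using fin[OF pq[OF that]] by simp
      finally obtain J P Q where JPQ: "nonoverlapping (p i) (q i) (J::nat set) P Q"
        "ennreal (?v i - r) < ennreal (\<Sum>j\<in>J. norm (h (Q j) - h (P j)))"
        unfolding variation_def by (auto simp: less_SUP_iff)
      then have "?v i - r < (\<Sum>j\<in>J. norm (h (Q j) - h (P j)))"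
        using False by (metis ennreal_less_iff not_less)
      then show ?thesis using JPQ(1) by (intro exI[of _ "(J, P, Q)"]) simp
    qed
    then have "\<forall>i\<in>I. \<exists>X. nonoverlapping (p i) (q i) (fst X::nat set) (fst (snd X)) (snd (snd X)) \<and>
        ?v i - r < (\<Sum>j\<in>fst X. norm (h (snd (snd X) j) - h (fst (snd X) j)))"
      by blast
    from bchoice[OF this] obtain X where X: "\<And>i. i \<in> I \<Longrightarrow>
        nonoverlapping (p i) (q i) (fst (X i)::nat set) (fst (snd (X i))) (snd (snd (X i))) \<and>
        ?v i - r < (\<Sum>j\<in>fst (X i). norm (h (snd (snd (X i)) j) - h (fst (snd (X i)) j)))"
      by blast
    define J P Q where "J i = fst (X i)" and "P i = fst (snd (X i))" and "Q i = snd (snd (X i))" for i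
    have J: "nonoverlapping (p i) (q i) (J i) (P i) (Q i)"
      and v: "?v i - r < (\<Sum>j\<in>J i. norm (h (Q i j) - h (P i j)))" if "i \<in> I" for i
      using X[OF that] by (auto simp: J_def P_def Q_def)
    have finJ: "finite (J i)" if "i \<in> I" for i using J[OF that] by (simp add: nonoverlapping_def)
    have PQ: "p i \<le> P i j" "P i j \<le> Q i j" "Q i j \<le> q i" if "i \<in> I" "j \<in> J i" for i j
      using J[OF that(1)] that(2) by (auto simp: nonoverlapping_def)
    let ?K = "Sigma I J"
    have "nonoverlapping a b ?K (\<lambda>(i,j). P i j) (\<lambda>(i,j). Q i j)"
    proof -
      have "{P i j<..<Q i j} \<inter> {P i' j'<..<Q i' j'} = {}"
        if "i \<in> I" "j \<in> J i" "i' \<in> I" "j' \<in> J i'" "(i, j) \<noteq> (i', j')" for i j i' j'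
      proof (cases "i = i'")
        case True
        then show ?thesis using J[OF that(1)] that by (auto simp: nonoverlapping_def)
      next
        case False
        have "{P i j<..<Q i j} \<subseteq> {p i<..<q i}" "{P i' j'<..<Q i' j'} \<subseteq> {p i'<..<q i'}"
          using PQ[OF that(1,2)] PQ[OF that(3,4)]
          by (auto simp: greaterThanLessThan_subseteq_greaterThanLessThan)
        moreover have "{p i<..<q i} \<inter> {p i'<..<q i'} = {}"
          using no that False by (simp add: nonoverlapping_def)
        ultimately show ?thesis by blast
      qed
      moreover have "a \<le> P i j \<and> P i j \<le> Q i j \<and> Q i j \<le> b" if "i \<in> I" "j \<in> J i" for i j
        using PQ[OF that] pq[OF that(1)] by linarith
      ultimately show ?thesis
        unfolding nonoverlapping_def using \<open>finite I\<close> finJ by auto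
    qed
    moreover have "(\<Sum>k\<in>?K. (case k of (i,j) \<Rightarrow> Q i j) - (case k of (i,j) \<Rightarrow> P i j)) < d"
    proof -
      have "(\<Sum>k\<in>?K. (case k of (i,j) \<Rightarrow> Q i j) - (case k of (i,j) \<Rightarrow> P i j)) =
          (\<Sum>i\<in>I. \<Sum>j\<in>J i. Q i j - P i j)"
        using \<open>finite I\<close> finJ by (subst sum.Sigma) (auto intro: sum.cong)
      also have "\<dots> \<le> (\<Sum>i\<in>I. q i - p i)"
        using J pq by (intro sum_mono nonoverlapping_length)
      finally show ?thesis using less by simp
    qed
    ultimately have "(\<Sum>k\<in>?K. norm (h (case k of (i,j) \<Rightarrow> Q i j) - h (case k of (i,j) \<Rightarrow> P i j))) < e/2"
      by (rule d)
    also have "(\<Sum>k\<in>?K. norm (h (case k of (i,j) \<Rightarrow> Q i j) - h (case k of (i,j) \<Rightarrow> P i j))) =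
        (\<Sum>i\<in>I. \<Sum>j\<in>J i. norm (h (Q i j) - h (P i j)))"
      using \<open>finite I\<close> finJ by (subst sum.Sigma) (auto intro: sum.cong)
    finally have *: "(\<Sum>i\<in>I. \<Sum>j\<in>J i. norm (h (Q i j) - h (P i j))) < e/2" .
    have "(\<Sum>i\<in>I. norm (T (q i) - T (p i))) \<le> (\<Sum>i\<in>I. (\<Sum>j\<in>J i. norm (h (Q i j) - h (P i j))) + r)"
      using incr pq v by (intro sum_mono) (smt (verit))
    also have "\<dots> = (\<Sum>i\<in>I. \<Sum>j\<in>J i. norm (h (Q i j) - h (P i j))) + card I * r"
      by (simp add: sum.distrib)
    also have "\<dots> < e/2 + e/2"
    proof -
      have "card I * r \<le> e/2" using \<open>e > 0\<close> by (simp add: r_def field_simps)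
      then show ?thesis using * by simp
    qed
    finally show "(\<Sum>i\<in>I. norm (T (q i) - T (p i))) < e" by simp
  qed
qed

section \<open>Absolutely continuous functions as integrals\<close>

text \<open>A bounded null set is covered by countably many nonoverlapping intervals of total length
  below the \<open>\<delta>\<close> of absolute continuity. The Stieltjes measure of an interval is
  the increment of \<open>F\<close>, so every finite subfamily has measure at most
  \<open>e\<close>.\<close>

lemma interval_measure_absolutely_continuous:
  fixes F :: "real \<Rightarrow> real"
  assumes mono: "mono F" and ac: "\<And>c d. abs_cont_on c d F"
  shows "absolutely_continuous lborel (interval_measure F)"
proof -
  let ?M = "interval_measure F"
  have cont: "continuous_on UNIV F"
  proof -
    have "isCont F x" for x
      using continuous_on_interior[OF abs_cont_on_imp_continuous_on[OF ac[of "x-1" "x+1"]], of x] by simp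
    then show ?thesis by (simp add: continuous_at_imp_continuous_on)
  qed
  have Icc: "emeasure ?M {c..d} = ennreal (F d - F c)" if "c \<le> d" for c d
    using that mono cont by (intro emeasure_interval_measure_Icc) (auto simp: mono_def)
  have null: "emeasure ?M (N \<inter> {c..d}) = 0" if N: "N \<in> null_sets lborel" and "c < d" for N c d
  proof -
    have [measurable]: "N \<in> sets borel" using N by auto
    have "emeasure ?M (N \<inter> {c..d}) \<le> ennreal e" if "e > 0" for e
    proof -
      \<comment> \<open>The index type is \<open>real set\<close> because the covering intervals
        will index themselves, with \<open>Inf\<close> and \<open>Sup\<close> as end points.\<close>
      obtain \<delta> where "\<delta> > 0" and \<delta>: "\<And>(I::real set set) p q. nonoverlapping c d I p q \<Longrightarrow>
          (\<Sum>i\<in>I. q i - p i) < \<delta> \<Longrightarrow> (\<Sum>i\<in>I. norm (F (q i) - F (p i))) < e"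
        using abs_cont_onE[OF ac \<open>e > 0\<close>] by blast
      have "N \<inter> {c..d} \<in> null_sets lebesgue"
        using N by (intro null_sets_completionI null_set_Int2) auto
      then have neg: "negligible (N \<inter> {c..d})" by (simp add: negligible_iff_null_sets)
      obtain \<D> where D: "countable \<D>"
        "\<And>K. K \<in> \<D> \<Longrightarrow> K \<subseteq> cbox c d \<and> K \<noteq> {} \<and> (\<exists>x y. K = cbox x y)"
        "pairwise (\<lambda>A B. interior A \<inter> interior B = {}) \<D>"
        "N \<inter> {c..d} \<subseteq> \<Union>\<D>" "\<Union>\<D> \<in> lmeasurable"
        "measure lebesgue (\<Union>\<D>) \<le> measure lebesgue (N \<inter> {c..d}) + \<delta>/2"
      proof (rule measurable_outer_intervals_bounded[of "N \<inter> {c..d}" c d "\<delta>/2"])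
        show "N \<inter> {c..d} \<in> lmeasurable" by (rule negligible_imp_measurable[OF neg])
      qed (use \<open>\<delta> > 0\<close> that in auto)
      have K: "K = {Inf K..Sup K} \<and> Inf K \<le> Sup K \<and> c \<le> Inf K \<and> Sup K \<le> d" if "K \<in> \<D>" for K
        using D(2)[OF that] by auto
      have fin: "emeasure ?M (\<Union>E) \<le> ennreal e" if E: "finite E" "E \<subseteq> \<D>" for E
      proof -
        have no: "nonoverlapping c d E Inf Sup"
        proof -
          have "{Inf A<..<Sup A} \<inter> {Inf B<..<Sup B} = {}" if "A \<in> E" "B \<in> E" "A \<noteq> B" for A B
          proof -
            have "interior A = {Inf A<..<Sup A}" "interior B = {Inf B<..<Sup B}"
              using K that E by (metis interior_atLeastAtMost_real subsetD)+
            moreover have "interior A \<inter> interior B = {}"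
              using D(3) that E by (auto simp: pairwise_def)
            ultimately show ?thesis by metis
          qed
          then show ?thesis using E K unfolding nonoverlapping_def by blast
        qed
        have "(\<Sum>A\<in>E. Sup A - Inf A) = measure lebesgue (\<Union>A\<in>E. {Inf A<..<Sup A})"
          by (rule nonoverlapping_measure[OF no])
        also have "\<dots> \<le> measure lebesgue (\<Union>\<D>)"
        proof (rule measure_mono_fmeasurable)
          have "{Inf A<..<Sup A} \<subseteq> A" if "A \<in> E" for A
            using K[of A] that E by (metis greaterThanLessThan_subseteq_atLeastAtMost_iff order_refl subsetD)
          then show "(\<Union>A\<in>E. {Inf A<..<Sup A}) \<subseteq> \<Union>\<D>" using E by blast
        qed (use D(5) E in auto)
        also have "\<dots> < \<delta>"
          using D(6) \<open>\<delta> > 0\<close> negligible_imp_measure0[OF neg] by simp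
        finally have less: "(\<Sum>A\<in>E. norm (F (Sup A) - F (Inf A))) < e"
          using no by (intro \<delta>)
        have "emeasure ?M (\<Union>E) \<le> (\<Sum>A\<in>E. emeasure ?M A)"
        proof -
          have "A \<in> sets borel" if "A \<in> E" for A using K[of A] that E
            by (metis atLeastAtMost_borel subsetD)
          then show ?thesis using emeasure_subadditive_finite[of E "\<lambda>x. x" ?M] E by auto
        qed
        also have "\<dots> = (\<Sum>A\<in>E. ennreal (norm (F (Sup A) - F (Inf A))))"
        proof (rule sum.cong[OF refl])
          fix A assume "A \<in> E"
          then have A: "A = {Inf A..Sup A}" "Inf A \<le> Sup A" using K E by blast+
          have "emeasure ?M A = ennreal (F (Sup A) - F (Inf A))" using Icc[OF A(2)] A(1) by simp
          also have "F (Sup A) - F (Inf A) = norm (F (Sup A) - F (Inf A))"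
            using mono A(2) by (simp add: mono_def)
          finally show "emeasure ?M A = ennreal (norm (F (Sup A) - F (Inf A)))" .
        qed
        also have "\<dots> = ennreal (\<Sum>A\<in>E. norm (F (Sup A) - F (Inf A)))"
          by (rule sum_ennreal) auto
        also have "\<dots> \<le> ennreal e" using less by (intro ennreal_leI) simp
        finally show ?thesis .
      qed
      show "emeasure ?M (N \<inter> {c..d}) \<le> ennreal e"
      proof (cases "\<D> = {}")
        case True
        then show ?thesis using D(4) by simp
      next
        case False
        \<comment> \<open>Increasing finite unions exhaust the countable cover, so the bound for
          finite subfamilies passes to the whole of it.\<close>
        let ?U = "\<lambda>n. \<Union>(from_nat_into \<D> ` {..n})"
        have mem: "from_nat_into \<D> n \<in> \<D>" for n by (rule from_nat_into[OF False])
        have U: "\<Union>\<D> = (\<Union>n. ?U n)"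
        proof (intro equalityI subsetI)
          fix x assume "x \<in> \<Union>\<D>"
          then obtain A where "A \<in> \<D>" "x \<in> A" by blast
          moreover obtain n where "A = from_nat_into \<D> n"
            using range_from_nat_into[OF False D(1)] \<open>A \<in> \<D>\<close> by (metis imageE)
          ultimately have "x \<in> ?U n" by blast
          then show "x \<in> (\<Union>n. ?U n)" by blast
        qed (use mem in blast)
        have "?U m \<subseteq> ?U n" if "m \<le> n" for m n
          using that by (intro Union_mono image_mono) auto
        then have incseq: "incseq ?U" unfolding incseq_def by blast
        have "from_nat_into \<D> n \<in> sets borel" for n
          using K[OF mem[of n]] by (metis atLeastAtMost_borel)
        then have meas: "?U n \<in> sets ?M" for n by auto
        have "emeasure ?M (N \<inter> {c..d}) \<le> emeasure ?M (\<Union>n. ?U n)"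
          using D(4) U meas by (intro emeasure_mono) auto
        also have "\<dots> = (SUP n. emeasure ?M (?U n))"
          using meas incseq by (intro SUP_emeasure_incseq[symmetric]) auto
        also have "\<dots> \<le> ennreal e"
          using mem by (intro SUP_least fin) auto
        finally show ?thesis .
      qed
    qed
    then show ?thesis
      by (metis ennreal_le_epsilon add.left_neutral le_zero_eq)
  qed
  show ?thesis
    unfolding absolutely_continuous_def
  proof
    fix N assume N: "N \<in> null_sets (lborel :: real measure)"
    then have [measurable]: "N \<in> sets borel" by auto
    have "(\<Union>n. N \<inter> {- real (Suc n)..real (Suc n)}) \<in> null_sets ?M"
      using null[OF N] by (intro null_sets_UN) (auto simp: null_sets_def)
    also have "(\<Union>n. N \<inter> {- real (Suc n)..real (Suc n)}) = N"
    proof -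
      have "\<exists>n. x \<in> {- real (Suc n)..real (Suc n)}" for x
      proof -
        obtain n where "\<bar>x\<bar> \<le> real n" using real_arch_simple by blast
        then show ?thesis by (intro exI[of _ n]) auto
      qed
      then show ?thesis by blast
    qed
    finally show "N \<in> null_sets ?M" .
  qed
qed

lemma mono_abs_cont_on_imp_indefinite_integral:
  fixes G :: "real \<Rightarrow> real"
  assumes ac: "abs_cont_on a b G" and mono: "mono_on {a..b} G" and "a \<le> b"
  obtains k where "k absolutely_integrable_on {a..b}"
    "\<And>x. x \<in> {a..b} \<Longrightarrow> (k has_integral (G x - G a)) {a..x}"
proof -
  \<comment> \<open>Clamping to \<open>{a..b}\<close> extends \<open>G\<close> by constants, since
    the Stieltjes measure is built from a monotone function on the whole line.\<close>
  define c where "c x = max a (min b x)" for x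
  define F where "F x = G (c x)" for x
  have c: "c x \<in> {a..b}" "c x = x \<longleftrightarrow> x \<in> {a..b}" for x using \<open>a \<le> b\<close> by (auto simp: c_def)
  have c_mono: "x \<le> y \<Longrightarrow> c x \<le> c y" for x y by (auto simp: c_def)
  have "mono F"
    using mono c c_mono unfolding F_def mono_def mono_on_def by blast
  have "abs_cont_on u v F" for u v
  proof (rule abs_cont_onI)
    fix e :: real assume "e > 0"
    then obtain d where "d > 0" and d: "\<And>(I::nat set) p q. nonoverlapping a b I p q \<Longrightarrow>
      (\<Sum>i\<in>I. q i - p i) < d \<Longrightarrow> (\<Sum>i\<in>I. norm (G (q i) - G (p i))) < e"
      using abs_cont_onE[OF ac] by blast
    show "\<exists>d>0. \<forall>(I::nat set) p q. nonoverlapping u v I p q \<longrightarrow>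
      (\<Sum>i\<in>I. q i - p i) < d \<longrightarrow> (\<Sum>i\<in>I. norm (F (q i) - F (p i))) < e"
    proof (intro exI[of _ d] conjI allI impI \<open>d > 0\<close>)
      fix I :: "nat set" and p q
      assume no: "nonoverlapping u v I p q" and less: "(\<Sum>i\<in>I. q i - p i) < d"
      have "nonoverlapping a b I (\<lambda>i. c (p i)) (\<lambda>i. c (q i))"
      proof (rule nonoverlapping_refine[OF no])
        fix i assume "i \<in> I"
        then have "p i \<le> q i" using no by (simp add: nonoverlapping_def)
        then show "a \<le> c (p i) \<and> c (p i) \<le> c (q i) \<and> c (q i) \<le> b"
          using c(1) c_mono by auto
        show "{c (p i)<..<c (q i)} \<subseteq> {p i<..<q i}"
          by (auto simp: c_def min_def max_def split: if_splits)
      qed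
      moreover have "(\<Sum>i\<in>I. c (q i) - c (p i)) < d"
      proof -
        have "c (q i) - c (p i) \<le> q i - p i" if "i \<in> I" for i
          using no that \<open>a \<le> b\<close> by (auto simp: nonoverlapping_def c_def)
        then have "(\<Sum>i\<in>I. c (q i) - c (p i)) \<le> (\<Sum>i\<in>I. q i - p i)" by (rule sum_mono)
        then show ?thesis using less by simp
      qed
      ultimately show "(\<Sum>i\<in>I. norm (F (q i) - F (p i))) < e"
        unfolding F_def by (rule d)
    qed
  qed
  note F_ac = this
  let ?M = "interval_measure F"
  have F_cont: "continuous (at_right x) F" for x
  proof -
    have "isCont F x"
      using continuous_on_interior[OF abs_cont_on_imp_continuous_on[OF F_ac[of "x-1" "x+1"]], of x] by simp
    then show ?thesis by (simp add: continuous_at_imp_continuous_at_within)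
  qed
  have "sets ?M = sets lborel" by simp
  then obtain k where k[measurable]: "k \<in> borel_measurable lborel" and M: "density lborel k = ?M"
    using sigma_finite_measure.Radon_Nikodym[OF sigma_finite_lborel interval_measure_absolutely_continuous[OF \<open>mono F\<close> F_ac]] by blast
  have int: "(\<integral>\<^sup>+t. k t * indicator {a<..x} t \<partial>lborel) = ennreal (G x - G a)" if "x \<in> {a..b}" for x
  proof -
    have "(\<integral>\<^sup>+t. k t * indicator {a<..x} t \<partial>lborel) = emeasure ?M {a<..x}"
      unfolding M[symmetric] by (rule emeasure_density[symmetric]) auto
    also have "\<dots> = ennreal (F x - F a)"
      using \<open>mono F\<close> F_cont that by (intro emeasure_interval_measure_Ioc) (auto simp: mono_def)
    finally show ?thesis using that c(2)[of x] c(2)[of a] by (simp add: F_def)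
  qed
  have fin: "AE t in lborel. k t * indicator {a<..b} t \<noteq> \<infinity>"
    using int[of b] \<open>a \<le> b\<close> by (intro nn_integral_PInf_AE) auto
  \<comment> \<open>The density is finite almost everywhere on \<open>{a<..b}\<close>, so passing to
    real values changes none of the integrals in question.\<close>
  define r where "r t = enn2real (k t)" for t
  have [measurable]: "r \<in> borel_measurable borel" unfolding r_def by simp
  have hi: "(r has_integral (G x - G a)) {a..x}" if x: "x \<in> {a..b}" for x
  proof -
    have "(\<integral>\<^sup>+t. ennreal (r t * indicator {a<..x} t) \<partial>lborel) = (\<integral>\<^sup>+t. k t * indicator {a<..x} t \<partial>lborel)"
    proof (rule nn_integral_cong_AE)
      show "AE t in lborel. ennreal (r t * indicator {a<..x} t) = k t * indicator {a<..x} t"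
        using fin
      proof eventually_elim
        case (elim t)
        then show ?case using x by (auto simp: r_def indicator_def less_top split: if_splits)
      qed
    qed
    then have "((\<lambda>t. r t * indicator {a<..x} t) has_integral (G x - G a)) UNIV"
      using int[OF x] x mono by (intro nn_integral_has_integral) (auto simp: r_def mono_on_def)
    then have "((\<lambda>t. if t \<in> {a<..x} then r t else 0) has_integral (G x - G a)) UNIV"
      by (rule has_integral_eq[rotated]) (auto simp: indicator_def)
    then have "(r has_integral (G x - G a)) {a<..x}"
      by (simp only: has_integral_restrict_UNIV)
    \<comment> \<open>The measure was computed on half-open intervals; only the point
      \<open>a\<close> separates \<open>{a<..x}\<close> from \<open>{a..x}\<close>.\<close>
    moreover have "negligible {t \<in> {a<..x} - {a..x}. r t \<noteq> 0}" "negligible {t \<in> {a..x} - {a<..x}. r t \<noteq> 0}"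
      by (rule negligible_subset[of "{a}"]; auto)+
    ultimately show ?thesis
      using has_integral_spike_set_eq by blast
  qed
  show thesis
  proof (rule that[of r])
    show "r absolutely_integrable_on {a..b}"
      using hi[of b] \<open>a \<le> b\<close> by (intro nonnegative_absolutely_integrable_1) (auto simp: r_def)
  qed (use hi in auto)
qed

lemma abs_cont_on_imp_indefinite_integral_real:
  fixes F :: "real \<Rightarrow> real"
  assumes ac: "abs_cont_on a b F" and "a \<le> b"
  obtains k where "k absolutely_integrable_on {a..b}"
    "\<And>x. x \<in> {a..b} \<Longrightarrow> (k has_integral (F x - F a)) {a..x}"
proof -
  define T where "T x = enn2real (variation F a x)" for x
  have T_ac: "abs_cont_on a b T"
    unfolding T_def by (rule abs_cont_on_variation[OF assms])
  \<comment> \<open>This single estimate makes both \<open>T\<close> and \<open>T - F\<close>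
    increasing, which is the Jordan decomposition of \<open>F\<close>.\<close>
  have incr: "\<bar>F y - F x\<bar> \<le> T y - T x" if "a \<le> x" "x \<le> y" "y \<le> b" for x y
  proof -
    have fin: "variation F a z < \<infinity>" if "a \<le> z" "z \<le> b" for z
      by (rule abs_cont_on_variation_finite[OF abs_cont_on_subinterval[OF ac]]) (use that in auto)
    have "enn2real (variation F a x + ennreal (norm (F y - F x))) \<le> T y"
      unfolding T_def using variation_ge_increment[of a x y F] fin[of y] that
      by (intro enn2real_mono) auto
    then show ?thesis
      using fin[of x] that by (simp add: T_def enn2real_plus)
  qed
  have "T x \<le> T y \<and> T x - F x \<le> T y - F y" if "x \<in> {a..b}" "y \<in> {a..b}" "x \<le> y" for x y
    using incr[of x y] that by auto
  then have "mono_on {a..b} T" "mono_on {a..b} (\<lambda>x. T x - F x)"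
    by (auto intro!: mono_onI)
  note mono = this
  obtain k1 where
    k1: "k1 absolutely_integrable_on {a..b}" "\<And>x. x \<in> {a..b} \<Longrightarrow> (k1 has_integral (T x - T a)) {a..x}"
    using mono_abs_cont_on_imp_indefinite_integral[OF T_ac mono(1) \<open>a \<le> b\<close>] by blast
  obtain k2 where
    k2: "k2 absolutely_integrable_on {a..b}"
      "\<And>x. x \<in> {a..b} \<Longrightarrow> (k2 has_integral ((T x - F x) - (T a - F a))) {a..x}"
    using mono_abs_cont_on_imp_indefinite_integral[OF abs_cont_on_diff[OF T_ac ac] mono(2) \<open>a \<le> b\<close>]
    by blast
  show thesis
  proof (rule that)
    show "(\<lambda>x. k1 x - k2 x) absolutely_integrable_on {a..b}"
      using k1(1) k2(1) by (rule set_integral_diff)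
    fix x assume "x \<in> {a..b}"
    from has_integral_diff[OF k1(2)[OF this] k2(2)[OF this]]
    show "((\<lambda>x. k1 x - k2 x) has_integral (F x - F a)) {a..x}" by (simp add: algebra_simps)
  qed
qed

lemma abs_cont_on_imp_indefinite_integral:
  fixes F :: "real \<Rightarrow> 'a::euclidean_space"
  assumes ac: "abs_cont_on a b F" and "a \<le> b"
  obtains k where "k absolutely_integrable_on {a..b}"
    "\<And>x. x \<in> {a..b} \<Longrightarrow> (k has_integral (F x - F a)) {a..x}"
proof -
  have "\<exists>k. k absolutely_integrable_on {a..b} \<and>
      (\<forall>x\<in>{a..b}. (k has_integral (F x \<bullet> i - F a \<bullet> i)) {a..x})" for i
    using abs_cont_on_imp_indefinite_integral_real[OF
        abs_cont_on_bounded_linear[OF bounded_linear_inner_left ac] \<open>a \<le> b\<close>, of i] by metis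
  then obtain k where k: "\<And>i. k i absolutely_integrable_on {a..b}"
    "\<And>i x. x \<in> {a..b} \<Longrightarrow> (k i has_integral (F x \<bullet> i - F a \<bullet> i)) {a..x}" by metis
  let ?k = "\<lambda>t. \<Sum>i\<in>Basis. k i t *\<^sub>R i"
  have comp: "?k t \<bullet> i = k i t" if "i \<in> Basis" for i t using that by simp
  show thesis
  proof (rule that)
    show "?k absolutely_integrable_on {a..b}"
      unfolding absolutely_integrable_componentwise_iff[where f="?k"] using k(1) comp by simp
    fix x assume "x \<in> {a..b}"
    then show "(?k has_integral (F x - F a)) {a..x}"
      unfolding has_integral_componentwise_iff[where f="?k"] using k(2) comp by (simp add: inner_diff_left)
  qed
qed

section \<open>Lebesgue differentiation and the fundamental theorem\<close>

text \<open>In dimension one the cubes with lower corner \<open>x\<close> are the intervals to the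
  right of \<open>x\<close>, so differentiation along such cubes is one-sided.\<close>

lemma ae_right_derivative_integral:
  fixes k :: "real \<Rightarrow> 'a::euclidean_space"
  assumes "\<And>a b. k integrable_on {a..b}"
  obtains N where "negligible N" "\<And>x e. x \<notin> N \<Longrightarrow> 0 < e \<Longrightarrow>
      \<exists>d>0. \<forall>h. 0 < h \<and> h < d \<longrightarrow> norm (integral {x..x+h} k /\<^sub>R h - k x) < e"
proof (rule integrable_ccontinuous_explicit[of k])
  show "\<And>a b. k integrable_on cbox a b" using assms by simp
  fix N assume "negligible N" and N: "\<And>x e. x \<notin> N \<Longrightarrow> 0 < e \<Longrightarrow>
      \<exists>d>0. \<forall>h. 0 < h \<and> h < d \<longrightarrow> norm (integral (cbox x (x + h *\<^sub>R One)) k /\<^sub>R h ^ DIM(real) - k x) < e"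
  show thesis by (rule that[of N]) (use N \<open>negligible N\<close> in auto)
qed

text \<open>A left-hand difference quotient at \<open>x\<close> is a right-hand one of the reflected
  integrand at \<open>-x\<close>; where both converge the derivative is two-sided. The end points
  are excluded because nothing is assumed about \<open>k\<close> beyond them.\<close>

lemma ae_vector_derivative_indefinite_integral:
  fixes k :: "real \<Rightarrow> 'a::euclidean_space"
  assumes k: "k absolutely_integrable_on {a..b}"
  obtains N where "negligible N"
    "\<And>x. x \<in> {a..b} - N \<Longrightarrow> ((\<lambda>x. integral {a..x} k) has_vector_derivative k x) (at x)"
proof -
  \<comment> \<open>Extension by 0 gives integrability on every interval, as the one-sided lemma and
    the reflection require.\<close>
  define r where "r x = (if x \<in> {a..b} then k x else 0)" for x
  have r: "r absolutely_integrable_on UNIV"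
    using k unfolding r_def[abs_def] absolutely_integrable_restrict_UNIV .
  have r_on: "r integrable_on {u..v}" for u v
    using absolutely_integrable_on_subinterval[OF r, of u v]
    by (auto simp: set_lebesgue_integral_eq_integral)
  have r'_on: "(\<lambda>x. r (- x)) integrable_on {u..v}" for u v
    using r_on[of "-v" "-u"] Henstock_Kurzweil_Integration.integrable_reflect_real[of r "-u" "-v"] by simp
  obtain N1 where N1: "negligible N1" "\<And>x e. x \<notin> N1 \<Longrightarrow> 0 < e \<Longrightarrow>
      \<exists>d>0. \<forall>h. 0 < h \<and> h < d \<longrightarrow> norm (integral {x..x+h} r /\<^sub>R h - r x) < e"
    using ae_right_derivative_integral[OF r_on] by blast
  obtain N2 where N2: "negligible N2" "\<And>x e. x \<notin> N2 \<Longrightarrow> 0 < e \<Longrightarrow>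
      \<exists>d>0. \<forall>h. 0 < h \<and> h < d \<longrightarrow> norm (integral {x..x+h} (\<lambda>x. r (- x)) /\<^sub>R h - r (- x)) < e"
    using ae_right_derivative_integral[OF r'_on] by blast
  let ?N = "N1 \<union> uminus ` N2 \<union> {a, b}"
  have "negligible (uminus ` N2)"
    by (rule negligible_differentiable_image_negligible[OF _ N2(1)])
      (auto intro!: differentiable_on_minus)
  then have "negligible ?N" using N1(1) by (auto intro: negligible_Un)
  moreover have "((\<lambda>x. integral {a..x} k) has_vector_derivative k x) (at x)" if x: "x \<in> {a..b} - ?N" for x
  proof -
    let ?G = "\<lambda>x. integral {a..x} k"
    have ax: "a < x" "x < b" "x \<notin> N1" "-x \<notin> N2" using x by (auto simp: less_le image_iff)
    have r_x: "r x = k x" using x by (simp add: r_def)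
    have G: "integral {u..v} r = ?G v - ?G u" if "a \<le> u" "u \<le> v" "v \<le> b" for u v
    proof -
      have "k integrable_on {a..v}"
        using that set_lebesgue_integral_eq_integral(1)[OF absolutely_integrable_on_subinterval[OF k, of a v]] by auto
      then have "?G u + integral {u..v} k = ?G v"
        using that by (intro Henstock_Kurzweil_Integration.integral_combine) auto
      moreover have "integral {u..v} r = integral {u..v} k"
        by (rule integral_cong) (use that in \<open>auto simp: r_def\<close>)
      ultimately show ?thesis by (simp add: algebra_simps)
    qed
    have refl: "integral {-x..-x+h} (\<lambda>x. r (- x)) = integral {x-h..x} r" for h
      using Henstock_Kurzweil_Integration.integral_reflect_real[of x "x - h" r] by (simp add: algebra_simps)
    have "((\<lambda>y. (?G y - ?G x) /\<^sub>R (y - x)) \<longlongrightarrow> k x) (at x)"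
    proof (rule tendstoI)
      fix e :: real assume "e > 0"
      obtain d1 where "d1 > 0" and d1: "\<And>h. 0 < h \<Longrightarrow> h < d1 \<Longrightarrow> norm (integral {x..x+h} r /\<^sub>R h - k x) < e"
        using N1(2)[OF ax(3) \<open>e > 0\<close>] r_x by auto
      obtain d2 where "d2 > 0" and d2: "\<And>h. 0 < h \<Longrightarrow> h < d2 \<Longrightarrow> norm (integral {x-h..x} r /\<^sub>R h - k x) < e"
        using N2(2)[OF ax(4) \<open>e > 0\<close>] r_x refl by auto
      let ?d = "min (min d1 d2) (min (x - a) (b - x))"
      have "?d > 0" using \<open>d1 > 0\<close> \<open>d2 > 0\<close> ax by simp
      moreover have "dist ((?G y - ?G x) /\<^sub>R (y - x)) (k x) < e" if "y \<noteq> x" "dist y x < ?d" for y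
      proof (cases "x < y")
        case True
        then show ?thesis using d1[of "y - x"] G[of x y] that ax by (auto simp: dist_norm)
      next
        case False
        have "(?G y - ?G x) /\<^sub>R (y - x) = (?G x - ?G y) /\<^sub>R (x - y)"
          by (metis (no_types, lifting) minus_diff_eq scaleR_minus_left scaleR_minus_right inverse_minus_eq minus_minus)
        then show ?thesis using d2[of "x - y"] G[of y x] that ax False by (auto simp: dist_norm)
      qed
      ultimately show "\<forall>\<^sub>F y in at x. dist ((?G y - ?G x) /\<^sub>R (y - x)) (k x) < e"
        unfolding eventually_at by blast
    qed
    then have "((\<lambda>y. norm ((?G y - ?G x) /\<^sub>R (y - x) - k x)) \<longlongrightarrow> 0) (at x)"
      by (intro tendsto_norm_zero LIM_zero)
    moreover have "\<forall>\<^sub>F y in at x. norm ((?G y - ?G x) /\<^sub>R (y - x) - k x) =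
        norm (?G y - ?G x - (y - x) *\<^sub>R k x) / norm (y - x)"
      using eventually_neq_at_within[of x x UNIV]
    proof eventually_elim
      case (elim y)
      then have "?G y - ?G x - (y - x) *\<^sub>R k x = (y - x) *\<^sub>R ((?G y - ?G x) /\<^sub>R (y - x) - k x)"
        by (simp add: scaleR_right_diff_distrib)
      then show ?case using elim by simp
    qed
    ultimately have "((\<lambda>y. norm (?G y - ?G x - (y - x) *\<^sub>R k x) / norm (y - x)) \<longlongrightarrow> 0) (at x)"
      by (rule Lim_transform_eventually)
    then show ?thesis
      by (simp add: has_vector_derivative_def has_derivative_iff_norm bounded_linear_scaleR_left)
  qed
  ultimately show thesis by (rule that)
qed

lemma AE_lebesgue_on_Icc_iff:
  "(AE s in lebesgue_on {a..b::real}. P s) \<longleftrightarrow> (\<exists>N. negligible N \<and> (\<forall>s\<in>{a..b} - N. P s))"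
proof -
  have "(AE s in lebesgue_on {a..b}. P s) \<longleftrightarrow> (AE s in lebesgue. s \<in> {a..b} \<longrightarrow> P s)"
    by (rule AE_restrict_space_iff) auto
  also have "\<dots> \<longleftrightarrow> (\<exists>N. negligible N \<and> {s. \<not> (s \<in> {a..b} \<longrightarrow> P s)} \<subseteq> N)"
    by (rule eventually_ae_filter_negligible)
  finally show ?thesis by blast
qed

lemma abs_cont_on_ae_derivative:
  fixes F :: "real \<Rightarrow> 'a::euclidean_space"
  assumes ac: "abs_cont_on a b F" and "a \<le> b"
  obtains k N where "k absolutely_integrable_on {a..b}"
    "\<And>x. x \<in> {a..b} \<Longrightarrow> (k has_integral (F x - F a)) {a..x}"
    "negligible N" "\<And>x. x \<in> {a..b} - N \<Longrightarrow> (F has_vector_derivative k x) (at x)"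
proof -
  obtain k where k: "k absolutely_integrable_on {a..b}"
    "\<And>x. x \<in> {a..b} \<Longrightarrow> (k has_integral (F x - F a)) {a..x}"
    using abs_cont_on_imp_indefinite_integral[OF assms] by blast
  obtain N where N: "negligible N"
    "\<And>x. x \<in> {a..b} - N \<Longrightarrow> ((\<lambda>x. integral {a..x} k) has_vector_derivative k x) (at x)"
    using ae_vector_derivative_indefinite_integral[OF k(1)] by blast
  show thesis
  proof (rule that[OF k])
    show "negligible (N \<union> {a, b})" using N(1) by (auto intro: negligible_Un)
    fix x assume x: "x \<in> {a..b} - (N \<union> {a, b})"
    have "((\<lambda>x. F a + integral {a..x} k) has_vector_derivative k x) (at x)"
      using has_vector_derivative_add[OF has_vector_derivative_const N(2)] x by simp
    then show "(F has_vector_derivative k x) (at x)"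
    proof (rule has_vector_derivative_transform_within_open[of _ _ _ "{a<..<b}"])
      fix y assume "y \<in> {a<..<b}"
      then show "F a + integral {a..y} k = F y" using k(2)[of y] by (auto dest: integral_unique)
    qed (use x in auto)
  qed
qed

text \<open>Derivatives at a point are unique, so any almost-everywhere derivative agrees almost
  everywhere with the density found before. This lets the fundamental theorem be applied to the
  velocity prescribed by a control system or to \<open>vector_derivative\<close>.\<close>

lemma abs_cont_on_has_integral_derivative:
  fixes F :: "real \<Rightarrow> 'a::euclidean_space"
  assumes ac: "abs_cont_on a b F" and "a \<le> b"
    and ae: "AE s in lebesgue_on {a..b}. (F has_vector_derivative k s) (at s)"
  shows "k absolutely_integrable_on {a..b}"
    and "\<And>x y. a \<le> x \<Longrightarrow> x \<le> y \<Longrightarrow> y \<le> b \<Longrightarrow> (k has_integral (F y - F x)) {x..y}"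
proof -
  obtain r N where r: "r absolutely_integrable_on {a..b}"
    "\<And>x. x \<in> {a..b} \<Longrightarrow> (r has_integral (F x - F a)) {a..x}"
    "negligible N" "\<And>x. x \<in> {a..b} - N \<Longrightarrow> (F has_vector_derivative r x) (at x)"
    using abs_cont_on_ae_derivative[OF assms(1,2)] by blast
  obtain M where M: "negligible M" "\<And>x. x \<in> {a..b} - M \<Longrightarrow> (F has_vector_derivative k x) (at x)"
    using ae unfolding AE_lebesgue_on_Icc_iff by blast
  have neg: "negligible (N \<union> M)" using r(3) M(1) by (rule negligible_Un)
  have eq: "k x = r x" if "x \<in> {a..b} - (N \<union> M)" for x
    using r(4)[of x] M(2)[of x] that vector_derivative_unique_at by blast
  show "k absolutely_integrable_on {a..b}"
    using r(1) by (rule absolutely_integrable_spike[OF _ neg]) (use eq in auto)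
  fix x y assume xy: "a \<le> x" "x \<le> y" "y \<le> b"
  have "(k has_integral (F x - F a)) {a..x}" if "x \<in> {a..b}" for x
    using r(2)[OF that] by (rule has_integral_spike[OF neg, rotated]) (use eq that in auto)
  then have x: "(k has_integral (F x - F a)) {a..x}" and y: "(k has_integral (F y - F a)) {a..y}"
    using xy by auto
  have "k integrable_on {x..y}"
    using integrable_on_subinterval[OF has_integral_integrable[OF y]] xy by auto
  then have "(k has_integral (integral {x..y} k)) {x..y}" by (rule integrable_integral)
  moreover have "F x - F a + integral {x..y} k = F y - F a"
    using has_integral_combine[OF xy(1,2) x calculation] y by (rule has_integral_unique)
  then have "integral {x..y} k = F y - F x" by (simp add: eq_diff_eq algebra_simps)
  ultimately show "(k has_integral (F y - F x)) {x..y}" by simp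
qed

section \<open>Absolute continuity of indefinite integrals and consequences\<close>

text \<open>At every point at most one of the open intervals is active, so the sum of the restricted
  integrands stays below \<open>r\<close>. Closed intervals could share end points, hence the
  passage to open ones.\<close>

lemma sum_integral_nonoverlapping_le:
  fixes r :: "real \<Rightarrow> real"
  assumes no: "nonoverlapping a b I p q" and r: "r integrable_on {a..b}"
    and nonneg: "\<And>x. x \<in> {a..b} \<Longrightarrow> 0 \<le> r x"
  shows "(\<Sum>i\<in>I. integral {p i..q i} r) \<le> integral {a..b} r"
proof -
  have fin: "finite I" using no by (simp add: nonoverlapping_def)
  have pq: "a \<le> p i" "p i \<le> q i" "q i \<le> b" if "i \<in> I" for i
    using no that by (auto simp: nonoverlapping_def)
  let ?h = "\<lambda>i x. if x \<in> {p i<..<q i} then r x else 0"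
  have "(?h i has_integral (integral {p i..q i} r)) {a..b}" if "i \<in> I" for i
  proof -
    have "r integrable_on {p i..q i}"
      using integrable_on_subinterval[OF r] pq[OF that] by auto
    then have "(r has_integral (integral {p i..q i} r)) {p i<..<q i}"
      using has_integral_Icc_iff_Ioo by blast
    moreover have "{p i<..<q i} \<subseteq> {a..b}" using pq[OF that] by auto
    ultimately show ?thesis by (simp only: has_integral_restrict)
  qed
  then have "((\<lambda>x. \<Sum>i\<in>I. ?h i x) has_integral (\<Sum>i\<in>I. integral {p i..q i} r)) {a..b}"
    using fin by (intro has_integral_sum)
  then show ?thesis
  proof (rule has_integral_le[OF _ integrable_integral[OF r]])
    fix x assume x: "x \<in> {a..b}"
    show "(\<Sum>i\<in>I. ?h i x) \<le> r x"
    proof (cases "\<exists>i\<in>I. x \<in> {p i<..<q i}")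
      case True
      then obtain i where i: "i \<in> I" "x \<in> {p i<..<q i}" by blast
      have "?h j x = (if j = i then r x else 0)" if "j \<in> I" for j
      proof (cases "j = i")
        case False
        then have "{p i<..<q i} \<inter> {p j<..<q j} = {}"
          using no i(1) that unfolding nonoverlapping_def by blast
        then have "x \<notin> {p j<..<q j}" using i(2) by blast
        then show ?thesis using False by (simp only: if_False)
      qed (use i in simp)
      then have "(\<Sum>i\<in>I. ?h i x) = (\<Sum>j\<in>I. if j = i then r x else 0)" by (intro sum.cong) auto
      also have "\<dots> = r x" using fin i by simp
      finally show ?thesis by simp
    next
      case False
      then have "(\<Sum>i\<in>I. ?h i x) = 0" by (intro sum.neutral) auto
      then show ?thesis using nonneg[OF x] by simp
    qed
  qed
qed

text \<open>The norm of \<open>k\<close> is split into its truncation at height \<open>n\<close>,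
  whose integrals are at most \<open>n\<close> times the length, and a remainder \<open>?r\<close>
  whose total integral is below \<open>e / 2\<close> wherever the intervals lie.\<close>

lemma abs_cont_on_indefinite_integral:
  fixes k :: "real \<Rightarrow> 'a::euclidean_space"
  assumes k: "k absolutely_integrable_on {a..b}"
  shows "abs_cont_on a b (\<lambda>x. integral {a..x} k)"
proof (rule abs_cont_onI)
  fix e :: real assume "e > 0"
  let ?n = "\<lambda>x. norm (k x)"
  let ?m = "\<lambda>n x. min (?n x) (real n)"
  have n_int: "?n absolutely_integrable_on {a..b}" using absolutely_integrable_norm[OF k] by (simp add: o_def)
  have m_int: "?m n absolutely_integrable_on {a..b}" for n
    using n_int by (intro absolutely_integrable_min_1) auto
  have lim: "(\<lambda>n. integral {a..b} (?m n)) \<longlonglongrightarrow> integral {a..b} ?n"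
  proof (rule dominated_convergence(2)[where h = ?n])
    show "?m n integrable_on {a..b}" for n using m_int by (simp add: set_lebesgue_integral_eq_integral)
    show "?n integrable_on {a..b}" using n_int by (simp add: set_lebesgue_integral_eq_integral)
    show "norm (?m n x) \<le> ?n x" for n x by auto
    fix x
    obtain n0 where "?n x \<le> real n0" using real_arch_simple by blast
    then have "\<forall>\<^sub>F n in sequentially. ?m n x = ?n x"
      by (intro eventually_sequentiallyI[of n0]) (auto simp: min_def)
    then show "(\<lambda>n. ?m n x) \<longlonglongrightarrow> ?n x" by (rule tendsto_eventually)
  qed
  obtain n where n: "integral {a..b} ?n - integral {a..b} (?m n) < e/2"
  proof -
    from lim \<open>e > 0\<close> have "\<forall>\<^sub>F n in sequentially. dist (integral {a..b} (?m n)) (integral {a..b} ?n) < e/2"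
      by (intro tendstoD) auto
    then obtain n where "dist (integral {a..b} (?m n)) (integral {a..b} ?n) < e/2"
      using eventually_happens'[OF sequentially_bot] by blast
    then show thesis by (intro that[of n], unfold dist_real_def) linarith
  qed
  let ?r = "\<lambda>x. ?n x - ?m n x"
  have r_int: "?r integrable_on {a..b}"
    using n_int m_int[of n] by (intro integrable_diff) (simp_all add: set_lebesgue_integral_eq_integral)
  have r_small: "integral {a..b} ?r < e/2"
    using n n_int m_int[of n] by (simp add: Henstock_Kurzweil_Integration.integral_diff set_lebesgue_integral_eq_integral)
  \<comment> \<open>Chosen for \<open>n * d \<le> e / 2\<close>; the added 1 allows
    \<open>n = 0\<close>.\<close>
  define d where "d = e / (2 * (real n + 1))"
  have "d > 0" using \<open>e > 0\<close> by (simp add: d_def)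
  show "\<exists>d>0. \<forall>(I::nat set) p q. nonoverlapping a b I p q \<longrightarrow>
      (\<Sum>i\<in>I. q i - p i) < d \<longrightarrow> (\<Sum>i\<in>I. norm (integral {a..q i} k - integral {a..p i} k)) < e"
  proof (intro exI[of _ d] conjI allI impI \<open>d > 0\<close>)
    fix I :: "nat set" and p q
    assume no: "nonoverlapping a b I p q" and less: "(\<Sum>i\<in>I. q i - p i) < d"
    have "norm (integral {a..q i} k - integral {a..p i} k) \<le> integral {p i..q i} ?r + n * (q i - p i)"
      if "i \<in> I" for i
    proof -
      have pq: "a \<le> p i" "p i \<le> q i" "q i \<le> b" using no that by (auto simp: nonoverlapping_def)
      have k_on: "k integrable_on {u..v}" "?n integrable_on {u..v}" "?r integrable_on {u..v}" if "a \<le> u" "v \<le> b" for u v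
        using that integrable_on_subinterval[OF _ _] k n_int r_int
        by (auto intro!: integrable_on_subinterval[of _ "{a..b}" u v] simp: set_lebesgue_integral_eq_integral)
      have "integral {a..p i} k + integral {p i..q i} k = integral {a..q i} k"
        using pq by (intro Henstock_Kurzweil_Integration.integral_combine k_on) auto
      then have "integral {a..q i} k - integral {a..p i} k = integral {p i..q i} k" by (simp add: algebra_simps)
      also have "norm \<dots> \<le> integral {p i..q i} (\<lambda>x. ?r x + n)"
        using pq k_on by (intro integral_norm_bound_integral integrable_add) auto
      also have "\<dots> = integral {p i..q i} ?r + n * (q i - p i)"
        using pq k_on by (subst Henstock_Kurzweil_Integration.integral_add) auto
      finally show ?thesis .
    qed
    then have "(\<Sum>i\<in>I. norm (integral {a..q i} k - integral {a..p i} k)) \<le>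
        (\<Sum>i\<in>I. integral {p i..q i} ?r + n * (q i - p i))"
      by (intro sum_mono)
    also have "\<dots> = (\<Sum>i\<in>I. integral {p i..q i} ?r) + n * (\<Sum>i\<in>I. q i - p i)"
      by (simp add: sum.distrib sum_distrib_left)
    also have "\<dots> < e/2 + e/2"
    proof (rule add_less_le_mono)
      show "(\<Sum>i\<in>I. integral {p i..q i} ?r) < e/2"
        using sum_integral_nonoverlapping_le[OF no r_int] r_small by auto
      have "n * (\<Sum>i\<in>I. q i - p i) \<le> n * d" using less by (intro mult_left_mono) auto
      also have "\<dots> \<le> e/2" using \<open>e > 0\<close> by (simp add: d_def field_simps)
      finally show "n * (\<Sum>i\<in>I. q i - p i) \<le> e/2" .
    qed
    finally show "(\<Sum>i\<in>I. norm (integral {a..q i} k - integral {a..p i} k)) < e" by simp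
  qed
qed

lemma abs_cont_on_mono_if_derivative_nonneg:
  fixes F :: "real \<Rightarrow> real"
  assumes "abs_cont_on a b F" "a \<le> b"
    and "AE s in lebesgue_on {a..b}. (F has_vector_derivative k s) (at s)"
    and "AE s in lebesgue_on {a..b}. 0 \<le> k s"
    and "a \<le> x" "x \<le> y" "y \<le> b"
  shows "F x \<le> F y"
proof -
  obtain N where N: "negligible N" "\<And>s. s \<in> {a..b} - N \<Longrightarrow> 0 \<le> k s"
    using assms(4) unfolding AE_lebesgue_on_Icc_iff by blast
  have "(k has_integral (F y - F x)) {x..y}"
    by (rule abs_cont_on_has_integral_derivative(2)[OF assms(1-3,5-7)])
  then have "((\<lambda>s. \<bar>k s\<bar>) has_integral (F y - F x)) {x..y}"
    by (rule has_integral_spike[OF N(1), rotated]) (use N(2) assms(5-7) in auto)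
  then have "0 \<le> F y - F x" by (rule has_integral_nonneg) auto
  then show ?thesis by simp
qed

text \<open>Luzin's property (N). By the change of variables formula on the set where \<open>F\<close> is
  differentiable, the image of that set already has full measure in \<open>F ` {a..b}\<close>.\<close>

lemma abs_cont_on_negligible_image:
  fixes F :: "real \<Rightarrow> real"
  assumes ac: "abs_cont_on a b F" and "a \<le> b"
    and mono: "\<And>x y. a \<le> x \<Longrightarrow> x < y \<Longrightarrow> y \<le> b \<Longrightarrow> F x < F y"
    and neg: "negligible M" and sub: "M \<subseteq> {a..b}"
  shows "negligible (F ` M)"
proof -
  obtain k N where k: "k absolutely_integrable_on {a..b}"
    "\<And>x. x \<in> {a..b} \<Longrightarrow> (k has_integral (F x - F a)) {a..x}"
    "negligible N" "\<And>x. x \<in> {a..b} - N \<Longrightarrow> (F has_vector_derivative k x) (at x)"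
    using abs_cont_on_ae_derivative[OF ac \<open>a \<le> b\<close>] by blast
  let ?S = "{a..b} - (M \<union> N)"
  have negMN: "negligible (M \<union> N)" using neg k(3) by (rule negligible_Un)
  have inj: "inj_on F {a..b}"
    using mono by (intro linorder_inj_onI) (auto simp: less_imp_neq)
  have k_nonneg: "0 \<le> k x" if x: "x \<in> ?S" "a < x" "x < b" for x
  proof (rule ccontr)
    assume "\<not> 0 \<le> k x"
    then have "(F has_real_derivative k x) (at x)" "k x < 0"
      using k(4)[of x] x by (auto simp: has_real_derivative_iff_has_vector_derivative)
    then obtain d where "d > 0" "\<And>h. h > 0 \<Longrightarrow> h < d \<Longrightarrow> F (x + h) < F x"
      using DERIV_neg_dec_right by blast
    then have "F (x + min (d/2) (b - x)) < F x" using x by auto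
    moreover have "F x < F (x + min (d/2) (b - x))" using x \<open>d > 0\<close> by (intro mono) auto
    ultimately show False by simp
  qed
  have S_sets: "?S \<in> sets lebesgue" by (rule sets.Diff) (auto intro: negligible_imp_sets[OF negMN])
  have "(\<lambda>x. \<bar>k x\<bar> *\<^sub>R (1::real)) absolutely_integrable_on ?S \<and> integral ?S (\<lambda>x. \<bar>k x\<bar> *\<^sub>R 1) = F b - F a"
  proof -
    \<comment> \<open>Absolute continuity enters here: the derivative integrates to the whole
      increment, so the image of the good set loses none of the length
      \<open>F b - F a\<close>.\<close>
    have "((\<lambda>x. \<bar>k x\<bar>) has_integral (F b - F a)) {a..b}"
    proof (rule has_integral_spike)
      show "negligible (M \<union> N \<union> {a, b})" using negMN by (intro negligible_Un) auto
      show "(k has_integral (F b - F a)) {a..b}" using k(2)[of b] \<open>a \<le> b\<close> by simp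
      show "\<bar>k x\<bar> = k x" if "x \<in> {a..b} - (M \<union> N \<union> {a, b})" for x
        using k_nonneg[of x] that by (auto simp: less_le)
    qed
    moreover have "negligible ({a..b} - ?S \<union> (?S - {a..b}))"
      by (rule negligible_subset[OF negMN]) auto
    ultimately have hi: "((\<lambda>x. \<bar>k x\<bar>) has_integral (F b - F a)) ?S"
      by (subst has_integral_spike_set_eq[of _ "{a..b}"]) (auto intro: negligible_subset[OF negMN])
    then show ?thesis
      by (auto simp: integral_unique intro!: nonnegative_absolutely_integrable_1)
  qed
  then have img: "(\<lambda>_. 1::real) absolutely_integrable_on F ` ?S \<and> integral (F ` ?S) (\<lambda>_. 1::real) = F b - F a"
    using has_absolute_integral_change_of_variables_real[OF S_sets, of F k "\<lambda>_. 1::real" "F b - F a"]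
      k(4) inj_on_subset[OF inj]
    by (auto simp: has_real_derivative_iff_has_vector_derivative intro: has_vector_derivative_at_within)
  have img_sub: "F ` {a..b} \<subseteq> {F a..F b}"
  proof clarify
    fix x assume "x \<in> {a..b}"
    then show "F x \<in> {F a..F b}" using mono[of a x] mono[of x b] by (cases "a = x"; cases "x = b") auto
  qed
  have meas: "F ` ?S \<in> lmeasurable"
    using img by (simp add: lmeasurable_iff_integrable_on set_lebesgue_integral_eq_integral)
  then have "measure lebesgue (F ` ?S) = F b - F a"
    using img by (simp add: lmeasure_integral)
  moreover have "F a \<le> F b" using img_sub \<open>a \<le> b\<close> by (auto simp: image_subset_iff)
  ultimately have "measure lebesgue ({F a..F b} - F ` ?S) = 0"
    using meas img_sub by (subst measurable_measure_Diff) auto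
  then have "negligible ({F a..F b} - F ` ?S)"
    using meas by (subst negligible_iff_measure0) (auto intro: fmeasurable.Diff)
  moreover have "F ` M \<subseteq> {F a..F b} - F ` ?S"
  proof -
    have "F x \<notin> F ` ?S" if "x \<in> M" for x
      using inj sub that unfolding inj_on_def by blast
    moreover have "F x \<in> {F a..F b}" if "x \<in> M" for x
      using img_sub sub that by (meson image_subset_iff subsetD)
    ultimately show ?thesis by (simp only: image_subset_iff Diff_iff) simp
  qed
  ultimately show ?thesis by (rule negligible_subset)
qed

subsection \<open>Gronwall and Picard under Caratheodory conditions\<close>

lemma absolutely_integrable_scaleR_continuous:
  fixes z :: "real \<Rightarrow> 'a::euclidean_space"
  assumes "h absolutely_integrable_on {a..b}" "continuous_on {a..b} z"
  shows "(\<lambda>s. h s *\<^sub>R z s) absolutely_integrable_on {a..b}"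
proof -
  have "(\<lambda>s. (\<lambda>y c. c *\<^sub>R y) (z s) (h s)) absolutely_integrable_on {a..b}"
  proof (rule absolutely_integrable_bounded_measurable_product[where f = z and g = h])
    show "bilinear (\<lambda>(y::'a) (c::real). c *\<^sub>R y)"
      by (auto simp: bilinear_def linear_iff algebra_simps)
    show "z \<in> borel_measurable (lebesgue_on {a..b})"
      using assms(2) by (intro continuous_imp_measurable_on_sets_lebesgue) auto
    show "bounded (z ` {a..b})"
      using assms(2) by (intro compact_imp_bounded compact_continuous_image) auto
  qed (use assms in auto)
  then show ?thesis by simp
qed

lemma integral_le_subinterval:
  fixes h :: "real \<Rightarrow> real"
  assumes "h absolutely_integrable_on {a..b}" "\<And>s. s \<in> {a..b} \<Longrightarrow> 0 \<le> h s" "t \<in> {a..b}"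
  shows "0 \<le> integral {a..t} h" "integral {a..t} h \<le> integral {a..b} h"
proof -
  have h: "h integrable_on {a..b}" by (rule set_lebesgue_integral_eq_integral(1)[OF assms(1)])
  have t: "h integrable_on {a..t}" by (rule integrable_on_subinterval[OF h]) (use assms(3) in auto)
  show "0 \<le> integral {a..t} h" by (rule Henstock_Kurzweil_Integration.integral_nonneg[OF t]) (use assms(2,3) in auto)
  show "integral {a..t} h \<le> integral {a..b} h"
    by (rule integral_subset_le[OF _ t h]) (use assms(2,3) in auto)
qed

text \<open>The weight \<open>exp (2 * H)\<close>, with \<open>H\<close> a primitive of the Lipschitz modulus \<open>h\<close>, makes the
  Picard operator a contraction with factor 1/2.\<close>

lemma has_integral_exp_weight:
  fixes h :: "real \<Rightarrow> real"
  assumes h: "h absolutely_integrable_on {0..S}" "\<And>s. s \<in> {0..S} \<Longrightarrow> 0 \<le> h s" and t: "t \<in> {0..S}"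
  defines "H \<equiv> \<lambda>t. integral {0..t} h"
  shows "((\<lambda>s. h s * exp (2 * H s)) has_integral ((exp (2 * H t) - 1) / 2)) {0..t}"
proof -
  have "0 \<le> S" using t by auto
  have H_ac: "abs_cont_on 0 S H"
    unfolding H_def by (rule abs_cont_on_indefinite_integral[OF h(1)])
  have H_bound: "0 \<le> H x \<and> H x \<le> H S" if "x \<in> {0..S}" for x
    unfolding H_def using integral_le_subinterval[OF h that] by simp
  obtain N where N: "negligible N" "\<And>x. x \<in> {0..S} - N \<Longrightarrow> (H has_vector_derivative h x) (at x)"
    unfolding H_def using ae_vector_derivative_indefinite_integral[OF h(1)] by blast
  \<comment> \<open>Below \<open>c\<close> the exponential is Lipschitz with constant
    \<open>exp c\<close>. This carries absolute continuity from \<open>H\<close> to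
    \<open>exp (2 * H)\<close>, after which the chain rule and the fundamental theorem evaluate the
    integral.\<close>
  have exp_diff: "\<bar>exp u - exp v\<bar> \<le> exp c * \<bar>u - v\<bar>" if "u \<le> c" "v \<le> c" for u v c :: real
  proof -
    have *: "exp u - exp v \<le> exp c * (u - v)" if "v \<le> u" "u \<le> c" for u v :: real
    proof -
      have "1 - exp (v - u) \<le> u - v" using exp_ge_add_one_self[of "v - u"] by linarith
      then have "exp u * (1 - exp (v - u)) \<le> exp u * (u - v)" by (rule mult_left_mono) simp
      moreover have "exp u * (u - v) \<le> exp c * (u - v)" using that by (intro mult_right_mono) auto
      ultimately show ?thesis by (simp add: algebra_simps exp_diff)
    qed
    show ?thesis
    proof (cases "v \<le> u")
      case True
      then show ?thesis using *[OF True \<open>u \<le> c\<close>] by simp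
    next
      case False
      then show ?thesis using *[of u v] \<open>v \<le> c\<close> by (simp add: abs_minus_commute)
    qed
  qed
  let ?E = "\<lambda>x. exp (2 * H x) / 2"
  have E_ac: "abs_cont_on 0 S ?E"
  proof (rule abs_cont_on_dominated[OF H_ac])
    fix x y assume "0 \<le> x" "x \<le> y" "y \<le> S"
    then have "\<bar>exp (2 * H y) - exp (2 * H x)\<bar> \<le> exp (2 * H S) * \<bar>2 * H y - 2 * H x\<bar>"
      using H_bound by (intro exp_diff) auto
    moreover have "\<bar>2 * H y - 2 * H x\<bar> = 2 * norm (H y - H x)"
      by (metis abs_mult abs_numeral real_norm_def right_diff_distrib)
    moreover have "norm (?E y - ?E x) = \<bar>exp (2 * H y) - exp (2 * H x)\<bar> / 2"
      by (metis abs_divide abs_numeral diff_divide_distrib real_norm_def)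
    ultimately show "norm (?E y - ?E x) \<le> exp (2 * H S) * norm (H y - H x)" by simp
  qed
  have "AE s in lebesgue_on {0..S}. (?E has_vector_derivative (h s * exp (2 * H s))) (at s)"
    unfolding AE_lebesgue_on_Icc_iff
  proof (intro exI[of _ N] conjI ballI N(1))
    fix s assume "s \<in> {0..S} - N"
    then have "(H has_real_derivative h s) (at s)"
      using N(2) by (simp add: has_real_derivative_iff_has_vector_derivative)
    then show "(?E has_vector_derivative (h s * exp (2 * H s))) (at s)"
      unfolding has_real_derivative_iff_has_vector_derivative[symmetric]
      by (auto intro!: derivative_eq_intros)
  qed
  from abs_cont_on_has_integral_derivative(2)[OF E_ac \<open>0 \<le> S\<close> this, of 0 t] t
  show ?thesis by (simp add: H_def diff_divide_distrib)
qed

text \<open>Let \<open>M\<close> be the maximum of \<open>\<phi>\<close> against the weight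
  \<open>exp (- 2 * H)\<close>. At a maximum point the hypothesis gives
  \<open>M * exp (2 * H) \<le> A + M * (exp (2 * H) - 1) / 2\<close>, and the last term is absorbed
  on the left. The factors 2 are the price of this absorption; the later uses only need a bound
  proportional to \<open>A\<close>.\<close>

lemma gronwall:
  fixes h \<phi> :: "real \<Rightarrow> real"
  assumes h: "h absolutely_integrable_on {0..S}" "\<And>s. s \<in> {0..S} \<Longrightarrow> 0 \<le> h s"
    and \<phi>: "continuous_on {0..S} \<phi>" "\<And>s. s \<in> {0..S} \<Longrightarrow> 0 \<le> \<phi> s"
    and le: "\<And>t. t \<in> {0..S} \<Longrightarrow> \<phi> t \<le> A + integral {0..t} (\<lambda>s. h s * \<phi> s)"
    and t: "t \<in> {0..S}"
  shows "\<phi> t \<le> 2 * A * exp (2 * integral {0..S} h)"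
proof -
  define H where "H t = integral {0..t} h" for t
  have weight: "((\<lambda>s. h s * exp (2 * H s)) has_integral ((exp (2 * H t) - 1) / 2)) {0..t}" if "t \<in> {0..S}" for t
    unfolding H_def using has_integral_exp_weight[OF h that] by simp
  have H_cont: "continuous_on {0..S} H"
    unfolding H_def by (rule abs_cont_on_imp_continuous_on[OF abs_cont_on_indefinite_integral[OF h(1)]])
  let ?w = "\<lambda>s. \<phi> s * exp (- 2 * H s)"
  have "continuous_on {0..S} ?w"
    using \<phi>(1) H_cont by (intro continuous_intros)
  then obtain t0 where t0: "t0 \<in> {0..S}" and max: "\<And>s. s \<in> {0..S} \<Longrightarrow> ?w s \<le> ?w t0"
    using continuous_attains_sup[of "{0..S}" ?w] t by auto
  define M where "M = ?w t0"
  have "0 \<le> M" using \<phi>(2)[OF t0] by (simp add: M_def)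
  have le_M: "\<phi> s \<le> M * exp (2 * H s)" if "s \<in> {0..S}" for s
    using max[OF that] by (simp add: M_def exp_minus field_simps)
  have h\<phi>: "(\<lambda>s. h s * \<phi> s) integrable_on {0..t0}"
    using set_lebesgue_integral_eq_integral(1)[OF absolutely_integrable_scaleR_continuous[OF h(1) \<phi>(1)]] t0
    by (auto intro: integrable_on_subinterval)
  have "\<phi> t0 \<le> A + integral {0..t0} (\<lambda>s. h s * \<phi> s)" by (rule le[OF t0])
  also have "integral {0..t0} (\<lambda>s. h s * \<phi> s) \<le> M * ((exp (2 * H t0) - 1) / 2)"
  proof (rule has_integral_le[OF integrable_integral[OF h\<phi>] has_integral_mult_right[OF weight[OF t0]]])
    fix s assume "s \<in> {0..t0}"
    then have "s \<in> {0..S}" using t0 by auto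
    then have "h s * \<phi> s \<le> h s * (M * exp (2 * H s))" using h(2) le_M by (intro mult_left_mono) auto
    then show "h s * \<phi> s \<le> M * (h s * exp (2 * H s))" by (simp add: algebra_simps)
  qed
  finally have "M * exp (2 * H t0) \<le> A + M * ((exp (2 * H t0) - 1) / 2)"
    by (simp add: M_def exp_minus field_simps)
  then have "M * exp (2 * H t0) \<le> 2 * A - M" by (simp add: field_simps)
  then have "M * exp (2 * H t0) \<le> 2 * A" using \<open>0 \<le> M\<close> by simp
  moreover have "0 \<le> H t0" unfolding H_def using integral_le_subinterval[OF h t0] by simp
  then have "M * 1 \<le> M * exp (2 * H t0)" using \<open>0 \<le> M\<close> by (intro mult_left_mono) auto
  ultimately have "M \<le> 2 * A" by simp
  have "\<phi> t \<le> M * exp (2 * H t)" by (rule le_M[OF t])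
  also have "\<dots> \<le> 2 * A * exp (2 * H t)" using \<open>M \<le> 2 * A\<close> by (intro mult_right_mono) auto
  also have "\<dots> \<le> 2 * A * exp (2 * integral {0..S} h)"
    using integral_le_subinterval(2)[OF h t] \<open>M \<le> 2 * A\<close> \<open>0 \<le> M\<close> by (intro mult_left_mono) (auto simp: H_def)
  finally show ?thesis .
qed

text \<open>Picard iteration in the weighted supremum norm, carried out with explicit bounds: each
  step halves the weighted distance, and the weight lies between 1 and \<open>exp (2 * H S)\<close>.
  The telescoping series of the iterates therefore converges uniformly by the Weierstrass
  test.\<close>

lemma caratheodory_solution_exists:
  fixes \<Phi> :: "real \<Rightarrow> 'a::euclidean_space \<Rightarrow> 'a"
  assumes h: "h absolutely_integrable_on {0..S}" "\<And>s. s \<in> {0..S} \<Longrightarrow> 0 \<le> h s"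
    and int: "\<And>z. continuous_on {0..S} z \<Longrightarrow> (\<lambda>s. \<Phi> s (z s)) absolutely_integrable_on {0..S}"
    and lip: "\<And>s z z'. s \<in> {0..S} \<Longrightarrow> norm (\<Phi> s z - \<Phi> s z') \<le> h s * norm (z - z')"
  obtains z where "continuous_on {0..S} z"
    "\<And>t. t \<in> {0..S} \<Longrightarrow> z t = x0 + integral {0..t} (\<lambda>s. \<Phi> s (z s))"
proof (cases "0 \<le> S")
  case False
  then show thesis by (intro that[of "\<lambda>_. x0"]) auto
next
  case True
  define H where "H t = integral {0..t} h" for t
  have weight: "((\<lambda>s. h s * exp (2 * H s)) has_integral ((exp (2 * H t) - 1) / 2)) {0..t}" if "t \<in> {0..S}" for t
    unfolding H_def using has_integral_exp_weight[OF h that] by simp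
  define T where "T z t = x0 + integral {0..t} (\<lambda>s. \<Phi> s (z s))" for z t
  define Z where "Z n = (T ^^ n) (\<lambda>_. x0)" for n
  have Z_Suc: "Z (Suc n) = T (Z n)" for n by (simp add: Z_def)
  have T_cont: "continuous_on {0..S} (T z)" if "continuous_on {0..S} z" for z
    unfolding T_def
    by (intro continuous_intros abs_cont_on_imp_continuous_on[OF abs_cont_on_indefinite_integral[OF int[OF that]]])
  have Z_cont: "continuous_on {0..S} (Z n)" for n
    by (induction n) (auto simp: Z_Suc T_cont Z_def[of 0])
  have int_on: "(\<lambda>s. \<Phi> s (z s)) integrable_on {0..t}" if "continuous_on {0..S} z" "t \<in> {0..S}" for z t
    using set_lebesgue_integral_eq_integral(1)[OF int[OF that(1)]] that(2)
    by (auto intro: integrable_on_subinterval)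
  have T_diff: "norm (T z t - T z' t) \<le> D * exp (2 * H t) / 2"
    if z: "continuous_on {0..S} z" "continuous_on {0..S} z'" and t: "t \<in> {0..S}" and "0 \<le> D"
      and D: "\<And>s. s \<in> {0..S} \<Longrightarrow> norm (z s - z' s) \<le> D * exp (2 * H s)" for z z' t D
  proof -
    have "T z t - T z' t = integral {0..t} (\<lambda>s. \<Phi> s (z s) - \<Phi> s (z' s))"
      using int_on z t by (simp add: T_def Henstock_Kurzweil_Integration.integral_diff)
    also have "norm \<dots> \<le> integral {0..t} (\<lambda>s. D * (h s * exp (2 * H s)))"
    proof (rule integral_norm_bound_integral)
      show "(\<lambda>s. \<Phi> s (z s) - \<Phi> s (z' s)) integrable_on {0..t}"
        using int_on z t by (intro integrable_diff)
      show "(\<lambda>s. D * (h s * exp (2 * H s))) integrable_on {0..t}"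
        using has_integral_mult_right[OF weight[OF t]] by blast
      fix s assume "s \<in> {0..t}"
      then have s: "s \<in> {0..S}" using t by auto
      have "norm (\<Phi> s (z s) - \<Phi> s (z' s)) \<le> h s * (D * exp (2 * H s))"
        using lip[OF s] D[OF s] h(2)[OF s] by (meson mult_left_mono order_trans)
      then show "norm (\<Phi> s (z s) - \<Phi> s (z' s)) \<le> D * (h s * exp (2 * H s))" by (simp add: algebra_simps)
    qed
    also have "\<dots> = D * ((exp (2 * H t) - 1) / 2)"
      using has_integral_mult_right[OF weight[OF t]] by (rule integral_unique)
    also have "\<dots> \<le> D * exp (2 * H t) / 2" using \<open>0 \<le> D\<close> by (simp add: field_simps)
    finally show ?thesis .
  qed
  have "bounded ((\<lambda>t. Z 1 t - Z 0 t) ` {0..S})"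
    using Z_cont by (intro compact_imp_bounded compact_continuous_image continuous_intros) auto
  then obtain D where "D > 0" and D: "\<And>t. t \<in> {0..S} \<Longrightarrow> norm (Z 1 t - Z 0 t) \<le> D"
    unfolding bounded_pos by auto
  have H_bound: "0 \<le> H t \<and> H t \<le> H S" if "t \<in> {0..S}" for t
    unfolding H_def using integral_le_subinterval[OF h that] by simp
  have step: "norm (Z (Suc n) t - Z n t) \<le> D * (1/2)^n * exp (2 * H t)" if "t \<in> {0..S}" for n t
    using that
  proof (induction n arbitrary: t)
    case 0
    have "D * 1 \<le> D * exp (2 * H t)" using \<open>D > 0\<close> H_bound[OF 0] by (intro mult_left_mono) auto
    then show ?case using D[OF 0] by simp
  next
    case (Suc n)
    have "norm (T (Z (Suc n)) t - T (Z n) t) \<le> (D * (1/2)^n) * exp (2 * H t) / 2"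
      using \<open>D > 0\<close> Suc by (intro T_diff Z_cont) auto
    then show ?case by (simp add: Z_Suc)
  qed
  let ?M = "\<lambda>n. D * (1/2)^n * exp (2 * H S)"
  have "summable ?M"
    by (intro summable_mult2 summable_mult summable_geometric) auto
  moreover have "norm (Z (Suc n) t - Z n t) \<le> ?M n" if "t \<in> {0..S}" for n t
    using step[OF that, of n] H_bound[OF that] \<open>D > 0\<close>
    by (meson order_trans mult_left_mono exp_le_cancel_iff mult_nonneg_nonneg less_imp_le zero_le_power zero_le_divide_1_iff zero_le_numeral)
  ultimately have ul: "uniform_limit {0..S} (\<lambda>n t. \<Sum>i<n. Z (Suc i) t - Z i t)
      (\<lambda>t. suminf (\<lambda>i. Z (Suc i) t - Z i t)) sequentially"
    by (intro Weierstrass_m_test) auto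
  define z where "z t = x0 + suminf (\<lambda>i. Z (Suc i) t - Z i t)" for t
  have Z_lim: "uniform_limit {0..S} Z z sequentially"
  proof -
    have "uniform_limit {0..S} (\<lambda>n t. x0 + (\<Sum>i<n. Z (Suc i) t - Z i t)) z sequentially"
      unfolding z_def by (intro uniform_limit_add uniform_limit_const ul)
    moreover have "x0 + (\<Sum>i<n. Z (Suc i) t - Z i t) = Z n t" for n t
      using sum_lessThan_telescope[of "\<lambda>i. Z i t" n] by (simp add: Z_def[of 0])
    ultimately show ?thesis by simp
  qed
  have z_cont: "continuous_on {0..S} z"
    by (rule uniform_limit_theorem[OF _ Z_lim]) (use Z_cont in auto)
  have "z t = T z t" if t: "t \<in> {0..S}" for t
  proof (rule LIMSEQ_unique)
    show "(\<lambda>n. Z (Suc n) t) \<longlonglongrightarrow> z t"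
      by (intro LIMSEQ_Suc tendsto_uniform_limitI[OF Z_lim t])
    show "(\<lambda>n. Z (Suc n) t) \<longlonglongrightarrow> T z t"
    proof (rule tendstoI)
      fix e :: real assume "e > 0"
      \<comment> \<open>Cancels the weight at \<open>t\<close>: a uniform distance below
        \<open>d\<close> becomes at most \<open>d * exp (2 * H t) / 2 = e / 2\<close> after one
        Picard step.\<close>
      define d where "d = e * exp (- 2 * H t)"
      have "d > 0" using \<open>e > 0\<close> by (simp add: d_def)
      from uniform_limitD[OF Z_lim this]
      show "\<forall>\<^sub>F n in sequentially. dist (Z (Suc n) t) (T z t) < e"
      proof eventually_elim
        case (elim n)
        have "norm (Z n s - z s) \<le> d * exp (2 * H s)" if "s \<in> {0..S}" for s
        proof -
          have "norm (Z n s - z s) \<le> d * 1" using elim that by (auto simp: dist_norm less_imp_le)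
          also have "\<dots> \<le> d * exp (2 * H s)" using \<open>d > 0\<close> H_bound[OF that] by (intro mult_left_mono) auto
          finally show ?thesis .
        qed
        then have "norm (T (Z n) t - T z t) \<le> d * exp (2 * H t) / 2"
          using \<open>d > 0\<close> by (intro T_diff Z_cont z_cont t) auto
        also have "\<dots> < e" using \<open>e > 0\<close> by (simp add: d_def exp_minus)
        finally show ?case by (simp add: dist_norm Z_Suc)
      qed
    qed
  qed
  then show thesis by (intro that[OF z_cont]) (simp add: T_def)
qed

subsection \<open>Trajectories of control systems\<close>

text \<open>The l1 norm on control values. A common bound for \<open>f\<close> and all
  \<open>g j\<close> bounds the control field by that constant times this weight.\<close>

definition control_weight :: "real \<Rightarrow> real ^ 'k \<Rightarrow> real" where
  "control_weight v w = \<bar>v\<bar> + (\<Sum>j\<in>UNIV. \<bar>w $ j\<bar>)"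

lemma control_weight_nonneg [simp]: "0 \<le> control_weight v w"
  by (simp add: control_weight_def sum_nonneg)

lemma control_weight_absolutely_integrable:
  assumes "v absolutely_integrable_on A" "w absolutely_integrable_on A"
  shows "(\<lambda>s. control_weight (v s) (w s)) absolutely_integrable_on A"
proof -
  have "(\<lambda>s. w s $ j) absolutely_integrable_on A" for j
    using absolutely_integrable_component[OF assms(2), of "axis j 1"] by (simp add: inner_axis)
  then show ?thesis
    using assms(1) unfolding control_weight_def real_norm_def[symmetric]
    by (intro set_integral_add absolutely_integrable_sum absolutely_integrable_norm[unfolded o_def]) auto
qed

lemma control_field_diff:
  "control_field f g y v w - control_field f g y v' w' = control_field f g y (v - v') (w - w')"
  by (simp add: control_field_def scaleR_left_diff_distrib sum_subtractf)

lemma norm_control_field_le: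
  assumes "norm (f y) \<le> C" "\<And>j. norm (g j y) \<le> C"
  shows "norm (control_field f g y v w) \<le> C * control_weight v w"
proof -
  have "norm (control_field f g y v w) \<le> norm (v *\<^sub>R f y) + (\<Sum>j\<in>UNIV. norm ((w $ j) *\<^sub>R g j y))"
    unfolding control_field_def by (intro norm_triangle_le add_mono order_refl norm_sum)
  also have "\<dots> \<le> \<bar>v\<bar> * C + (\<Sum>j\<in>UNIV. \<bar>w $ j\<bar> * C)"
    using assms by (intro add_mono sum_mono) (auto intro!: mult_left_mono)
  finally show ?thesis by (simp add: control_weight_def algebra_simps sum_distrib_left)
qed

lemma norm_control_field_diff_le:
  assumes "norm (f y - f z) \<le> C" "\<And>j. norm (g j y - g j z) \<le> C"
  shows "norm (control_field f g y v w - control_field f g z v w) \<le> C * control_weight v w"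
proof -
  have "control_field f g y v w - control_field f g z v w =
      control_field (\<lambda>_. f y - f z) (\<lambda>j _. g j y - g j z) 0 v w"
    by (simp add: control_field_def scaleR_right_diff_distrib sum_subtractf)
  also have "norm \<dots> \<le> C * control_weight v w"
    using assms by (intro norm_control_field_le) auto
  finally show ?thesis .
qed

lemma control_field_absolutely_integrable:
  fixes f :: "real ^ 'n \<Rightarrow> real ^ 'n" and g :: "'k::finite \<Rightarrow> real ^ 'n \<Rightarrow> real ^ 'n" and v :: "real \<Rightarrow> real"
  assumes vw: "v absolutely_integrable_on {a..b}" "w absolutely_integrable_on {a..b}"
    and f: "continuous_on UNIV f" and g: "\<And>j. continuous_on UNIV (g j)" and z: "continuous_on {a..b} z"
  shows "(\<lambda>s. control_field f g (z s) (v s) (w s)) absolutely_integrable_on {a..b}"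
proof -
  have "(\<lambda>s. w s $ j) absolutely_integrable_on {a..b}" for j
    using absolutely_integrable_component[OF vw(2), of "axis j 1"] by (simp add: inner_axis)
  moreover have "continuous_on {a..b} (\<lambda>s. f (z s))" "continuous_on {a..b} (\<lambda>s. g j (z s))" for j
    using continuous_on_compose2[OF f z] continuous_on_compose2[OF g z] by auto
  ultimately have "(\<lambda>s. v s *\<^sub>R f (z s)) absolutely_integrable_on {a..b}"
    "(\<lambda>s. w s $ j *\<^sub>R g j (z s)) absolutely_integrable_on {a..b}" for j
    using absolutely_integrable_scaleR_continuous[where z = "\<lambda>s. f (z s)" and h = v]
      absolutely_integrable_scaleR_continuous[where z = "\<lambda>s. g j (z s)" and h = "\<lambda>s. w s $ j"] vw(1) by auto
  then show ?thesis
    unfolding control_field_def by (intro set_integral_add absolutely_integrable_sum) auto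
qed

lemma solution_upto_integral:
  assumes "solution_upto f g x0 v w S y" "t \<in> {0..S}"
  shows "((\<lambda>s. control_field f g (y s) (v s) (w s)) has_integral (y t - x0)) {0..t}"
  using abs_cont_on_has_integral_derivative(2)[of 0 S y "\<lambda>s. control_field f g (y s) (v s) (w s)" 0 t] assms
  unfolding solution_upto_def by auto

lemma solution_upto_continuous_on:
  "solution_upto f g x0 v w S y \<Longrightarrow> continuous_on {0..S} y"
  unfolding solution_upto_def by (blast intro: abs_cont_on_imp_continuous_on)

lemma solution_uptoI:
  assumes "0 \<le> S"
    and int: "(\<lambda>s. control_field f g (y s) (v s) (w s)) absolutely_integrable_on {0..S}"
    and eq: "\<And>t. t \<in> {0..S} \<Longrightarrow> y t = x0 + integral {0..t} (\<lambda>s. control_field f g (y s) (v s) (w s))"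
  shows "solution_upto f g x0 v w S y"
proof -
  let ?F = "\<lambda>s. control_field f g (y s) (v s) (w s)"
  have diff: "y t - y s = integral {0..t} ?F - integral {0..s} ?F" if "s \<in> {0..S}" "t \<in> {0..S}" for s t
    using eq[OF that(1)] eq[OF that(2)] by simp
  have "abs_cont_on 0 S y"
    by (rule abs_cont_on_dominated[OF abs_cont_on_indefinite_integral[OF int], of _ 1]) (simp add: diff)
  moreover have "y 0 = x0" using eq[of 0] \<open>0 \<le> S\<close> by simp
  moreover obtain N where N: "negligible N"
    "\<And>x. x \<in> {0..S} - N \<Longrightarrow> ((\<lambda>x. integral {0..x} ?F) has_vector_derivative ?F x) (at x)"
    using ae_vector_derivative_indefinite_integral[OF int] by blast
  have "AE s in lebesgue_on {0..S}. (y has_vector_derivative ?F s) (at s)"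
    unfolding AE_lebesgue_on_Icc_iff
  proof (intro exI conjI ballI)
    show "negligible (N \<union> {0, S})" using N(1) by (intro negligible_Un) auto
    fix s assume s: "s \<in> {0..S} - (N \<union> {0, S})"
    have "((\<lambda>x. x0 + integral {0..x} ?F) has_vector_derivative ?F s) (at s)"
      using has_vector_derivative_add[OF has_vector_derivative_const N(2)] s by simp
    then show "(y has_vector_derivative ?F s) (at s)"
      by (rule has_vector_derivative_transform_within_open[of _ _ _ "{0<..<S}"])
        (use s eq in auto)
  qed
  ultimately show ?thesis unfolding solution_upto_def by blast
qed

lemma solution_upto_restrict:
  assumes "solution_upto f g x0 v w S y" "t \<le> S"
  shows "solution_upto f g x0 v w t y"
  using assms abs_cont_on_subinterval[of 0 S y 0 t] unfolding solution_upto_def AE_lebesgue_on_Icc_iff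
  by (meson atLeastAtMost_iff Diff_iff order_refl order_trans)

text \<open>Compactness of the ball turns local constants into global ones, and adding those of the
  finitely many fields yields a single \<open>C\<close> that serves as Lipschitz constant and as
  bound.\<close>

lemma fields_lipschitz_on_cball:
  fixes f :: "real ^ 'n \<Rightarrow> real ^ 'n" and g :: "'k::finite \<Rightarrow> real ^ 'n \<Rightarrow> real ^ 'n"
  assumes f: "local_lipschitz (UNIV :: real set) UNIV (\<lambda>_. f)"
    and g: "\<And>j. local_lipschitz (UNIV :: real set) UNIV (\<lambda>_. g j)"
  obtains C where "0 \<le> C"
    "\<And>y z. y \<in> cball 0 R \<Longrightarrow> z \<in> cball 0 R \<Longrightarrow> norm (f y - f z) \<le> C * norm (y - z)"
    "\<And>j y z. y \<in> cball 0 R \<Longrightarrow> z \<in> cball 0 R \<Longrightarrow> norm (g j y - g j z) \<le> C * norm (y - z)"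
    "\<And>y. y \<in> cball 0 R \<Longrightarrow> norm (f y) \<le> C"
    "\<And>j y. y \<in> cball 0 R \<Longrightarrow> norm (g j y) \<le> C"
proof -
  let ?B = "cball 0 R :: (real ^ 'n) set"
  have one: "\<exists>C\<ge>0. (\<forall>y\<in>?B. \<forall>z\<in>?B. norm (p y - p z) \<le> C * norm (y - z)) \<and> (\<forall>y\<in>?B. norm (p y) \<le> C)"
    if p: "local_lipschitz (UNIV :: real set) UNIV (\<lambda>_. p)" for p :: "real ^ 'n \<Rightarrow> real ^ 'n"
  proof -
    \<comment> \<open>The passage from local to global constants wants a compact time set too, so
      the dummy time is restricted to one point.\<close>
    have loc: "local_lipschitz {0::real} ?B (\<lambda>_. p)"
      by (rule local_lipschitz_subset[OF p]) auto
    obtain L where L: "L-lipschitz_on ?B p"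
      using local_lipschitz_compact_implies_lipschitz[OF loc] by auto
    have "continuous_on ?B p"
      using local_lipschitz_continuous_on[OF loc, of 0] by simp
    then have "bounded (p ` ?B)"
      by (intro compact_imp_bounded compact_continuous_image) auto
    then obtain D where "D > 0" "\<And>y. y \<in> ?B \<Longrightarrow> norm (p y) \<le> D"
      unfolding bounded_pos by auto
    moreover have "norm (p y - p z) \<le> (L + D) * norm (y - z)" if "y \<in> ?B" "z \<in> ?B" for y z
    proof -
      have "norm (p y - p z) \<le> L * norm (y - z)"
        using lipschitz_onD[OF L that] by (simp add: dist_norm)
      also have "\<dots> \<le> (L + D) * norm (y - z)" using \<open>D > 0\<close> by (intro mult_right_mono) auto
      finally show ?thesis .
    qed
    moreover have "0 \<le> L" by (rule lipschitz_on_nonneg[OF L])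
    ultimately show ?thesis by (intro exI[of _ "L + D"]) (auto intro: add_increasing)
  qed
  obtain Cf where Cf: "0 \<le> Cf" "\<And>y z. y \<in> ?B \<Longrightarrow> z \<in> ?B \<Longrightarrow> norm (f y - f z) \<le> Cf * norm (y - z)"
    "\<And>y. y \<in> ?B \<Longrightarrow> norm (f y) \<le> Cf"
    using one[OF f] by blast
  have "\<forall>j. \<exists>C\<ge>0. (\<forall>y\<in>?B. \<forall>z\<in>?B. norm (g j y - g j z) \<le> C * norm (y - z)) \<and> (\<forall>y\<in>?B. norm (g j y) \<le> C)"
    using one[OF g] by blast
  from choice[OF this] obtain Cg where Cg: "\<And>j. 0 \<le> Cg j"
    "\<And>j y z. y \<in> ?B \<Longrightarrow> z \<in> ?B \<Longrightarrow> norm (g j y - g j z) \<le> Cg j * norm (y - z)"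
    "\<And>j y. y \<in> ?B \<Longrightarrow> norm (g j y) \<le> Cg j" by blast
  define C where "C = Cf + (\<Sum>j\<in>UNIV. Cg j)"
  have "Cf \<le> C" using Cg(1) by (simp add: C_def sum_nonneg)
  have "Cg j \<le> C" for j
    using member_le_sum[of j UNIV Cg] Cg(1) Cf(1) by (simp add: C_def)
  show thesis
  proof (rule that[of C])
    show "0 \<le> C" using Cf(1) \<open>Cf \<le> C\<close> by simp
    show "norm (f y - f z) \<le> C * norm (y - z)" if "y \<in> ?B" "z \<in> ?B" for y z
      using Cf(2)[OF that] mult_right_mono[OF \<open>Cf \<le> C\<close> norm_ge_zero] by (rule order_trans)
    show "norm (g j y - g j z) \<le> C * norm (y - z)" if "y \<in> ?B" "z \<in> ?B" for j y z
      using Cg(2)[OF that] mult_right_mono[OF \<open>Cg j \<le> C\<close> norm_ge_zero] by (rule order_trans)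
    show "norm (f y) \<le> C" if "y \<in> ?B" for y using Cf(3)[OF that] \<open>Cf \<le> C\<close> by simp
    show "norm (g j y) \<le> C" if "y \<in> ?B" for j y using Cg(3)[OF that] \<open>Cg j \<le> C\<close> by (rule order_trans)
  qed
qed

text \<open>Continuous dependence on the control in \<open>L1\<close>, including existence up to
  \<open>S\<close>. The pointwise weight hypothesis bounds the Lipschitz modulus of every admissible
  perturbed equation by one fixed function \<open>h\<close>, so the Gronwall constant and with it
  \<open>d\<close> are chosen before the perturbation.\<close>

lemma trajectory_perturbation:
  fixes f :: "real ^ 'n \<Rightarrow> real ^ 'n" and g :: "'k::finite \<Rightarrow> real ^ 'n \<Rightarrow> real ^ 'n"
  assumes f: "local_lipschitz (UNIV :: real set) UNIV (\<lambda>_. f)"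
    and g: "\<And>j. local_lipschitz (UNIV :: real set) UNIV (\<lambda>_. g j)"
    and "0 \<le> S" and vw: "v absolutely_integrable_on {0..S}" "w absolutely_integrable_on {0..S}"
    and y: "solution_upto f g x0 v w S y" and "e > 0"
  obtains d where "d > 0"
    "\<And>v' w'. v' absolutely_integrable_on {0..S} \<Longrightarrow> w' absolutely_integrable_on {0..S} \<Longrightarrow>
       (\<And>s. s \<in> {0..S} \<Longrightarrow> control_weight (v' s) (w' s) \<le> control_weight (v s) (w s) + 1) \<Longrightarrow>
       integral {0..S} (\<lambda>s. control_weight (v' s - v s) (w' s - w s)) \<le> d \<Longrightarrow>
       \<exists>z. solution_upto f g x0 v' w' S z \<and> (\<forall>s\<in>{0..S}. norm (z s - y s) \<le> e)"
proof -
  have y_cont: "continuous_on {0..S} y" by (rule solution_upto_continuous_on[OF y])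
  have "bounded (y ` {0..S})" using y_cont by (intro compact_imp_bounded compact_continuous_image) auto
  then obtain R where R: "\<And>s. s \<in> {0..S} \<Longrightarrow> norm (y s) \<le> R"
    unfolding bounded_iff by (meson imageI)
  define B where "B = (cball 0 (R + 1) :: (real ^ 'n) set)"
  have "0 \<le> R" using order_trans[OF norm_ge_zero R[of 0]] \<open>0 \<le> S\<close> by simp
  then have B: "closed B" "convex B" "B \<noteq> {}" by (auto simp: B_def)
  obtain C where "0 \<le> C"
    and f_lip: "\<And>y z. y \<in> B \<Longrightarrow> z \<in> B \<Longrightarrow> norm (f y - f z) \<le> C * norm (y - z)"
    and g_lip: "\<And>j y z. y \<in> B \<Longrightarrow> z \<in> B \<Longrightarrow> norm (g j y - g j z) \<le> C * norm (y - z)"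
    and f_bd: "\<And>y. y \<in> B \<Longrightarrow> norm (f y) \<le> C" and g_bd: "\<And>j y. y \<in> B \<Longrightarrow> norm (g j y) \<le> C"
    using fields_lipschitz_on_cball[of f g "R + 1", OF f g] unfolding B_def by blast
  \<comment> \<open>Composed with the projection onto \<open>B\<close> the fields are globally Lipschitz, so the perturbed equation
    is globally solvable; its solution turns out not to leave \<open>B\<close>.\<close>
  define P where "P = closest_point B"
  have P_in: "P z \<in> B" for z unfolding P_def using B by (intro closest_point_in_set)
  have P_id: "P z = z" if "z \<in> B" for z unfolding P_def using that by (rule closest_point_self)
  have P_lip: "norm (P y - P z) \<le> norm (y - z)" for y z
    unfolding P_def using closest_point_lipschitz[OF B(2,1,3)] by (simp add: dist_norm)
  define fP where "fP z = f (P z)" for z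
  define gP where "gP j z = g j (P z)" for j z
  have fP_lip: "norm (fP y - fP z) \<le> C * norm (y - z)" for y z
    unfolding fP_def using f_lip[OF P_in P_in] mult_left_mono[OF P_lip \<open>0 \<le> C\<close>] by (rule order_trans)
  have gP_lip: "norm (gP j y - gP j z) \<le> C * norm (y - z)" for j y z
    unfolding gP_def using g_lip[OF P_in P_in] mult_left_mono[OF P_lip \<open>0 \<le> C\<close>] by (rule order_trans)
  have fP_cont: "continuous_on UNIV fP"
    by (rule lipschitz_on_continuous_on[of C]) (use fP_lip \<open>0 \<le> C\<close> in \<open>auto simp: lipschitz_on_def dist_norm\<close>)
  have gP_cont: "continuous_on UNIV (gP j)" for j
    by (rule lipschitz_on_continuous_on[of C]) (use gP_lip \<open>0 \<le> C\<close> in \<open>auto simp: lipschitz_on_def dist_norm\<close>)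
  define h where "h s = C * (control_weight (v s) (w s) + 1)" for s
  have h: "h absolutely_integrable_on {0..S}" "0 \<le> h s" for s
    unfolding h_def using control_weight_absolutely_integrable[OF vw] \<open>0 \<le> C\<close>
    by (auto intro!: set_integral_add mult_nonneg_nonneg add_nonneg_nonneg)
  \<comment> \<open>\<open>K * d\<close> is the Gronwall bound for the initial error
    \<open>A = C * d\<close>. The cap \<open>min e 1\<close> uses the margin 1 between the
    trajectory \<open>y\<close> and the boundary of \<open>B\<close> to keep the perturbed solution
    inside \<open>B\<close>.\<close>
  define K where "K = 2 * C * exp (2 * integral {0..S} h)"
  have "0 \<le> K" using \<open>0 \<le> C\<close> by (simp add: K_def)
  define d where "d = min e 1 / (K + 1)"
  have "d > 0" using \<open>e > 0\<close> \<open>0 \<le> K\<close> by (simp add: d_def)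
  have "K * d \<le> min e 1"
  proof -
    have "K * d \<le> (K + 1) * d" using \<open>d > 0\<close> by (intro mult_right_mono) auto
    also have "\<dots> = min e 1" using \<open>0 \<le> K\<close> by (simp add: d_def)
    finally show ?thesis .
  qed
  show thesis
  proof (rule that[OF \<open>d > 0\<close>])
    fix v' :: "real \<Rightarrow> real" and w' :: "real \<Rightarrow> real ^ 'k"
    assume vw': "v' absolutely_integrable_on {0..S}" "w' absolutely_integrable_on {0..S}"
      and weight: "\<And>s. s \<in> {0..S} \<Longrightarrow> control_weight (v' s) (w' s) \<le> control_weight (v s) (w s) + 1"
      and close: "integral {0..S} (\<lambda>s. control_weight (v' s - v s) (w' s - w s)) \<le> d"
    define \<Phi> where "\<Phi> s z = control_field fP gP z (v' s) (w' s)" for s z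
    have \<Phi>_int: "(\<lambda>s. \<Phi> s (z s)) absolutely_integrable_on {0..S}" if "continuous_on {0..S} z" for z
      unfolding \<Phi>_def by (rule control_field_absolutely_integrable[OF vw' fP_cont gP_cont that])
    have \<Phi>_lip: "norm (\<Phi> s y - \<Phi> s z) \<le> h s * norm (y - z)" if "s \<in> {0..S}" for s y z
    proof -
      have "norm (\<Phi> s y - \<Phi> s z) \<le> C * norm (y - z) * control_weight (v' s) (w' s)"
        unfolding \<Phi>_def by (intro norm_control_field_diff_le fP_lip gP_lip)
      also have "\<dots> \<le> C * norm (y - z) * (control_weight (v s) (w s) + 1)"
        using weight[OF that] \<open>0 \<le> C\<close> by (intro mult_left_mono) auto
      finally show ?thesis by (simp add: h_def algebra_simps)
    qed
    obtain z where z_cont: "continuous_on {0..S} z"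
      and z: "\<And>t. t \<in> {0..S} \<Longrightarrow> z t = x0 + integral {0..t} (\<lambda>s. \<Phi> s (z s))"
      using caratheodory_solution_exists[where ?x0.0 = x0, OF h \<Phi>_int \<Phi>_lip] by blast
    let ?c = "\<lambda>s. control_weight (v' s - v s) (w' s - w s)"
    have c_int: "?c absolutely_integrable_on {0..S}"
      using vw vw' by (intro control_weight_absolutely_integrable set_integral_diff)
    have "norm (z t - y t) \<le> 2 * (C * d) * exp (2 * integral {0..S} h)" if "t \<in> {0..S}" for t
    proof (rule gronwall[OF h, where \<phi> = "\<lambda>s. norm (z s - y s)", OF _ _ _ that])
      show "continuous_on {0..S} (\<lambda>s. norm (z s - y s))"
        using z_cont y_cont by (intro continuous_intros)
      fix t assume t: "t \<in> {0..S}"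
      let ?F = "\<lambda>s. control_field f g (y s) (v s) (w s)"
      have on: "q integrable_on {0..t}" if "q absolutely_integrable_on {0..S}" for q :: "real \<Rightarrow> real"
        using set_lebesgue_integral_eq_integral(1)[OF that] t by (auto intro: integrable_on_subinterval)
      have \<Phi>_on: "(\<lambda>s. \<Phi> s (z s)) integrable_on {0..t}"
        using set_lebesgue_integral_eq_integral(1)[OF \<Phi>_int[OF z_cont]] t by (auto intro: integrable_on_subinterval)
      have h\<phi>: "(\<lambda>s. h s * norm (z s - y s)) integrable_on {0..t}"
      proof (rule on)
        have "(\<lambda>s. h s *\<^sub>R norm (z s - y s)) absolutely_integrable_on {0..S}"
          using z_cont y_cont by (intro absolutely_integrable_scaleR_continuous h continuous_intros)
        then show "(\<lambda>s. h s * norm (z s - y s)) absolutely_integrable_on {0..S}" by simp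
      qed
      have c_on: "(\<lambda>s. C * ?c s) integrable_on {0..t}" using integrable_cmul[OF on[OF c_int], of C] by simp
      note F = solution_upto_integral[OF y t]
      have "z t - y t = integral {0..t} (\<lambda>s. \<Phi> s (z s) - ?F s)"
        using z[OF t] F \<Phi>_on by (subst Henstock_Kurzweil_Integration.integral_diff) (auto simp: integral_unique)
      also have "norm \<dots> \<le> integral {0..t} (\<lambda>s. h s * norm (z s - y s) + C * ?c s)"
      proof (rule integral_norm_bound_integral)
        show "(\<lambda>s. \<Phi> s (z s) - ?F s) integrable_on {0..t}" using \<Phi>_on F by (intro integrable_diff) auto
        show "(\<lambda>s. h s * norm (z s - y s) + C * ?c s) integrable_on {0..t}"
          using h\<phi> c_on by (rule integrable_add)
        fix s assume "s \<in> {0..t}"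
        then have s: "s \<in> {0..S}" using t by auto
        then have ys: "y s \<in> B" using R[OF s] by (simp add: B_def)
        \<comment> \<open>On \<open>B\<close> the truncated fields are the original ones, so at the
          same state the two velocities differ only through the controls.\<close>
        have "\<Phi> s (y s) - ?F s = control_field f g (y s) (v' s - v s) (w' s - w s)"
          unfolding control_field_diff[symmetric] using P_id[OF ys]
          by (simp add: \<Phi>_def control_field_def fP_def gP_def)
        then have "norm (\<Phi> s (y s) - ?F s) \<le> C * ?c s"
          using norm_control_field_le[of f "y s" C g] f_bd[OF ys] g_bd[OF ys] by simp
        moreover have "norm (\<Phi> s (z s) - ?F s) \<le> norm (\<Phi> s (z s) - \<Phi> s (y s)) + norm (\<Phi> s (y s) - ?F s)"
          by norm
        ultimately show "norm (\<Phi> s (z s) - ?F s) \<le> h s * norm (z s - y s) + C * ?c s"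
          using \<Phi>_lip[OF s, of "z s" "y s"] by linarith
      qed
      also have "\<dots> = integral {0..t} (\<lambda>s. h s * norm (z s - y s)) + C * integral {0..t} ?c"
        using h\<phi> c_on by (simp add: Henstock_Kurzweil_Integration.integral_add)
      also have "C * integral {0..t} ?c \<le> C * d"
        using integral_le_subinterval(2)[OF c_int _ t] close \<open>0 \<le> C\<close> by (intro mult_left_mono) auto
      finally show "norm (z t - y t) \<le> C * d + integral {0..t} (\<lambda>s. h s * norm (z s - y s))" by simp
    qed auto
    then have zy: "norm (z t - y t) \<le> min e 1" if "t \<in> {0..S}" for t
      using that \<open>K * d \<le> min e 1\<close> by (fastforce simp: K_def algebra_simps)
    have zB: "z t \<in> B" if "t \<in> {0..S}" for t
      using zy[OF that] R[OF that] norm_triangle_ineq2[of "z t" "y t"] by (simp add: B_def)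
    have eq: "\<Phi> s (z s) = control_field f g (z s) (v' s) (w' s)" if "s \<in> {0..S}" for s
      using P_id[OF zB[OF that]] by (simp add: \<Phi>_def control_field_def fP_def gP_def)
    have "solution_upto f g x0 v' w' S z"
    proof (rule solution_uptoI[OF \<open>0 \<le> S\<close>])
      show "(\<lambda>s. control_field f g (z s) (v' s) (w' s)) absolutely_integrable_on {0..S}"
        by (rule absolutely_integrable_spike[OF \<Phi>_int[OF z_cont] negligible_empty]) (simp add: eq)
      fix t assume t: "t \<in> {0..S}"
      have "integral {0..t} (\<lambda>s. \<Phi> s (z s)) = integral {0..t} (\<lambda>s. control_field f g (z s) (v' s) (w' s))"
        using t by (intro integral_cong eq) auto
      then show "z t = x0 + integral {0..t} (\<lambda>s. control_field f g (z s) (v' s) (w' s))"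
        using z[OF t] by simp
    qed
    then show "\<exists>z. solution_upto f g x0 v' w' S z \<and> (\<forall>s\<in>{0..S}. norm (z s - y s) \<le> e)"
      using zy by (intro exI[of _ z]) auto
  qed
qed

text \<open>Gronwall with \<open>A = 0\<close>, on a ball containing both solutions.\<close>

lemma solution_upto_unique:
  fixes f :: "real ^ 'n \<Rightarrow> real ^ 'n" and g :: "'k::finite \<Rightarrow> real ^ 'n \<Rightarrow> real ^ 'n"
  assumes f: "local_lipschitz (UNIV :: real set) UNIV (\<lambda>_. f)"
    and g: "\<And>j. local_lipschitz (UNIV :: real set) UNIV (\<lambda>_. g j)"
    and vw: "v absolutely_integrable_on {0..S}" "w absolutely_integrable_on {0..S}"
    and y: "solution_upto f g x0 v w S y" and z: "solution_upto f g x0 v w S z" and t: "t \<in> {0..S}"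
  shows "y t = z t"
proof -
  have y_cont: "continuous_on {0..S} y" by (rule solution_upto_continuous_on[OF y])
  have z_cont: "continuous_on {0..S} z" by (rule solution_upto_continuous_on[OF z])
  have "bounded (y ` {0..S} \<union> z ` {0..S})"
    using y_cont z_cont by (intro compact_imp_bounded compact_Un compact_continuous_image) auto
  then obtain R where R: "\<And>s. s \<in> {0..S} \<Longrightarrow> y s \<in> cball 0 R \<and> z s \<in> cball 0 R"
    unfolding bounded_iff mem_cball_0 by (meson imageI UnI1 UnI2)
  define B where "B = (cball 0 R :: (real ^ 'n) set)"
  obtain C where "0 \<le> C"
    and f_lip: "\<And>y z. y \<in> B \<Longrightarrow> z \<in> B \<Longrightarrow> norm (f y - f z) \<le> C * norm (y - z)"
    and g_lip: "\<And>j y z. y \<in> B \<Longrightarrow> z \<in> B \<Longrightarrow> norm (g j y - g j z) \<le> C * norm (y - z)"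
  proof (rule fields_lipschitz_on_cball[of f g R, OF f g], goal_cases)
    case (1 C)
    then show thesis by (intro that[of C]) (auto simp: B_def)
  qed
  define h where "h s = C * control_weight (v s) (w s)" for s
  have h: "h absolutely_integrable_on {0..S}" "0 \<le> h s" for s
    unfolding h_def using control_weight_absolutely_integrable[OF vw] \<open>0 \<le> C\<close> by auto
  have "norm (y t - z t) \<le> 2 * 0 * exp (2 * integral {0..S} h)"
  proof (rule gronwall[OF h, where \<phi> = "\<lambda>s. norm (y s - z s)", OF _ _ _ t])
    show "continuous_on {0..S} (\<lambda>s. norm (y s - z s))"
      using z_cont y_cont by (intro continuous_intros)
    fix t assume t: "t \<in> {0..S}"
    have "(\<lambda>s. h s *\<^sub>R norm (y s - z s)) absolutely_integrable_on {0..S}"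
      using z_cont y_cont by (intro absolutely_integrable_scaleR_continuous h continuous_intros)
    from set_lebesgue_integral_eq_integral(1)[OF this]
    have h\<phi>: "(\<lambda>s. h s * norm (y s - z s)) integrable_on {0..t}"
      using t by (auto intro: integrable_on_subinterval)
    have F: "((\<lambda>s. control_field f g (y s) (v s) (w s) - control_field f g (z s) (v s) (w s))
        has_integral ((y t - x0) - (z t - x0))) {0..t}"
      by (intro has_integral_diff solution_upto_integral[OF y t] solution_upto_integral[OF z t])
    have "norm (y t - z t) =
        norm (integral {0..t} (\<lambda>s. control_field f g (y s) (v s) (w s) - control_field f g (z s) (v s) (w s)))"
      using integral_unique[OF F] by simp
    also have "\<dots> \<le> integral {0..t} (\<lambda>s. h s * norm (y s - z s))"
    proof (rule integral_norm_bound_integral[OF has_integral_integrable[OF F] h\<phi>])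
      fix s assume "s \<in> {0..t}"
      then have s: "s \<in> {0..S}" using t by auto
      have "norm (control_field f g (y s) (v s) (w s) - control_field f g (z s) (v s) (w s)) \<le>
          C * norm (y s - z s) * control_weight (v s) (w s)"
        using R[OF s] by (intro norm_control_field_diff_le f_lip g_lip) (auto simp: B_def)
      then show "norm (control_field f g (y s) (v s) (w s) - control_field f g (z s) (v s) (w s)) \<le>
          h s * norm (y s - z s)" by (simp add: h_def algebra_simps)
    qed
    finally show "norm (y t - z t) \<le> 0 + integral {0..t} (\<lambda>s. h s * norm (y s - z s))" by simp
  qed auto
  then show ?thesis by simp
qed

lemma trajectory_eq:
  fixes f :: "real ^ 'n \<Rightarrow> real ^ 'n" and g :: "'k::finite \<Rightarrow> real ^ 'n \<Rightarrow> real ^ 'n"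
  assumes f: "local_lipschitz (UNIV :: real set) UNIV (\<lambda>_. f)"
    and g: "\<And>j. local_lipschitz (UNIV :: real set) UNIV (\<lambda>_. g j)"
    and vw: "v absolutely_integrable_on {0..S}" "w absolutely_integrable_on {0..S}"
    and y: "solution_upto f g x0 v w S y" and t: "t \<in> {0..S}"
  shows "trajectory f g x0 v w t = y t"
  unfolding trajectory_def
proof (rule the_equality)
  have yt: "solution_upto f g x0 v w t y" using solution_upto_restrict[OF y] t by simp
  then show "\<exists>y'. solution_upto f g x0 v w t y' \<and> y' t = y t" by blast
  fix x assume "\<exists>y. solution_upto f g x0 v w t y \<and> y t = x"
  then obtain y' where y': "solution_upto f g x0 v w t y'" "y' t = x" by blast
  have "v absolutely_integrable_on {0..t}" "w absolutely_integrable_on {0..t}"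
    using vw t by (auto intro: absolutely_integrable_on_subinterval)
  then have "y' t = y t"
    using t by (intro solution_upto_unique[OF f g _ _ y'(1) yt]) auto
  then show "x = y t" using y'(2) by simp
qed

subsection \<open>Convex Lagrangians and extended real integrals\<close>

text \<open>Used twice: for the recession limit of the Lagrangian at \<open>v = 0\<close>, and for
  the ordinary infima as the tolerance shrinks.\<close>

lemma tendsto_SUP_at_right_0:
  fixes F :: "real \<Rightarrow> ereal"
  assumes anti: "\<And>x y. 0 < x \<Longrightarrow> x \<le> y \<Longrightarrow> F y \<le> F x"
  shows "(F \<longlongrightarrow> (SUP x\<in>{0<..}. F x)) (at_right 0)"
proof (rule order_tendstoI)
  fix a assume "a < (SUP x\<in>{0<..}. F x)"
  then obtain x where "0 < x" "a < F x" by (auto simp: less_SUP_iff)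
  then have "a < F y" if "y \<in> {0<..<x}" for y
    using anti[of y x] that by (auto intro: less_le_trans)
  then show "\<forall>\<^sub>F y in at_right 0. a < F y"
    using eventually_at_right_real[OF \<open>0 < x\<close>] by (rule eventually_mono[rotated])
next
  fix a assume a: "(SUP x\<in>{0<..}. F x) < a"
  have "F y < a" if "0 < y" for y
    using SUP_upper[of y "{0<..}" F] that a by (auto intro: le_less_trans)
  then show "\<forall>\<^sub>F y in at_right 0. F y < a"
    by (auto intro: eventually_mono[OF eventually_at_right_less])
qed

section \<open>Perspectives of convex functions\<close>

text \<open>The point \<open>w / (v + e)\<close> is the convex combination of \<open>w / v\<close>
  and 0 with coefficients \<open>v / (v + e)\<close> and \<open>e / (v + e)\<close>.\<close>

lemma convex_perspective_add:
  fixes L :: "'a::real_vector \<Rightarrow> real"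
  assumes "convex_on UNIV L" "0 < v" "0 < e"
  shows "(v + e) * L (w /\<^sub>R (v + e)) \<le> v * L (w /\<^sub>R v) + e * L 0"
proof -
  let ?t = "e / (v + e)"
  have t: "0 \<le> ?t" "?t \<le> 1" "1 - ?t = v / (v + e)" using assms by (auto simp: field_simps)
  have eq: "(1 - ?t) *\<^sub>R (w /\<^sub>R v) + ?t *\<^sub>R 0 = w /\<^sub>R (v + e)"
    unfolding t(3) using assms by (simp add: field_simps)
  have "L ((1 - ?t) *\<^sub>R (w /\<^sub>R v) + ?t *\<^sub>R 0) \<le> (1 - ?t) * L (w /\<^sub>R v) + ?t * L 0"
    using assms(1) t(1,2) by (intro convex_onD) auto
  then have "L (w /\<^sub>R (v + e)) \<le> v / (v + e) * L (w /\<^sub>R v) + ?t * L 0"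
    unfolding eq unfolding t(3) .
  then have "(v + e) * L (w /\<^sub>R (v + e)) \<le> (v + e) * (v / (v + e) * L (w /\<^sub>R v) + ?t * L 0)"
    using assms by (intro mult_left_mono) auto
  also have "\<dots> = v * L (w /\<^sub>R v) + e * L 0"
    using assms by (simp add: distrib_left)
  finally show ?thesis .
qed

text \<open>The parametric Lagrangian is the perspective of \<open>L2\<close> and therefore subadditive in \<open>(v, w)\<close>;
  adding the time \<open>e\<close> without control costs at most \<open>e * L2 0\<close>.\<close>

lemma parametric_lagrangian_ge:
  fixes L :: "real ^ 'n \<Rightarrow> real ^ 'k \<Rightarrow> real"
  assumes conv: "convex_on UNIV L2" and L: "\<And>x u. L x u = L1 x + L2 u" and "0 \<le> v" "0 < e"
  shows "ereal (L1 y * v + (v + e) * L2 (w /\<^sub>R (v + e)) - e * L2 0) \<le> parametric_lagrangian L y v w"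
proof (cases "0 < v")
  case True
  then show ?thesis
    using convex_perspective_add[OF conv True \<open>0 < e\<close>, of w]
    by (simp add: parametric_lagrangian_def L algebra_simps)
next
  case False
  then have "v = 0" using assms by simp
  \<comment> \<open>By the perspective inequality \<open>\<psi>\<close> decreases once
    \<open>\<eta> * L2 0\<close> is subtracted. Its limit at 0 is then a supremum, possibly
    infinite, which dominates the value at \<open>e\<close>.\<close>
  define \<psi> where "\<psi> \<eta> = \<eta> * L2 (w /\<^sub>R \<eta>) - \<eta> * L2 0" for \<eta>
  have anti: "ereal (\<psi> b) \<le> ereal (\<psi> a)" if "0 < a" "a \<le> b" for a b
  proof (cases "a = b")
    case False
    then show ?thesis
      using convex_perspective_add[OF conv \<open>0 < a\<close>, of "b - a" w] that
      by (simp add: \<psi>_def algebra_simps)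
  qed simp
  let ?s = "SUP \<eta>\<in>{0<..}. ereal (\<psi> \<eta>)"
  have lim1: "((\<lambda>\<eta>. ereal (\<psi> \<eta>)) \<longlongrightarrow> ?s) (at_right 0)"
    by (rule tendsto_SUP_at_right_0[OF anti])
  \<comment> \<open>The part removed to form \<open>\<psi>\<close>, including the \<open>L1\<close>
    term, vanishes in the limit: at \<open>v = 0\<close> the parametric Lagrangian does not see the
    state.\<close>
  have lim2: "((\<lambda>\<eta>. ereal (\<eta> * (L1 y + L2 0))) \<longlongrightarrow> ereal (0 * (L1 y + L2 0))) (at_right 0)"
    by (intro tendsto_intros)
  have ge: "ereal (\<psi> e) \<le> ?s" by (rule SUP_upper) (use \<open>0 < e\<close> in simp)
  have "((\<lambda>\<eta>. ereal (\<psi> \<eta>) + ereal (\<eta> * (L1 y + L2 0))) \<longlongrightarrow> ?s + ereal 0) (at_right 0)"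
    using ge lim1 lim2 by (intro tendsto_add_ereal_nonneg) auto
  then have "((\<lambda>\<eta>. ereal (L y (w /\<^sub>R \<eta>) * \<eta>)) \<longlongrightarrow> ?s) (at_right 0)"
    by (simp add: \<psi>_def L algebra_simps zero_ereal_def[symmetric])
  then have "Lim (at_right 0) (\<lambda>\<eta>. ereal (L y (w /\<^sub>R \<eta>) * \<eta>)) = ?s"
    by (intro tendsto_Lim) auto
  then show ?thesis
    using ge by (simp add: parametric_lagrangian_def \<open>v = 0\<close> \<psi>_def)
qed

text \<open>The origin lies on the segment from \<open>u\<close> to the opposite unit vector, so
  convexity bounds \<open>L u\<close> below by values of \<open>L\<close> on the unit ball.
  Multiplied by \<open>v + e\<close>, this linear bound makes the negative part of the perspective
  integrable.\<close>

lemma convex_lower_bound: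
  fixes L :: "'a::euclidean_space \<Rightarrow> real"
  assumes conv: "convex_on UNIV L"
  obtains K where "0 \<le> K" "\<And>u. - K * (1 + norm u) \<le> L u"
proof -
  have "continuous_on UNIV L" by (rule convex_on_continuous[OF open_UNIV conv])
  then have "continuous_on (cball 0 1) L" by (rule continuous_on_subset) simp
  then have "bounded (L ` cball 0 1)"
    by (intro compact_imp_bounded compact_continuous_image compact_cball)
  then obtain K where K: "0 < K" "\<And>u. norm u \<le> 1 \<Longrightarrow> \<bar>L u\<bar> \<le> K"
    unfolding bounded_pos by auto
  have "- (2 * K) * (1 + norm u) \<le> L u" for u
  proof (cases "u = 0")
    case True
    then show ?thesis using K(1) K(2)[of 0] by simp
  next
    case False
    let ?n = "norm u"
    let ?t = "?n / (1 + ?n)"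
    have n: "0 < ?n" using False by simp
    have "0 \<le> m / (1 + m) \<and> m / (1 + m) \<le> 1 \<and> 1 - m / (1 + m) = 1 / (1 + m)" if "0 < m" for m :: real
      using that by (auto simp: field_simps)
    from this[OF n] have t: "0 \<le> ?t" "?t \<le> 1" "1 - ?t = 1 / (1 + ?n)" by blast+
    have eq: "(1 - ?t) *\<^sub>R u + ?t *\<^sub>R (- (u /\<^sub>R ?n)) = 0"
      unfolding t(3) using n by (simp add: divide_inverse)
    have "L ((1 - ?t) *\<^sub>R u + ?t *\<^sub>R (- (u /\<^sub>R ?n))) \<le> (1 - ?t) * L u + ?t * L (- (u /\<^sub>R ?n))"
      using conv t(1,2) by (intro convex_onD) auto
    then have "L 0 \<le> 1 / (1 + ?n) * L u + ?t * L (- (u /\<^sub>R ?n))"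
      unfolding eq unfolding t(3) .
    moreover have "L (- (u /\<^sub>R ?n)) \<le> K" using K(2)[of "- (u /\<^sub>R ?n)"] n by simp
    from mult_left_mono[OF this t(1)] mult_right_mono[OF t(2), of K] K(1)
    have "?t * L (- (u /\<^sub>R ?n)) \<le> K" by linarith
    moreover have "- K \<le> L 0" using K(2)[of 0] by simp
    ultimately have "- (2 * K) \<le> L u / (1 + ?n)" by simp
    then show ?thesis using n by (simp add: pos_le_divide_eq add_pos_pos)
  qed
  then show thesis using K(1) by (intro that[of "2 * K"]) auto
qed

section \<open>Integrals with values in the extended reals\<close>

lemma ereal_integral_mono_AE:
  assumes "AE x in M. h x \<le> k x"
  shows "ereal_integral M h \<le> ereal_integral M k"
proof -
  have "(\<integral>\<^sup>+ x. e2ennreal (h x) \<partial>M) \<le> (\<integral>\<^sup>+ x. e2ennreal (k x) \<partial>M)"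
    using assms by (intro nn_integral_mono_AE) (auto intro: e2ennreal_mono)
  moreover have "(\<integral>\<^sup>+ x. e2ennreal (- k x) \<partial>M) \<le> (\<integral>\<^sup>+ x. e2ennreal (- h x) \<partial>M)"
  proof (rule nn_integral_mono_AE)
    show "AE x in M. e2ennreal (- k x) \<le> e2ennreal (- h x)"
      using assms by eventually_elim (intro e2ennreal_mono, simp)
  qed
  ultimately show ?thesis
    unfolding ereal_integral_def by (intro ereal_minus_mono) (simp_all add: less_eq_ennreal.rep_eq)
qed

lemma ereal_integral_ereal:
  assumes "integrable M h"
  shows "ereal_integral M (\<lambda>x. ereal (h x)) = ereal (integral\<^sup>L M h)"
proof -
  have "(\<integral>\<^sup>+ x. ennreal (h x) \<partial>M) < \<infinity>" "(\<integral>\<^sup>+ x. ennreal (- h x) \<partial>M) < \<infinity>"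
    using assms by (auto simp: real_integrable_def less_top)
  then obtain a b where "0 \<le> a" "0 \<le> b" "(\<integral>\<^sup>+ x. ennreal (h x) \<partial>M) = ennreal a"
    "(\<integral>\<^sup>+ x. ennreal (- h x) \<partial>M) = ennreal b"
    by (metis enn2real_nonneg ennreal_enn2real infinity_ennreal_def)
  then show ?thesis
    by (simp add: ereal_integral_def real_lebesgue_integral_def[OF assms] enn2ereal_ennreal)
qed

lemma integrable_if_ereal_integral_less_top:
  assumes [measurable]: "h \<in> borel_measurable M" and r: "integrable M r"
    and ge: "AE x in M. - r x \<le> h x"
    and less: "ereal_integral M (\<lambda>x. ereal (h x)) < \<infinity>"
  shows "integrable M h"
proof -
  have "(\<integral>\<^sup>+ x. ennreal (- h x) \<partial>M) \<le> (\<integral>\<^sup>+ x. ennreal (r x) \<partial>M)"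
    using ge by (intro nn_integral_mono_AE) (auto intro!: ennreal_leI elim!: eventually_mono)
  also have "\<dots> < \<infinity>" using r by (auto simp: real_integrable_def less_top)
  finally have neg: "(\<integral>\<^sup>+ x. ennreal (- h x) \<partial>M) < \<infinity>" .
  \<comment> \<open>In \<open>ereal\<close> the difference \<open>\<infinity> - x\<close> is
    \<open>\<infinity>\<close> for every \<open>x\<close>, so a cost below
    \<open>\<infinity>\<close> excludes an infinite positive part.\<close>
  have "(\<integral>\<^sup>+ x. ennreal (h x) \<partial>M) \<noteq> \<infinity>"
    using less by (auto simp: ereal_integral_def)
  then show ?thesis using neg by (auto simp: real_integrable_def)
qed

subsection \<open>From space-time to ordinary controls\<close>

text \<open>\<open>T\<close> is the elapsed time and \<open>R\<close> its inverse. The lower bound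
  \<open>c\<close> makes \<open>T\<close> strictly increasing and \<open>R\<close> Lipschitz with
  constant \<open>1 / c\<close>. Property (N) of \<open>T\<close> ensures that null sets of
  parameters become null sets of times, so almost-everywhere statements survive the change of
  variable.\<close>

lemma time_change:
  fixes v :: "real \<Rightarrow> real"
  assumes v: "v absolutely_integrable_on {0..S}" and "0 \<le> S" and "0 < c"
    and ge: "\<And>s. s \<in> {0..S} \<Longrightarrow> c \<le> v s" and total: "integral {0..S} v = 1"
  obtains T R :: "real \<Rightarrow> real" and N where
    "\<And>s. s \<in> {0..S} \<Longrightarrow> T s \<in> {0..1}" "\<And>s. s \<in> {0..S} \<Longrightarrow> R (T s) = s"
    "\<And>t. t \<in> {0..1} \<Longrightarrow> R t \<in> {0..S}" "\<And>t. t \<in> {0..1} \<Longrightarrow> T (R t) = t"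
    "R 0 = 0" "R 1 = S"
    "\<And>t t'. 0 \<le> t \<Longrightarrow> t \<le> t' \<Longrightarrow> t' \<le> 1 \<Longrightarrow> R t \<le> R t' \<and> c * (R t' - R t) \<le> t' - t"
    "\<And>M. negligible M \<Longrightarrow> M \<subseteq> {0..S} \<Longrightarrow> negligible (T ` M)"
    "negligible N" "N \<subseteq> {0..S}"
    "\<And>s. s \<in> {0..S} - N \<Longrightarrow> (T has_real_derivative v s) (at s)"
    "\<And>s. s \<in> {0..S} - N \<Longrightarrow> (R has_real_derivative inverse (v s)) (at (T s))"
proof -
  define T where "T s = integral {0..s} v" for s
  have T_ac: "abs_cont_on 0 S T"
    unfolding T_def by (rule abs_cont_on_indefinite_integral[OF v])
  have v_on: "v integrable_on {a..b}" if "0 \<le> a" "b \<le> S" for a b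
    by (rule integrable_on_subinterval[OF set_lebesgue_integral_eq_integral(1)[OF v]]) (use that in auto)
  have T_ge: "c * (y - x) \<le> T y - T x" if "0 \<le> x" "x \<le> y" "y \<le> S" for x y
  proof -
    have "T x + integral {x..y} v = T y"
      unfolding T_def using that v_on by (intro Henstock_Kurzweil_Integration.integral_combine) auto
    moreover have "integral {x..y} (\<lambda>_. c) \<le> integral {x..y} v"
      using that ge v_on by (intro integral_le) auto
    ultimately show ?thesis using that by (simp add: mult.commute)
  qed
  have T_less: "T x < T y" if "0 \<le> x" "x < y" "y \<le> S" for x y
    using T_ge[of x y] that \<open>0 < c\<close> mult_pos_pos[of c "y - x"] by linarith
  have T_le: "T x \<le> T y" if "0 \<le> x" "x \<le> y" "y \<le> S" for x y
    using T_less[of x y] that by (cases "x = y") auto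
  have T0: "T 0 = 0" and TS: "T S = 1" using total by (auto simp: T_def)
  have inj: "inj_on T {0..S}"
    using T_less by (intro linorder_inj_onI) (auto simp: less_imp_neq)
  have img: "T ` {0..S} = {0..1}"
  proof
    show "T ` {0..S} \<subseteq> {0..1}"
      using T_le[of 0] T_le[of _ S] T0 TS by auto
    show "{0..1} \<subseteq> T ` {0..S}"
      using IVT'[of T 0 _ S] abs_cont_on_imp_continuous_on[OF T_ac] T0 TS \<open>0 \<le> S\<close>
      by (auto simp: image_iff Bex_def) metis
  qed
  define R where "R = inv_into {0..S} T"
  have RT: "R (T s) = s" if "s \<in> {0..S}" for s unfolding R_def by (rule inv_into_f_f[OF inj that])
  have R_in: "R t \<in> {0..S}" and TR: "T (R t) = t" if "t \<in> {0..1}" for t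
    unfolding R_def using that img by (metis inv_into_into, metis f_inv_into_f)
  have R0: "R 0 = 0" and R1: "R 1 = S" using RT[of 0] RT[of S] T0 TS \<open>0 \<le> S\<close> by auto
  have R_le: "R t \<le> R t' \<and> c * (R t' - R t) \<le> t' - t" if "0 \<le> t" "t \<le> t'" "t' \<le> 1" for t t'
  proof -
    have "R t \<le> R t'"
    proof (rule ccontr)
      assume "\<not> R t \<le> R t'"
      then have "T (R t') < T (R t)" using R_in[of t] R_in[of t'] that by (intro T_less) auto
      then show False using TR that by simp
    qed
    then show ?thesis using T_ge[of "R t" "R t'"] R_in[of t] R_in[of t'] TR[of t] TR[of t'] that by auto
  qed
  have R_cont: "isCont R t" if "0 < t" "t < 1" for t
  proof -
    have "(1/c)-lipschitz_on {0..1} R"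
    proof (rule lipschitz_onI)
      fix x y :: real assume xy: "x \<in> {0..1}" "y \<in> {0..1}"
      show "dist (R x) (R y) \<le> 1 / c * dist x y"
        using R_le[of x y] R_le[of y x] xy \<open>0 < c\<close>
        by (cases "x \<le> y") (auto simp: dist_real_def field_simps)
    qed (use \<open>0 < c\<close> in simp)
    then show ?thesis
      using continuous_on_interior[OF lipschitz_on_continuous_on, of _ "{0..1}" R t] that by simp
  qed
  obtain N where N: "negligible N" "\<And>x. x \<in> {0..S} - N \<Longrightarrow> (T has_vector_derivative v x) (at x)"
    unfolding T_def using ae_vector_derivative_indefinite_integral[OF v] by blast
  \<comment> \<open>The end points join the exceptional set because the inverse function rule works
    at times strictly between 0 and 1. Intersecting with \<open>{0..S}\<close> puts the set within
    reach of property (N).\<close>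
  let ?N = "(N \<union> {0, S}) \<inter> {0..S}"
  have T_der: "(T has_real_derivative v s) (at s)" if "s \<in> {0..S} - ?N" for s
  proof -
    have "s \<in> {0..S} - N" using that by blast
    from N(2)[OF this] show ?thesis by (simp add: has_real_derivative_iff_has_vector_derivative)
  qed
  have R_der: "(R has_real_derivative inverse (v s)) (at (T s))" if s: "s \<in> {0..S} - ?N" for s
  proof (rule DERIV_inverse_function[of T _ _ _ 0 1])
    show "(T has_real_derivative v s) (at (R (T s)))" using T_der[OF s] RT s by simp
    show "v s \<noteq> 0" using ge[of s] s \<open>0 < c\<close> by auto
    show "0 < T s" "T s < 1" using T_less[of 0 s] T_less[of s S] s T0 TS by (auto simp: less_le)
    then show "isCont R (T s)" by (rule R_cont)
    show "T (R y) = y" if "0 < y" "y < 1" for y using TR that by simp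
  qed
  show thesis
  proof (rule that[of T R ?N])
    show "negligible ?N"
      by (rule negligible_subset[of "N \<union> {0, S}"]) (use N(1) in \<open>auto intro: negligible_Un\<close>)
    show "negligible (T ` M)" if "negligible M" "M \<subseteq> {0..S}" for M
      by (rule abs_cont_on_negligible_image[OF T_ac \<open>0 \<le> S\<close> T_less that])
  qed (use img RT R_in TR R0 R1 R_le T_der R_der in auto)
qed

text \<open>The trajectory is \<open>z\<close> composed with \<open>R\<close>, and dividing its
  velocity by \<open>v\<close> normalizes the drift coefficient to 1. The cost formula is the
  substitution \<open>t = T s\<close>, whose Jacobian is \<open>v\<close>; it is stated for a
  general \<open>F\<close> because \<open>u\<close> and \<open>x\<close> are produced before a cost
  is chosen.\<close>

lemma time_change_ordinary_control:
  fixes f :: "real ^ 'n \<Rightarrow> real ^ 'n" and g :: "'k::finite \<Rightarrow> real ^ 'n \<Rightarrow> real ^ 'n"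
    and v :: "real \<Rightarrow> real" and w :: "real \<Rightarrow> real ^ 'k"
  assumes v: "v absolutely_integrable_on {0..S}" and w: "w absolutely_integrable_on {0..S}"
    and "0 \<le> S" and "0 < c"
    and ge: "\<And>s. s \<in> {0..S} \<Longrightarrow> c \<le> v s" and total: "integral {0..S} v = 1"
    and z: "solution_upto f g x0 v w S z"
  obtains u x where "u absolutely_integrable_on {0..1}" "solution_upto f g x0 (\<lambda>_. 1) u 1 x"
    "x 1 = z S"
    "\<And>F :: real ^ 'n \<Rightarrow> real ^ 'k \<Rightarrow> real.
       (\<lambda>s. v s * F (z s) (w s /\<^sub>R v s)) absolutely_integrable_on {0..S} \<Longrightarrow>
       (\<lambda>t. F (x t) (u t)) absolutely_integrable_on {0..1} \<and>
       integral {0..1} (\<lambda>t. F (x t) (u t)) = integral {0..S} (\<lambda>s. v s * F (z s) (w s /\<^sub>R v s))"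
proof -
  obtain T R N where T_in: "\<And>s. s \<in> {0..S} \<Longrightarrow> T s \<in> {0..1}" and RT: "\<And>s. s \<in> {0..S} \<Longrightarrow> R (T s) = s"
    and R_in: "\<And>t. t \<in> {0..1} \<Longrightarrow> R t \<in> {0..S}" and TR: "\<And>t. t \<in> {0..1} \<Longrightarrow> T (R t) = t"
    and R0: "R 0 = 0" and R1: "R 1 = S"
    and R_le: "\<And>t t'. 0 \<le> t \<Longrightarrow> t \<le> t' \<Longrightarrow> t' \<le> 1 \<Longrightarrow> R t \<le> R t' \<and> c * (R t' - R t) \<le> t' - t"
    and T_neg: "\<And>M. negligible M \<Longrightarrow> M \<subseteq> {0..S} \<Longrightarrow> negligible (T ` M)"
    and N: "negligible N" "N \<subseteq> {0..S}"
    and T_der: "\<And>s. s \<in> {0..S} - N \<Longrightarrow> (T has_real_derivative v s) (at s)"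
    and R_der: "\<And>s. s \<in> {0..S} - N \<Longrightarrow> (R has_real_derivative inverse (v s)) (at (T s))"
  proof (rule time_change[OF v \<open>0 \<le> S\<close> \<open>0 < c\<close> ge total], assumption, goal_cases)
    case (1 T R N)
    show thesis by (rule that; fact 1)
  qed
  have v_pos: "0 < v s" if "s \<in> {0..S}" for s using ge[OF that] \<open>0 < c\<close> by simp
  let ?G = "{0..S} - N"
  have G_sets: "?G \<in> sets lebesgue" by (rule sets.Diff) (auto intro: negligible_imp_sets[OF N(1)])
  have T_inj: "inj_on T ?G" using RT by (intro inj_on_inverseI[of _ R]) auto
  have img: "{0..1} - T ` ?G \<subseteq> T ` N" "T ` ?G \<subseteq> {0..1}"
  proof -
    have "t \<in> T ` N" if "t \<in> {0..1} - T ` ?G" for t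
      using TR[of t] R_in[of t] that by (metis Diff_iff image_eqI)
    then show "{0..1} - T ` ?G \<subseteq> T ` N" by blast
    show "T ` ?G \<subseteq> {0..1}" using T_in by auto
  qed
  have TG_neg: "negligible ({0..1} - T ` ?G)"
    by (rule negligible_subset[OF T_neg[OF N] img(1)])
  have change: "(\<lambda>t. q (R t)) absolutely_integrable_on {0..1} \<and>
      integral {0..1} (\<lambda>t. q (R t)) = integral {0..S} (\<lambda>s. v s *\<^sub>R q s)"
    if q: "(\<lambda>s. v s *\<^sub>R q s) absolutely_integrable_on {0..S}" for q :: "real \<Rightarrow> 'b::euclidean_space"
  proof -
    have "(\<lambda>s. v s *\<^sub>R q s) absolutely_integrable_on ?G"
      using q by (rule absolutely_integrable_spike_set) (auto intro: negligible_subset[OF N(1)])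
    then have "(\<lambda>s. \<bar>v s\<bar> *\<^sub>R q (R (T s))) absolutely_integrable_on ?G"
      by (rule absolutely_integrable_spike[OF _ negligible_empty]) (use RT v_pos in \<open>auto simp: less_imp_le\<close>)
    moreover have "integral ?G (\<lambda>s. \<bar>v s\<bar> *\<^sub>R q (R (T s))) = integral {0..S} (\<lambda>s. v s *\<^sub>R q s)"
    proof -
      have "integral ?G (\<lambda>s. \<bar>v s\<bar> *\<^sub>R q (R (T s))) = integral ?G (\<lambda>s. v s *\<^sub>R q s)"
        by (rule integral_cong) (use RT v_pos in \<open>auto simp: less_imp_le\<close>)
      also have "\<dots> = integral {0..S} (\<lambda>s. v s *\<^sub>R q s)"
        by (rule integral_spike_set) (auto intro: negligible_subset[OF N(1)])
      finally show ?thesis .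
    qed
    ultimately have "(\<lambda>t. q (R t)) absolutely_integrable_on T ` ?G \<and>
        integral (T ` ?G) (\<lambda>t. q (R t)) = integral {0..S} (\<lambda>s. v s *\<^sub>R q s)"
      using has_absolute_integral_change_of_variables_real[OF G_sets, of T v "\<lambda>t. q (R t)"]
        DERIV_subset[OF T_der] T_inj by blast
    moreover have "negligible {t \<in> T ` ?G - {0..1}. q (R t) \<noteq> 0}" "negligible {t \<in> {0..1} - T ` ?G. q (R t) \<noteq> 0}"
    proof -
      have "{t \<in> T ` ?G - {0..1}. q (R t) \<noteq> 0} = {}" using img(2) by blast
      then show "negligible {t \<in> T ` ?G - {0..1}. q (R t) \<noteq> 0}" by (simp only: negligible_empty)
      show "negligible {t \<in> {0..1} - T ` ?G. q (R t) \<noteq> 0}"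
        by (rule negligible_subset[OF TG_neg]) blast
    qed
    ultimately show ?thesis
      using absolutely_integrable_spike_set[where f = "\<lambda>t. q (R t)" and S = "T ` ?G" and T = "{0..1}"]
        integral_spike_set[where f = "\<lambda>t. q (R t)" and S = "T ` ?G" and T = "{0..1}"] by auto
  qed
  define u where "u t = w (R t) /\<^sub>R v (R t)" for t
  define x where "x t = z (R t)" for t
  have z': "abs_cont_on 0 S z" "z 0 = x0"
    "AE s in lebesgue_on {0..S}. (z has_vector_derivative control_field f g (z s) (v s) (w s)) (at s)"
    using z by (auto simp: solution_upto_def)
  \<comment> \<open>Composing an absolutely continuous function with an increasing Lipschitz one:
    \<open>R\<close> maps nonoverlapping families to nonoverlapping families and stretches lengths
    by at most \<open>1 / c\<close>, whence the threshold \<open>c * d\<close>.\<close>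
  have x_ac: "abs_cont_on 0 1 x"
  proof (rule abs_cont_onI)
    fix e :: real assume "e > 0"
    then obtain d where "d > 0" and d: "\<And>(I::nat set) p q. nonoverlapping 0 S I p q \<Longrightarrow>
        (\<Sum>i\<in>I. q i - p i) < d \<Longrightarrow> (\<Sum>i\<in>I. norm (z (q i) - z (p i))) < e"
      using abs_cont_onE[OF z'(1)] by blast
    show "\<exists>d>0. \<forall>(I::nat set) p q. nonoverlapping 0 1 I p q \<longrightarrow>
      (\<Sum>i\<in>I. q i - p i) < d \<longrightarrow> (\<Sum>i\<in>I. norm (x (q i) - x (p i))) < e"
    proof (intro exI[of _ "c * d"] conjI allI impI)
      show "0 < c * d" using \<open>0 < c\<close> \<open>0 < d\<close> by simp
      fix I :: "nat set" and p q
      assume no: "nonoverlapping 0 1 I p q" and less: "(\<Sum>i\<in>I. q i - p i) < c * d"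
      have pq: "0 \<le> p i" "p i \<le> q i" "q i \<le> 1" if "i \<in> I" for i
        using no that by (auto simp: nonoverlapping_def)
      \<comment> \<open>Disjointness of the images under \<open>R\<close> is checked by carrying a
        common point back with \<open>T\<close>.\<close>
      have sub: "T s \<in> {p i<..<q i}" if "i \<in> I" "s \<in> {R (p i)<..<R (q i)}" for i s
      proof -
        have s: "s \<in> {0..S}" using that R_in[of "p i"] R_in[of "q i"] pq[OF that(1)] by auto
        have "p i < T s"
          using R_le[of "T s" "p i"] RT[OF s] T_in[OF s] pq[OF that(1)] that(2) by fastforce
        moreover have "T s < q i"
          using R_le[of "q i" "T s"] RT[OF s] T_in[OF s] pq[OF that(1)] that(2) by fastforce
        ultimately show ?thesis by simp
      qed
      have "nonoverlapping 0 S I (\<lambda>i. R (p i)) (\<lambda>i. R (q i))"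
        unfolding nonoverlapping_def
      proof (intro conjI ballI impI)
        show "finite I" using no by (simp add: nonoverlapping_def)
        fix i assume i: "i \<in> I"
        show "0 \<le> R (p i)" "R (q i) \<le> S" "R (p i) \<le> R (q i)"
          using R_in[of "p i"] R_in[of "q i"] R_le[of "p i" "q i"] pq[OF i] by auto
        fix j assume j: "j \<in> I" "i \<noteq> j"
        then have "{p i<..<q i} \<inter> {p j<..<q j} = {}" using no i unfolding nonoverlapping_def by blast
        then show "{R (p i)<..<R (q i)} \<inter> {R (p j)<..<R (q j)} = {}"
          using sub[OF i] sub[OF j(1)] by blast
      qed
      moreover have "(\<Sum>i\<in>I. R (q i) - R (p i)) < d"
      proof -
        have "c * (\<Sum>i\<in>I. R (q i) - R (p i)) \<le> (\<Sum>i\<in>I. q i - p i)"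
          unfolding sum_distrib_left using R_le pq by (intro sum_mono) blast
        then have "c * (\<Sum>i\<in>I. R (q i) - R (p i)) < c * d" using less by simp
        then show ?thesis using \<open>0 < c\<close> by simp
      qed
      ultimately show "(\<Sum>i\<in>I. norm (x (q i) - x (p i))) < e"
        unfolding x_def by (rule d)
    qed
  qed
  obtain M where M: "negligible M"
    "\<And>s. s \<in> {0..S} - M \<Longrightarrow> (z has_vector_derivative control_field f g (z s) (v s) (w s)) (at s)"
    using z'(3) unfolding AE_lebesgue_on_Icc_iff by blast
  have "AE t in lebesgue_on {0..1}. (x has_vector_derivative control_field f g (x t) 1 (u t)) (at t)"
    unfolding AE_lebesgue_on_Icc_iff
  proof (intro exI conjI ballI)
    \<comment> \<open>The bad times are the image under \<open>T\<close> of the bad parameters, null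
      by property (N).\<close>
    have "negligible ((N \<union> M) \<inter> {0..S})"
      by (rule negligible_subset[OF negligible_Un[OF N(1) M(1)]]) auto
    then show "negligible (T ` ((N \<union> M) \<inter> {0..S}))" by (rule T_neg) auto
    fix t assume t: "t \<in> {0..1} - T ` ((N \<union> M) \<inter> {0..S})"
    define s where "s = R t"
    have s: "s \<in> {0..S}" "T s = t" using R_in TR t by (auto simp: s_def)
    then have "s \<notin> N" "s \<notin> M" using t by blast+
    have "(R has_vector_derivative inverse (v s)) (at t)"
      using R_der[of s] s \<open>s \<notin> N\<close> by (simp add: has_real_derivative_iff_has_vector_derivative)
    then have "(z \<circ> R has_vector_derivative inverse (v s) *\<^sub>R control_field f g (z s) (v s) (w s)) (at t)"
      using M(2)[of s] s \<open>s \<notin> M\<close> by (intro vector_diff_chain_at) (auto simp: s_def)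
    moreover have "inverse (v s) *\<^sub>R control_field f g (z s) (v s) (w s) = control_field f g (x t) 1 (u t)"
      using v_pos[OF s(1)] by (simp add: control_field_def x_def u_def s_def scaleR_right_distrib scaleR_sum_right)
    moreover have "z \<circ> R = x" by (simp add: fun_eq_iff x_def)
    ultimately show "(x has_vector_derivative control_field f g (x t) 1 (u t)) (at t)" by simp
  qed
  then have x_sol: "solution_upto f g x0 (\<lambda>_. 1) u 1 x"
    using x_ac z'(2) R0 by (simp add: solution_upto_def x_def)
  \<comment> \<open>Multiplying \<open>w / v\<close> by the Jacobian \<open>v\<close> returns the
    integrable function \<open>w\<close>.\<close>
  have "(\<lambda>s. v s *\<^sub>R (w s /\<^sub>R v s)) absolutely_integrable_on {0..S}"
    by (rule absolutely_integrable_spike[OF w negligible_empty]) (use v_pos in \<open>auto simp: less_imp_neq[symmetric]\<close>)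
  from change[OF this] have u_int: "u absolutely_integrable_on {0..1}"
    unfolding u_def by blast
  show thesis
  proof (rule that[OF u_int x_sol])
    show "x 1 = z S" by (simp add: x_def R1)
    fix F :: "real ^ 'n \<Rightarrow> real ^ 'k \<Rightarrow> real"
    assume "(\<lambda>s. v s * F (z s) (w s /\<^sub>R v s)) absolutely_integrable_on {0..S}"
    then show "(\<lambda>t. F (x t) (u t)) absolutely_integrable_on {0..1} \<and>
       integral {0..1} (\<lambda>t. F (x t) (u t)) = integral {0..S} (\<lambda>s. v s * F (z s) (w s /\<^sub>R v s))"
      using change[of "\<lambda>s. F (z s) (w s /\<^sub>R v s)"] by (simp add: x_def u_def)
  qed
qed

section \<open>Approximation by ordinary controls\<close>

text \<open>Integrability and the bound by \<open>r\<close> are required for all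
  \<open>e > 0\<close> because the proof itself picks \<open>e\<close>, depending on the trajectory,
  on the size of the controls and on \<open>r\<close>, \<open>\<epsilon>\<close> and
  \<open>\<delta>\<close>.\<close>

lemma ordinary_control_approximation:
  fixes f :: "real ^ 'n \<Rightarrow> real ^ 'n" and g :: "'k::finite \<Rightarrow> real ^ 'n \<Rightarrow> real ^ 'n"
    and L1 :: "real ^ 'n \<Rightarrow> real" and L2 :: "real ^ 'k \<Rightarrow> real"
    and v :: "real \<Rightarrow> real" and w :: "real \<Rightarrow> real ^ 'k"
  assumes f: "local_lipschitz (UNIV :: real set) UNIV (\<lambda>_. f)"
    and g: "\<And>j. local_lipschitz (UNIV :: real set) UNIV (\<lambda>_. g j)"
    and L1: "continuous_on UNIV L1"
    and "0 \<le> S" and v: "v absolutely_integrable_on {0..S}" and w: "w absolutely_integrable_on {0..S}"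
    and v_nonneg: "\<And>s. 0 \<le> v s" and v_total: "integral {0..S} v = 1"
    and y: "solution_upto f g x0 v w S y"
    and L2_int: "\<And>e. 0 < e \<Longrightarrow> (\<lambda>s. (v s + e) * L2 (w s /\<^sub>R (v s + e))) absolutely_integrable_on {0..S}"
    and cost: "\<And>e. 0 < e \<Longrightarrow>
      integral {0..S} (\<lambda>s. L1 (y s) * v s + (v s + e) * L2 (w s /\<^sub>R (v s + e)) - e * L2 0) \<le> r"
    and "0 < \<epsilon>" "0 < \<delta>"
  obtains u x where "u absolutely_integrable_on {0..1}" "solution_upto f g x0 (\<lambda>_. 1) u 1 x"
    "norm (x 1 - y S) \<le> \<epsilon>" "(\<lambda>t. L1 (x t) + L2 (u t)) absolutely_integrable_on {0..1}"
    "integral {0..1} (\<lambda>t. L1 (x t) + L2 (u t)) \<le> r + \<delta>"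
proof -
  have y_cont: "continuous_on {0..S} y" by (rule solution_upto_continuous_on[OF y])
  have "bounded (y ` {0..S})" using y_cont by (intro compact_imp_bounded compact_continuous_image) auto
  then obtain R where R: "\<And>s. s \<in> {0..S} \<Longrightarrow> norm (y s) \<le> R"
    unfolding bounded_iff by (meson imageI)
  define B where "B = (cball 0 (R + 1) :: (real ^ 'n) set)"
  have L1_B: "continuous_on B L1" by (rule continuous_on_subset[OF L1]) simp
  have "compact B" by (simp add: B_def)
  then have "bounded (L1 ` B)" by (intro compact_imp_bounded compact_continuous_image L1_B)
  then obtain M where "0 < M" and M: "\<And>x. x \<in> B \<Longrightarrow> \<bar>L1 x\<bar> \<le> M" unfolding bounded_pos by auto
  have "uniformly_continuous_on B L1" by (rule compact_uniformly_continuous[OF L1_B \<open>compact B\<close>])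
  then obtain \<eta> where "0 < \<eta>"
    and \<eta>: "\<And>a b. a \<in> B \<Longrightarrow> b \<in> B \<Longrightarrow> dist b a < \<eta> \<Longrightarrow> dist (L1 b) (L1 a) < \<delta> / 2"
    unfolding uniformly_continuous_on_def using \<open>0 < \<delta>\<close> half_gt_zero by metis
  \<comment> \<open>Half of \<open>\<eta>\<close> gives the strict inequality of uniform continuity,
    1 keeps the new trajectory in \<open>B\<close>, and \<open>\<epsilon>\<close> controls the end
    point.\<close>
  define \<rho> where "\<rho> = min (min (\<eta>/2) 1) \<epsilon>"
  have "0 < \<rho>" using \<open>0 < \<eta>\<close> \<open>0 < \<epsilon>\<close> by (simp add: \<rho>_def)
  obtain d where "0 < d" and d: "\<And>v' w'. v' absolutely_integrable_on {0..S} \<Longrightarrow> w' absolutely_integrable_on {0..S} \<Longrightarrow>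
       (\<And>s. s \<in> {0..S} \<Longrightarrow> control_weight (v' s) (w' s) \<le> control_weight (v s) (w s) + 1) \<Longrightarrow>
       integral {0..S} (\<lambda>s. control_weight (v' s - v s) (w' s - w s)) \<le> d \<Longrightarrow>
       \<exists>z. solution_upto f g x0 v' w' S z \<and> (\<forall>s\<in>{0..S}. norm (z s - y s) \<le> \<rho>)"
    using trajectory_perturbation[OF f g \<open>0 \<le> S\<close> v w y \<open>0 < \<rho>\<close>] by blast
  note on = set_lebesgue_integral_eq_integral(1)
  have hv: "(v has_integral 1) {0..S}" using integrable_integral[OF on[OF v]] v_total by simp
  have hc: "((\<lambda>_. b) has_integral (b * S)) {0..S}" for b :: real
    using has_integral_const_real[of b 0 S] \<open>0 \<le> S\<close> by (simp add: mult.commute)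
  define W where "W = integral {0..S} (\<lambda>s. control_weight (v s) (w s))"
  have cw_int: "(\<lambda>s. control_weight (v s) (w s)) absolutely_integrable_on {0..S}"
    using v w by (rule control_weight_absolutely_integrable)
  have "0 \<le> W" unfolding W_def
    by (intro Henstock_Kurzweil_Integration.integral_nonneg set_lebesgue_integral_eq_integral(1)[OF cw_int]) auto
  \<comment> \<open>Collects the cost errors proportional to \<open>e * S\<close>: \<open>M\<close>
    for \<open>L1\<close> during the added time, \<open>L2 0\<close> for waiting without control,
    and \<open>r\<close> for rescaling the cost by \<open>\<mu>\<close>.\<close>
  define Q where "Q = M + \<bar>L2 0\<bar> + \<bar>r\<bar>"
  have "0 \<le> Q" using \<open>0 < M\<close> by (simp add: Q_def)
  \<comment> \<open>The three caps serve, in this order, the pointwise weight bound, the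
    \<open>L1\<close> distance of the controls, and the cost. The added 1 keeps the denominators
    positive.\<close>
  define e where "e = min 1 (min (d / (S * (W + 1) + 1)) (\<delta> / 2 / (S * Q + 1)))"
  have SW: "0 \<le> S * (W + 1)" and SQ: "0 \<le> S * Q" using \<open>0 \<le> S\<close> \<open>0 \<le> W\<close> \<open>0 \<le> Q\<close> by simp_all
  have "0 < e" using \<open>0 < d\<close> \<open>0 < \<delta>\<close> SW SQ by (auto simp: e_def)
  have "e \<le> 1" by (simp add: e_def)
  have e_d: "e * (S * (W + 1)) \<le> d"
  proof -
    have "e * (S * (W + 1)) \<le> e * (S * (W + 1) + 1)" using \<open>0 < e\<close> by (intro mult_left_mono) auto
    also have "\<dots> \<le> d / (S * (W + 1) + 1) * (S * (W + 1) + 1)"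
      using SW by (intro mult_right_mono) (auto simp: e_def)
    also have "\<dots> = d" using SW by simp
    finally show ?thesis .
  qed
  have e_\<delta>: "e * (S * Q) \<le> \<delta> / 2"
  proof -
    have "e * (S * Q) \<le> e * (S * Q + 1)" using \<open>0 < e\<close> by (intro mult_left_mono) auto
    also have "\<dots> \<le> \<delta> / 2 / (S * Q + 1) * (S * Q + 1)"
      using SQ by (intro mult_right_mono) (auto simp: e_def)
    also have "\<dots> = \<delta> / 2"
    proof -
      have "S * Q + 1 \<noteq> 0" using SQ by linarith
      then show ?thesis by (metis nonzero_eq_divide_eq)
    qed
    finally show ?thesis .
  qed
  define \<mu> where "\<mu> = 1 / (1 + e * S)"
  have eS: "0 \<le> e * S" using \<open>0 < e\<close> \<open>0 \<le> S\<close> by simp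
  have \<mu>: "0 < \<mu>" "\<mu> \<le> 1" "\<mu> * (1 + e * S) = 1" "1 - \<mu> \<le> e * S"
  proof -
    show pos: "0 < \<mu>" and le: "\<mu> \<le> 1" and one: "\<mu> * (1 + e * S) = 1"
      using eS by (auto simp: \<mu>_def)
    have "1 - \<mu> = \<mu> * (e * S)" using one by (simp add: algebra_simps)
    also have "\<dots> \<le> 1 * (e * S)" using le eS by (intro mult_right_mono) auto
    finally show "1 - \<mu> \<le> e * S" by simp
  qed
  define v' where "v' s = \<mu> * (v s + e)" for s
  define w' where "w' s = \<mu> *\<^sub>R w s" for s
  have const_int: "(\<lambda>_. c) absolutely_integrable_on {0..S}" for c :: real
    by (rule absolutely_integrable_on_const) auto
  have ve_int: "(\<lambda>s. v s + e) absolutely_integrable_on {0..S}"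
    using v const_int by (rule set_integral_add)
  have v'_int: "v' absolutely_integrable_on {0..S}"
    unfolding v'_def using ve_int by simp
  have w'_int: "w' absolutely_integrable_on {0..S}"
    unfolding w'_def by (rule absolutely_integrable_scaleR_left[OF w])
  have weight: "control_weight (v' s) (w' s) \<le> control_weight (v s) (w s) + 1" for s
  proof -
    have "\<bar>v' s\<bar> \<le> v s + 1"
    proof -
      have "\<mu> * (v s + e) \<le> 1 * (v s + e)" using \<mu> v_nonneg[of s] \<open>0 < e\<close> by (intro mult_right_mono) auto
      moreover have "0 \<le> \<mu> * (v s + e)" using \<mu> v_nonneg[of s] \<open>0 < e\<close> by simp
      ultimately show ?thesis using \<open>e \<le> 1\<close> by (simp add: v'_def)
    qed
    moreover have "\<bar>w' s $ j\<bar> \<le> \<bar>w s $ j\<bar>" for j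
      using \<mu> mult_right_mono[of \<mu> 1 "\<bar>w s $ j\<bar>"] by (simp add: w'_def abs_mult)
    ultimately show ?thesis
      using v_nonneg[of s] by (simp add: control_weight_def) (smt (verit) sum_mono)
  qed
  have close: "integral {0..S} (\<lambda>s. control_weight (v' s - v s) (w' s - w s)) \<le> d"
  proof -
    \<comment> \<open>Rescaling by \<open>\<mu>\<close> accounts for the factor
      \<open>1 - \<mu>\<close>, waiting for the summand \<open>e\<close>.\<close>
    have le: "control_weight (v' s - v s) (w' s - w s) \<le> (1 - \<mu>) * control_weight (v s) (w s) + e" for s
    proof -
      have "v' s - v s = \<mu> * e - (1 - \<mu>) * v s" by (simp add: v'_def algebra_simps)
      moreover have "0 \<le> (1 - \<mu>) * v s" using \<mu> v_nonneg by simp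
      moreover have "0 \<le> \<mu> * e" "\<mu> * e \<le> 1 * e" using \<mu> \<open>0 < e\<close> by (auto intro: mult_right_mono)
      ultimately have "\<bar>v' s - v s\<bar> \<le> (1 - \<mu>) * \<bar>v s\<bar> + e" using v_nonneg[of s] by simp
      moreover have "\<bar>(w' s - w s) $ j\<bar> = (1 - \<mu>) * \<bar>w s $ j\<bar>" for j
      proof -
        have "(w' s - w s) $ j = - ((1 - \<mu>) * w s $ j)" by (simp add: w'_def algebra_simps)
        then show ?thesis using \<mu> by (simp add: abs_mult)
      qed
      ultimately show ?thesis by (simp add: control_weight_def distrib_left sum_distrib_left)
    qed
    have hW: "((\<lambda>s. control_weight (v s) (w s)) has_integral W) {0..S}"
      unfolding W_def by (rule integrable_integral[OF on[OF cw_int]])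
    have "(\<lambda>s. control_weight (v' s - v s) (w' s - w s)) integrable_on {0..S}"
      by (intro on control_weight_absolutely_integrable set_integral_diff v v'_int w w'_int)
    from has_integral_le[OF integrable_integral[OF this]
        has_integral_add[OF has_integral_mult_right[OF hW, of "1 - \<mu>"] hc[of e]] le]
    have "integral {0..S} (\<lambda>s. control_weight (v' s - v s) (w' s - w s)) \<le> (1 - \<mu>) * W + e * S"
      by simp
    also have "\<dots> \<le> (e * S) * W + e * S"
      using \<mu>(4) \<open>0 \<le> W\<close> by (intro add_right_mono mult_right_mono)
    also have "\<dots> = e * (S * (W + 1))" by (simp add: algebra_simps)
    finally show ?thesis using e_d by simp
  qed
  obtain z where z: "solution_upto f g x0 v' w' S z" and zy: "\<And>s. s \<in> {0..S} \<Longrightarrow> norm (z s - y s) \<le> \<rho>"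
    using d[OF v'_int w'_int weight close] by blast
  have z_cont: "continuous_on {0..S} z" by (rule solution_upto_continuous_on[OF z])
  have total: "integral {0..S} v' = 1"
  proof -
    have "(v' has_integral (\<mu> * (1 + e * S))) {0..S}"
      unfolding v'_def by (intro has_integral_mult_right has_integral_add hv hc)
    then show ?thesis using \<mu>(3) by (simp add: integral_unique)
  qed
  have ge: "\<mu> * e \<le> v' s" for s using \<mu>(1) v_nonneg[of s] by (simp add: v'_def)
  have "0 < \<mu> * e" using \<mu>(1) \<open>0 < e\<close> by simp
  obtain u x where u: "u absolutely_integrable_on {0..1}" and x: "solution_upto f g x0 (\<lambda>_. 1) u 1 x"
    and x1: "x 1 = z S"
    and change: "\<And>F :: real ^ 'n \<Rightarrow> real ^ 'k \<Rightarrow> real.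
       (\<lambda>s. v' s * F (z s) (w' s /\<^sub>R v' s)) absolutely_integrable_on {0..S} \<Longrightarrow>
       (\<lambda>t. F (x t) (u t)) absolutely_integrable_on {0..1} \<and>
       integral {0..1} (\<lambda>t. F (x t) (u t)) = integral {0..S} (\<lambda>s. v' s * F (z s) (w' s /\<^sub>R v' s))"
    using time_change_ordinary_control[OF v'_int w'_int \<open>0 \<le> S\<close> \<open>0 < \<mu> * e\<close> ge total z] by blast
  have zB: "z s \<in> B" and yB: "y s \<in> B" if "s \<in> {0..S}" for s
    using zy[OF that] R[OF that] norm_triangle_ineq2[of "z s" "y s"] by (auto simp: B_def \<rho>_def)
  have L1_close: "\<bar>L1 (z s) - L1 (y s)\<bar> \<le> \<delta> / 2" if "s \<in> {0..S}" for s
  proof -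
    have "dist (z s) (y s) < \<eta>" using zy[OF that] \<open>0 < \<eta>\<close> by (auto simp: dist_norm \<rho>_def)
    from \<eta>[OF yB[OF that] zB[OF that] this] show ?thesis by (simp add: dist_real_def)
  qed
  let ?a = "\<lambda>s. (v s + e) * L2 (w s /\<^sub>R (v s + e))"
  have a_int: "?a absolutely_integrable_on {0..S}" by (rule L2_int[OF \<open>0 < e\<close>])
  have L1z_int: "(\<lambda>s. (v s + e) * L1 (z s)) absolutely_integrable_on {0..S}"
    using absolutely_integrable_scaleR_continuous[OF ve_int continuous_on_compose2[OF L1 z_cont]] by simp
  have L1y_int: "(\<lambda>s. v s * L1 (y s)) absolutely_integrable_on {0..S}"
    using absolutely_integrable_scaleR_continuous[OF v continuous_on_compose2[OF L1 y_cont]] by simp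
  \<comment> \<open>Since \<open>\<mu>\<close> cancels in \<open>w' / v'\<close>, the
    \<open>L2\<close> term is exactly \<open>\<mu>\<close> times the perspective at
    \<open>v + e\<close>, to which the hypotheses apply.\<close>
  have F_eq: "v' s * (L1 (z s) + L2 (w' s /\<^sub>R v' s)) = \<mu> * ((v s + e) * L1 (z s) + ?a s)" for s
  proof -
    have "w' s /\<^sub>R v' s = w s /\<^sub>R (v s + e)"
      using \<mu>(1) by (simp add: w'_def v'_def)
    then show ?thesis by (simp add: v'_def algebra_simps)
  qed
  have "(\<lambda>s. v' s * (L1 (z s) + L2 (w' s /\<^sub>R v' s))) absolutely_integrable_on {0..S}"
    unfolding F_eq using set_integral_add(1)[OF L1z_int a_int] by simp
  from change[of "\<lambda>x u. L1 x + L2 u", OF this]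
  have xu_int: "(\<lambda>t. L1 (x t) + L2 (u t)) absolutely_integrable_on {0..1}"
    and xu_cost: "integral {0..1} (\<lambda>t. L1 (x t) + L2 (u t)) = \<mu> * (integral {0..S} (\<lambda>s. (v s + e) * L1 (z s)) + integral {0..S} ?a)"
    unfolding F_eq using on[OF L1z_int] on[OF a_int] by (auto simp: Henstock_Kurzweil_Integration.integral_add)
  have a_le: "integral {0..S} ?a \<le> r - integral {0..S} (\<lambda>s. v s * L1 (y s)) + e * S * L2 0"
  proof -
    have "((\<lambda>s. v s * L1 (y s) + ?a s - e * L2 0) has_integral
        (integral {0..S} (\<lambda>s. v s * L1 (y s)) + integral {0..S} ?a - e * L2 0 * S)) {0..S}"
      by (intro has_integral_diff has_integral_add integrable_integral on L1y_int a_int hc)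
    then have "integral {0..S} (\<lambda>s. L1 (y s) * v s + ?a s - e * L2 0) =
        integral {0..S} (\<lambda>s. v s * L1 (y s)) + integral {0..S} ?a - e * L2 0 * S"
      by (simp add: integral_unique mult.commute[of "L1 _"])
    then show ?thesis using cost[OF \<open>0 < e\<close>] by (simp add: algebra_simps)
  qed
  have L1_le: "integral {0..S} (\<lambda>s. (v s + e) * L1 (z s)) \<le> integral {0..S} (\<lambda>s. v s * L1 (y s)) + \<delta>/2 + e * S * M"
  proof -
    \<comment> \<open>The oscillation \<open>\<delta> / 2\<close> of \<open>L1\<close> is weighted
      by \<open>v\<close>, of integral 1, and so enters once whatever \<open>S\<close> is; only the
      added time contributes the bound \<open>M\<close>.\<close>
    have "((\<lambda>s. v s * L1 (y s) + v s * (\<delta>/2) + e * M) has_integral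
        (integral {0..S} (\<lambda>s. v s * L1 (y s)) + 1 * (\<delta>/2) + e * M * S)) {0..S}"
      by (intro has_integral_add has_integral_mult_left integrable_integral on L1y_int hv hc)
    from integrable_integral[OF on[OF L1z_int]] this
    have "integral {0..S} (\<lambda>s. (v s + e) * L1 (z s)) \<le>
        integral {0..S} (\<lambda>s. v s * L1 (y s)) + 1 * (\<delta>/2) + e * M * S"
    proof (rule has_integral_le)
      fix s assume s: "s \<in> {0..S}"
      have "L1 (z s) \<le> L1 (y s) + \<delta>/2" using L1_close[OF s] by linarith
      then have "v s * L1 (z s) \<le> v s * (L1 (y s) + \<delta>/2)"
        using v_nonneg[of s] by (intro mult_left_mono)
      moreover have "e * L1 (z s) \<le> e * M"
        using M[OF zB[OF s]] \<open>0 < e\<close> by (intro mult_left_mono) auto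
      ultimately show "(v s + e) * L1 (z s) \<le> v s * L1 (y s) + v s * (\<delta>/2) + e * M"
        by (simp add: algebra_simps)
    qed
    then show ?thesis by (simp add: algebra_simps)
  qed
  have "integral {0..1} (\<lambda>t. L1 (x t) + L2 (u t)) \<le> \<mu> * (r + \<delta>/2 + e * S * M + e * S * L2 0)"
    unfolding xu_cost using a_le L1_le \<mu>(1) by (intro mult_left_mono) auto
  also have "\<dots> \<le> r + \<delta>"
  proof -
    have "\<mu> * (r + \<delta>/2 + e * S * M + e * S * L2 0) =
        r + - ((1 - \<mu>) * r) + \<mu> * (\<delta>/2 + e * S * M + e * S * L2 0)" by (simp add: algebra_simps)
    \<comment> \<open>If \<open>r\<close> is negative, multiplying by \<open>\<mu> \<le> 1\<close>
      increases it; the increase is at most \<open>e * S * \<bar>r\<bar>\<close>.\<close>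
    moreover have "- ((1 - \<mu>) * r) \<le> (e * S) * \<bar>r\<bar>"
    proof -
      have "- ((1 - \<mu>) * r) \<le> (1 - \<mu>) * \<bar>r\<bar>" using \<mu>(2) mult_left_mono[of "- r" "\<bar>r\<bar>" "1 - \<mu>"] by simp
      also have "\<dots> \<le> (e * S) * \<bar>r\<bar>" using \<mu>(4) by (intro mult_right_mono) auto
      finally show ?thesis .
    qed
    moreover have "\<mu> * (\<delta>/2 + e * S * M + e * S * L2 0) \<le> \<delta>/2 + e * S * M + e * S * \<bar>L2 0\<bar>"
    proof -
      let ?Y = "\<delta>/2 + e * S * M + e * S * \<bar>L2 0\<bar>"
      have "e * S * L2 0 \<le> e * S * \<bar>L2 0\<bar>" using eS by (intro mult_left_mono) auto
      then have "\<mu> * (\<delta>/2 + e * S * M + e * S * L2 0) \<le> \<mu> * ?Y"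
        using \<mu>(1) by (intro mult_left_mono) auto
      also have "0 \<le> ?Y" using \<open>0 < e\<close> \<open>0 \<le> S\<close> \<open>0 < M\<close> \<open>0 < \<delta>\<close>
        by (intro add_nonneg_nonneg mult_nonneg_nonneg) auto
      then have "\<mu> * ?Y \<le> 1 * ?Y" using \<mu>(2) by (intro mult_right_mono)
      finally show ?thesis by simp
    qed
    moreover have "e * (S * Q) = e * S * M + e * S * \<bar>L2 0\<bar> + (e * S) * \<bar>r\<bar>"
      by (simp add: Q_def algebra_simps)
    ultimately show ?thesis using e_\<delta> by linarith
  qed
  finally have cost_le: "integral {0..1} (\<lambda>t. L1 (x t) + L2 (u t)) \<le> r + \<delta>" .
  have "norm (x 1 - y S) \<le> \<epsilon>" using zy[of S] x1 \<open>0 \<le> S\<close> by (auto simp: \<rho>_def)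
  from that[OF u x this xu_int cost_le] show thesis .
qed

section \<open>The final parameter of a space-time control\<close>

text \<open>The time component is nondecreasing with limit above 1, so the parameters with time at
  most 1 form a compact interval, and by continuity the time equals 1 at its right end. The
  integrability statements are the fundamental theorem for the two components.\<close>

lemma space_time_control_properties:
  fixes p :: "real \<Rightarrow> real \<times> (real ^ 'k)"
  assumes p: "p \<in> space_time_controls"
  defines "S \<equiv> final_param p"
    and "v \<equiv> \<lambda>s. fst (vector_derivative p (at s))"
    and "w \<equiv> \<lambda>s. snd (vector_derivative p (at s))"
  shows "0 \<le> S" "v absolutely_integrable_on {0..S}" "w absolutely_integrable_on {0..S}"
    "AE s in lebesgue_on {0..S}. 0 \<le> v s" "integral {0..S} v = 1"
proof -
  let ?V = "\<lambda>s. fst (p s)"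
  have ac: "abs_cont_on 0 b p" if "0 < b" for b
    using p that by (auto simp: space_time_controls_def loc_abs_cont_def)
  have p0: "p 0 = (0, 0)" using p by (simp add: space_time_controls_def)
  have der: "AE s in lebesgue_on {0..b}. (p has_vector_derivative vector_derivative p (at s)) (at s)" if "0 < b" for b
  proof -
    obtain k N where "k absolutely_integrable_on {0..b}"
      "\<And>x. x \<in> {0..b} \<Longrightarrow> (k has_integral (p x - p 0)) {0..x}"
      "negligible N" "\<And>x. x \<in> {0..b} - N \<Longrightarrow> (p has_vector_derivative k x) (at x)"
      using abs_cont_on_ae_derivative[OF ac[OF \<open>0 < b\<close>] less_imp_le[OF \<open>0 < b\<close>]] by blast
    then show ?thesis
      unfolding AE_lebesgue_on_Icc_iff by (metis vector_derivative_at)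
  qed
  have V_ac: "abs_cont_on 0 b ?V" if "0 < b" for b
    by (rule abs_cont_on_bounded_linear[OF bounded_linear_fst ac[OF that]])
  have V_der: "AE s in lebesgue_on {0..b}. (?V has_vector_derivative v s) (at s)" if "0 < b" for b
    using der[OF that] unfolding v_def
    by (rule eventually_mono) (rule bounded_linear.has_vector_derivative[OF bounded_linear_fst])
  have v_nonneg: "AE s in lebesgue_on {0..b}. 0 \<le> v s" for b
  proof -
    have "AE s in lebesgue. s \<in> {0..} \<longrightarrow> 0 \<le> v s"
      using p unfolding space_time_controls_def v_def by (subst AE_restrict_space_iff[symmetric]) auto
    then show ?thesis by (subst AE_restrict_space_iff) (auto elim: eventually_mono)
  qed
  have V_mono: "?V x \<le> ?V y" if "0 \<le> x" "x \<le> y" for x y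
    by (rule abs_cont_on_mono_if_derivative_nonneg[OF V_ac _ V_der v_nonneg, of "y + 1"]) (use that in auto)
  obtain s0 where s0: "0 \<le> s0" "1 < ?V s0"
  proof (rule ccontr)
    assume "\<not> thesis"
    then have le: "?V s \<le> 1" if "0 \<le> s" for s using that \<open>\<And>s0. 0 \<le> s0 \<Longrightarrow> 1 < ?V s0 \<Longrightarrow> thesis\<close> by force
    \<comment> \<open>\<open>Lim\<close> only carries information once the limit exists;
      monotonicity identifies it with this supremum.\<close>
    let ?l = "SUP s\<in>{0..}. ereal (?V s)"
    have "((\<lambda>s. ereal (?V s)) \<longlongrightarrow> ?l) at_top"
    proof (rule order_tendstoI)
      fix a assume "a < ?l"
      then obtain s where "0 \<le> s" "a < ereal (?V s)" by (auto simp: less_SUP_iff)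
      then show "\<forall>\<^sub>F t in at_top. a < ereal (?V t)"
        using V_mono by (intro eventually_at_top_linorderI[of s]) (meson ereal_less_eq(3) less_le_trans)
    next
      fix a assume "?l < a"
      then have "ereal (?V t) < a" if "0 \<le> t" for t
        using SUP_upper[of t "{0..}" "\<lambda>s. ereal (?V s)"] that by (auto intro: le_less_trans)
      then show "\<forall>\<^sub>F t in at_top. ereal (?V t) < a"
        by (intro eventually_at_top_linorderI[of 0])
    qed
    then have "Lim at_top (\<lambda>s. ereal (?V s)) = ?l" by (intro tendsto_Lim) auto
    then have "1 < ?l" using p by (simp add: space_time_controls_def)
    moreover have "?l \<le> 1" using le by (intro SUP_least) auto
    ultimately show False by (meson leD)
  qed
  let ?A = "{s. 0 \<le> s \<and> ?V s \<le> 1}"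
  have A_le: "s \<le> s0" if "s \<in> ?A" for s
    using V_mono[OF s0(1), of s] s0 that by (cases "s \<le> s0") auto
  have "0 \<in> ?A" using p0 by simp
  have V_cont: "continuous_on {0..s0} ?V"
    by (rule continuous_on_subset[OF abs_cont_on_imp_continuous_on[OF V_ac[of "s0 + 1"]]]) (use s0 in auto)
  have "?A = {0..s0} \<inter> ?V -` {..1}" using A_le by auto
  then have "closed ?A" using continuous_closed_preimage[OF V_cont, of "{..1}"] by simp
  moreover have bdd: "bdd_above ?A" using A_le by (rule bdd_aboveI)
  ultimately have "S \<in> ?A"
    unfolding S_def final_param_def using \<open>0 \<in> ?A\<close> by (intro closed_contains_Sup) auto
  then have S: "0 \<le> S" "?V S \<le> 1" by auto
  have upper: "s \<le> S" if "s \<in> ?A" for s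
    unfolding S_def final_param_def by (rule cSup_upper[OF that bdd])
  \<comment> \<open>Otherwise the intermediate value theorem yields a parameter beyond
    \<open>S\<close> with time equal to 1, contradicting that \<open>S\<close> is an upper
    bound.\<close>
  have VS: "?V S = 1"
  proof (rule ccontr)
    assume "?V S \<noteq> 1"
    then have "?V S < 1" using S by simp
    moreover have "S \<le> s0" using A_le S by simp
    ultimately obtain s where "S \<le> s" "s \<le> s0" "?V s = 1"
      using IVT'[of ?V S 1 s0] s0 S continuous_on_subset[OF V_cont, of "{S..s0}"] by auto
    then show False using upper[of s] S \<open>?V S \<noteq> 1\<close> by auto
  qed
  have "S \<noteq> 0" using VS p0 by auto
  then have "0 < S" using S by simp
  show "0 \<le> S" by (rule S(1))
  show "AE s in lebesgue_on {0..S}. 0 \<le> v s" by (rule v_nonneg)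
  note V = abs_cont_on_has_integral_derivative[OF V_ac[OF \<open>0 < S\<close>] S(1) V_der[OF \<open>0 < S\<close>]]
  show "v absolutely_integrable_on {0..S}" by (rule V(1))
  show "integral {0..S} v = 1" using V(2)[of 0 S] S(1) VS p0 by (auto dest: integral_unique)
  have W_ac: "abs_cont_on 0 S (\<lambda>s. snd (p s))"
    by (rule abs_cont_on_bounded_linear[OF bounded_linear_snd ac[OF \<open>0 < S\<close>]])
  have W_der: "AE s in lebesgue_on {0..S}. ((\<lambda>s. snd (p s)) has_vector_derivative w s) (at s)"
    using der[OF \<open>0 < S\<close>] unfolding w_def
    by (rule eventually_mono) (rule bounded_linear.has_vector_derivative[OF bounded_linear_snd])
  show "w absolutely_integrable_on {0..S}"
    by (rule abs_cont_on_has_integral_derivative(1)[OF W_ac S(1) W_der])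
qed

section \<open>Comparison of the infima\<close>

text \<open>An infinite generalized cost leaves nothing to show. A finite one supplies the
  integrability that the approximation lemma asks for, and it bounds the cost of every perturbation
  by \<open>e\<close> at once.\<close>

lemma ordinary_inf_le_generalized_cost:
  fixes f :: "real ^ 'n \<Rightarrow> real ^ 'n"
    and g :: "'k::finite \<Rightarrow> real ^ 'n \<Rightarrow> real ^ 'n"
    and L :: "real ^ 'n \<Rightarrow> real ^ 'k \<Rightarrow> real"
  assumes f: "local_lipschitz (UNIV :: real set) UNIV (\<lambda>_. f)"
    and g: "\<And>j. local_lipschitz (UNIV :: real set) UNIV (\<lambda>_. g j)"
    and L1: "continuous_on UNIV L1" and L2: "convex_on UNIV L2" and L: "\<And>x u. L x u = L1 x + L2 u"
    and p: "p \<in> space_time_controls" and def: "generalized_trajectory_defined f g x0 p"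
    and x1: "generalized_trajectory f g x0 p (final_param p) = x1" and "0 < \<epsilon>"
  shows "ordinary_inf L f g x0 x1 \<epsilon> \<le> generalized_cost L f g x0 p"
proof (cases "generalized_cost L f g x0 p = \<infinity>")
  case False
  define S where "S = final_param p"
  define v where "v s = fst (vector_derivative p (at s))" for s
  define w where "w s = snd (vector_derivative p (at s))" for s
  have S: "0 \<le> S" and v: "v absolutely_integrable_on {0..S}" and w: "w absolutely_integrable_on {0..S}"
    and v_ae: "AE s in lebesgue_on {0..S}. 0 \<le> v s" and v_total: "integral {0..S} v = 1"
    using space_time_control_properties[OF p] unfolding S_def v_def w_def by blast+
  obtain y where y: "solution_upto f g x0 v w S y"
    using def unfolding generalized_trajectory_defined_def trajectory_defined_def S_def v_def[abs_def] w_def[abs_def]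
    by blast
  have traj: "generalized_trajectory f g x0 p s = y s" if "s \<in> {0..S}" for s
    using trajectory_eq[OF f g v w y that] unfolding generalized_trajectory_def v_def[abs_def] w_def[abs_def] .
  have yS: "y S = x1" using traj[of S] x1 S by (simp add: S_def)
  have y_cont: "continuous_on {0..S} y" by (rule solution_upto_continuous_on[OF y])
  obtain N where N: "negligible N" and N_nonneg: "\<And>s. s \<in> {0..S} - N \<Longrightarrow> 0 \<le> v s"
    using v_ae unfolding AE_lebesgue_on_Icc_iff by blast
  \<comment> \<open>The derivative of the time component is nonnegative only almost everywhere;
    taking the positive part makes \<open>vp + e\<close> positive everywhere and changes neither the
    trajectory equation nor any integral.\<close>
  define vp where "vp s = max 0 (v s)" for s
  have vp_eq: "vp s = v s" if "s \<in> {0..S} - N" for s using N_nonneg[OF that] by (simp add: vp_def)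
  have vp: "vp absolutely_integrable_on {0..S}"
    by (rule absolutely_integrable_spike[OF v N]) (rule vp_eq)
  have vp_total: "integral {0..S} vp = 1"
    using integral_spike[OF N, of "{0..S}" vp v] vp_eq v_total by simp
  have y': "solution_upto f g x0 vp w S y"
  proof -
    obtain M where "negligible M"
      "\<And>s. s \<in> {0..S} - M \<Longrightarrow> (y has_vector_derivative control_field f g (y s) (v s) (w s)) (at s)"
      using y unfolding solution_upto_def AE_lebesgue_on_Icc_iff by blast
    then have "negligible (N \<union> M) \<and> (\<forall>s\<in>{0..S} - (N \<union> M).
        (y has_vector_derivative control_field f g (y s) (vp s) (w s)) (at s))"
      using N vp_eq by (auto intro: negligible_Un)
    then show ?thesis using y unfolding solution_upto_def AE_lebesgue_on_Icc_iff by blast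
  qed
  obtain K where "0 \<le> K" and K: "\<And>u. - K * (1 + norm u) \<le> L2 u"
    using convex_lower_bound[OF L2] by blast
  define a where "a e s = (vp s + e) * L2 (w s /\<^sub>R (vp s + e))" for e s
  \<comment> \<open>The real-valued minorant of the parametric Lagrangian along \<open>y\<close>; it
    remains finite where the latter is infinite.\<close>
  define k where "k e s = L1 (y s) * vp s + a e s - e * L2 0" for e s
  have ly: "(\<lambda>s. L1 (y s) * vp s) absolutely_integrable_on {0..S}"
    using absolutely_integrable_scaleR_continuous[OF vp continuous_on_compose2[OF L1 y_cont]]
    by (simp add: mult.commute)
  have const_int: "(\<lambda>_. c) absolutely_integrable_on {0..S}" for c :: real
    by (rule absolutely_integrable_on_const) auto
  have k_le: "ereal_integral (lebesgue_on {0..S}) (\<lambda>s. ereal (k e s)) \<le> generalized_cost L f g x0 p" if "0 < e" for e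
    unfolding generalized_cost_def S_def[symmetric]
  proof (rule ereal_integral_mono_AE, unfold AE_lebesgue_on_Icc_iff, intro exI conjI ballI)
    show "negligible N" by (rule N)
    fix s assume s: "s \<in> {0..S} - N"
    then have "ereal (k e s) \<le> parametric_lagrangian L (y s) (v s) (w s)"
      using parametric_lagrangian_ge[of L2 L L1 "v s" e "y s" "w s", OF L2 L N_nonneg[OF s] that] vp_eq[OF s]
      by (simp add: k_def a_def)
    then show "ereal (k e s) \<le> parametric_lagrangian L (generalized_trajectory f g x0 p s)
        (fst (vector_derivative p (at s))) (snd (vector_derivative p (at s)))"
      using traj[of s] s by (simp add: v_def w_def)
  qed
  \<comment> \<open>Below, the linear bound on \<open>L2\<close> gives an integrable minorant;
    above, the finite generalized cost bounds the integral of \<open>k e\<close>. Removing the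
    integrable \<open>L1\<close> and constant terms leaves \<open>a e\<close>.\<close>
  have a_int: "a e absolutely_integrable_on {0..S}" if "0 < e" for e
  proof -
    let ?M = "lebesgue_on {0..S}"
    have pos: "0 < vp s + e" for s using that by (simp add: vp_def)
    have [measurable]: "vp \<in> borel_measurable ?M" "w \<in> borel_measurable ?M"
      using vp w by (auto simp: absolutely_integrable_measurable)
    have "L2 \<in> borel_measurable borel"
      by (rule borel_measurable_continuous_onI[OF convex_on_continuous[OF open_UNIV L2]])
    then have [measurable]: "a e \<in> borel_measurable ?M" unfolding a_def[abs_def] by measurable
    have ly': "integrable ?M (\<lambda>s. L1 (y s) * vp s)"
      by (rule absolutely_integrable_imp_integrable[OF ly]) simp
    then have [measurable]: "(\<lambda>s. L1 (y s) * vp s) \<in> borel_measurable ?M" by simp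
    define r where "r s = \<bar>L1 (y s) * vp s\<bar> + K * (vp s + e + norm (w s)) + e * \<bar>L2 0\<bar>" for s
    have r: "integrable ?M r"
      unfolding r_def[abs_def]
      using ly' absolutely_integrable_imp_integrable[OF vp] absolutely_integrable_imp_integrable[OF w]
        absolutely_integrable_imp_integrable[OF const_int] by auto
    have ge: "- r s \<le> k e s" for s
    proof -
      have "(vp s + e) * (- K * (1 + norm (w s /\<^sub>R (vp s + e)))) \<le> a e s"
        unfolding a_def using pos[of s] by (intro mult_left_mono K) auto
      moreover have "(vp s + e) * (- K * (1 + norm (w s /\<^sub>R (vp s + e)))) = - (K * (vp s + e + norm (w s)))"
        using pos[of s] by (simp add: field_simps)
      moreover have "e * L2 0 \<le> e * \<bar>L2 0\<bar>" using that by (intro mult_left_mono) auto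
      ultimately show ?thesis unfolding k_def r_def by linarith
    qed
    have "integrable ?M (k e)"
    proof (rule integrable_if_ereal_integral_less_top[OF _ r])
      show "k e \<in> borel_measurable ?M" unfolding k_def[abs_def] by measurable
      show "ereal_integral ?M (\<lambda>s. ereal (k e s)) < \<infinity>"
        using k_le[OF that] False by (auto simp: less_top[symmetric] top_ereal_def)
    qed (use ge in auto)
    then have "integrable ?M (\<lambda>s. k e s - L1 (y s) * vp s + e * L2 0)"
      using ly' absolutely_integrable_imp_integrable[OF const_int] by auto
    then have "integrable ?M (a e)" by (simp add: k_def)
    then show ?thesis by (simp add: integrable_restrict_space set_integrable_def)
  qed
  have k_int: "k e absolutely_integrable_on {0..S}" if "0 < e" for e
    unfolding k_def[abs_def] by (intro set_integral_diff set_integral_add ly a_int that const_int)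
  have k_cost: "ereal (integral {0..S} (k e)) \<le> generalized_cost L f g x0 p" if "0 < e" for e
  proof -
    have "integrable (lebesgue_on {0..S}) (k e)"
      by (rule absolutely_integrable_imp_integrable[OF k_int[OF that]]) simp
    then show ?thesis
      using k_le[OF that] by (simp add: ereal_integral_ereal lebesgue_integral_eq_integral)
  qed
  \<comment> \<open>The case distinction excludes \<open>\<infinity>\<close>, and the minorant for
    \<open>e = 1\<close> excludes \<open>-\<infinity>\<close>.\<close>
  obtain r where r: "generalized_cost L f g x0 p = ereal r"
    using k_cost[OF zero_less_one] False by (cases "generalized_cost L f g x0 p") auto
  show ?thesis
  proof (rule ereal_le_epsilon2)
    fix \<delta> :: real assume "0 < \<delta>"
    obtain u x where u: "u absolutely_integrable_on {0..1}" and x: "solution_upto f g x0 (\<lambda>_. 1) u 1 x"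
      and close: "norm (x 1 - y S) \<le> \<epsilon>" and int: "(\<lambda>t. L1 (x t) + L2 (u t)) absolutely_integrable_on {0..1}"
      and cost: "integral {0..1} (\<lambda>t. L1 (x t) + L2 (u t)) \<le> r + \<delta>"
    proof (rule ordinary_control_approximation[OF f g L1 S vp w _ vp_total y' _ _ \<open>0 < \<epsilon>\<close> \<open>0 < \<delta>\<close>, of L2 r])
      show "0 \<le> vp s" for s by (simp add: vp_def)
      show "(\<lambda>s. (vp s + e) * L2 (w s /\<^sub>R (vp s + e))) absolutely_integrable_on {0..S}" if "0 < e" for e
        using a_int[OF that] by (simp add: a_def[abs_def])
      show "integral {0..S} (\<lambda>s. L1 (y s) * vp s + (vp s + e) * L2 (w s /\<^sub>R (vp s + e)) - e * L2 0) \<le> r" if "0 < e" for e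
        using k_cost[OF that] r by (simp add: a_def k_def[abs_def])
    qed
    have one: "(\<lambda>_. 1::real) absolutely_integrable_on {0..1::real}"
      by (rule absolutely_integrable_on_const) auto
    have traj_u: "ordinary_trajectory f g x0 u t = x t" if "t \<in> {0..1}" for t
      unfolding ordinary_trajectory_def by (rule trajectory_eq[OF f g one u x that])
    have "ordinary_inf L f g x0 x1 \<epsilon> \<le> ordinary_cost L f g x0 u"
      unfolding ordinary_inf_def
    proof (intro Inf_lower CollectI exI conjI)
      show "ordinary_trajectory_defined f g x0 u"
        using x unfolding ordinary_trajectory_defined_def trajectory_defined_def by blast
      show "norm (ordinary_trajectory f g x0 u 1 - x1) \<le> \<epsilon>"
        using close traj_u[of 1] yS by simp
    qed (use u in auto)
    also have "ordinary_cost L f g x0 u \<le> ereal_integral (lebesgue_on {0..1}) (\<lambda>t. ereal (L1 (x t) + L2 (u t)))"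
      unfolding ordinary_cost_def
      by (rule ereal_integral_mono_AE) (simp add: AE_lebesgue_on_Icc_iff traj_u L exI[of _ "{}"])
    also have "\<dots> = ereal (integral {0..1} (\<lambda>t. L1 (x t) + L2 (u t)))"
    proof -
      have "integrable (lebesgue_on {0..1}) (\<lambda>t. L1 (x t) + L2 (u t))"
        by (rule absolutely_integrable_imp_integrable[OF int]) simp
      then show ?thesis by (simp add: ereal_integral_ereal lebesgue_integral_eq_integral)
    qed
    also have "\<dots> \<le> generalized_cost L f g x0 p + ereal \<delta>" using cost r by simp
    finally show "ordinary_inf L f g x0 x1 \<epsilon> \<le> generalized_cost L f g x0 p + ereal \<delta>" .
  qed
qed simp

theorem proposition40:
  fixes f :: "real ^ 'n \<Rightarrow> real ^ 'n"
    and g :: "'k::finite \<Rightarrow> real ^ 'n \<Rightarrow> real ^ 'n"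
    and x0 x1 :: "real ^ 'n"
    and L :: "real ^ 'n \<Rightarrow> real ^ 'k \<Rightarrow> real"
    and L1 :: "real ^ 'n \<Rightarrow> real"
    and L2 :: "real ^ 'k \<Rightarrow> real"
  assumes "local_lipschitz (UNIV :: real set) UNIV (\<lambda>_. f)"
    and "\<And>j. local_lipschitz (UNIV :: real set) UNIV (\<lambda>_. g j)"
    and "continuous_on UNIV L1"
    and "convex_on UNIV L2"
    and "\<And>x u. L x u = L1 x + L2 u"
  shows "\<not> lavrentiev_gap L f g x0 x1"
proof -
  have le: "ordinary_inf L f g x0 x1 \<epsilon> \<le> generalized_inf L f g x0 x1" if "0 < \<epsilon>" for \<epsilon>
    unfolding generalized_inf_def
  proof (rule Inf_greatest, clarify)
    fix c p
    assume "c \<in> generalized_controls" "p \<in> c" "generalized_trajectory_defined f g x0 p"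
      "x1 = generalized_trajectory f g x0 p (final_param p)"
    moreover have "p \<in> space_time_controls"
      using \<open>c \<in> generalized_controls\<close> \<open>p \<in> c\<close> by (auto simp: generalized_controls_def quotient_def)
    ultimately show "ordinary_inf L f g x0 (generalized_trajectory f g x0 p (final_param p)) \<epsilon>
        \<le> generalized_cost L f g x0 p"
      using assms that by (intro ordinary_inf_le_generalized_cost) auto
  qed
  \<comment> \<open>A larger tolerance admits more controls, so the limit defining the gap exists
    and is a supremum, to which the bound for each tolerance applies.\<close>
  have "(ordinary_inf L f g x0 x1 \<longlongrightarrow> (SUP \<epsilon>\<in>{0<..}. ordinary_inf L f g x0 x1 \<epsilon>)) (at_right 0)"
  proof (rule tendsto_SUP_at_right_0)
    fix a b :: real assume "a \<le> b"
    then show "ordinary_inf L f g x0 x1 b \<le> ordinary_inf L f g x0 x1 a"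
      unfolding ordinary_inf_def by (intro Inf_superset_mono) (auto intro: order_trans)
  qed
  then have "Lim (at_right 0) (ordinary_inf L f g x0 x1) = (SUP \<epsilon>\<in>{0<..}. ordinary_inf L f g x0 x1 \<epsilon>)"
    by (intro tendsto_Lim) auto
  also have "\<dots> \<le> generalized_inf L f g x0 x1" using le by (intro SUP_least) auto
  finally show ?thesis by (simp add: lavrentiev_gap_def)
qed

end
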